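(* Fix $\beta>0$. Assume the regularity assumption (R), the local quotient manifold assumption (Q) at $\theta^\star$, and the identifiability/nondegeneracy assumption (I) at $(\theta^\star,\beta)$, all stated in the context. Let $y_1,y_2,\dots$ be i.i.d. with density $p_{\theta^\star,\beta}$, let $\mathcal Y=\{y_i\}_{i=1}^n$, and let $\widehat\theta_{\mathrm{MLE}}=\widehat\theta_{\mathrm{MLE}}(\mathcal Y)$ be any maximizer over $\theta\in\Theta$ of $\mathcal L_n(\theta;\mathcal Y)=\frac1n\sum_{i=1}^n\log p_{\theta,\beta}(y_i)$. Then: 1. (Consistency on the quotient) as $n\to\infty$, $d_{\mathrm{eq}}(\widehat\theta_{\mathrm{MLE}},\theta^\star)\to 0$ in probability. 2. (Asymptotic normality and efficiency) there exists a choice of representatives $\widetilde\theta_{\mathrm{MLE}}\in[\widehat\theta_{\mathrm{MLE}}]$ such that $\widetilde\theta_{\mathrm{MLE}}\to\theta^\star$ in probability and $$\sqrt n\,\Pi_W\bigl(\widetilde\theta_{\mathrm{MLE}}-\theta^\star\bigr)\xrightarrow{\ \mathcal D\ }\mathcal N\bigl(0,\mathcal I_{\mathrm{obs}}^{(W)}(\theta^\star;\beta)^{-1}\bigr).$$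
   Context: Model. Fix integers $d,m\ge 1$ and $\sigma>0$. Let $(\mathcal Z,\mathcal F,\mu)$ be a probability space, $A:\mathcal Z\to\mathbb R^{d\times m}$ a measurable map with $\mathbb E_{Z\sim\mu}\|A(Z)\|_{\mathrm{op}}^2<\infty$, $\Theta\subseteq\mathbb R^m$ a $C^2$ embedded submanifold of dimension $m$, and $\theta^\star\in\Theta$. For $\theta\in\Theta$ and $\beta\ge0$ let $p_{\theta,\beta}(y)=\int_{\mathcal Z}\varphi_\sigma(y-\beta A(z)\theta)\,\mu(dz)$, where $\varphi_\sigma$ is the density of $\mathcal N(0,\sigma^2I_d)$; this is the density of $Y=\beta A(Z)\theta+\sigma\xi$ with $Z\sim\mu$, $\xi\sim\mathcal N(0,I_d)$ independent. (R) $\Theta$ is compact; there is $a_{\max}<\infty$ with $\|A(z)\|_{\mathrm{op}}\le a_{\max}$ for a.e. $z$; and $\mathbb E_{Z\sim\mu}[A(Z)^\top A(Z)]$ is positive definite. Equivalence. For $\theta,\theta'\in\Theta$ write $\theta\sim\theta'$ if $p_{\theta,\beta}=p_{\theta',\beta}$ a.e. (equivalently, $A(Z)\theta$ and $A(Z)\theta'$ have the same law under $Z\sim\mu$). $[\theta]=\{\theta'\in\Theta:\theta'\sim\theta\}$. Define $d_{\mathrm{eq}}(\theta_0,\theta_1)=\inf\{\|\theta_0'-\theta_1'\|:\theta_0'\in[\theta_0],\theta_1'\in[\theta_1]\}$. (Q) There is an open neighborhood $U_\star\subset\Theta$ of $\theta^\star$ such that the quotient $U_\star/{\sim}$ admits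 a $C^2$ manifold structure for which the canonical projection $U_\star\to U_\star/{\sim}$, $\theta\mapsto[\theta]$, is a $C^2$ submersion. Tangent and normal space. $T(\theta^\star)$ is the tangent space at $\theta^\star$ to $[\theta^\star]$, i.e. the set of $\dot\gamma(0)$ for $C^1$ curves $\gamma:(-\varepsilon,\varepsilon)\to[\theta^\star]$ with $\gamma(0)=\theta^\star$; $W=T(\theta^\star)^\perp\subset\mathbb R^m$ (Euclidean orthogonal complement) and $\Pi_W$ is the orthogonal projector onto $W$. Fisher information. $\mathcal I_{\mathrm{obs}}(\theta;\beta)=\mathbb E_{Y\sim p_{\theta,\beta}}[\nabla_\theta\log p_{\theta,\beta}(Y)\nabla_\theta\log p_{\theta,\beta}(Y)^\top]$, and $\mathcal I^{(W)}_{\mathrm{obs}}(\theta^\star;\beta):W\to W$ is the self-adjoint operator with $\langle h,\mathcal I^{(W)}_{\mathrm{obs}}(\theta^\star;\beta)g\rangle=h^\top\mathcal I_{\mathrm{obs}}(\theta^\star;\beta)g$ for $h,g\in W$. (I) (i) With $\mathcal L(\theta;\theta^\star,\beta)=\mathbb E_{Y\sim p_{\theta^\star,\beta}}[\log p_{\theta,\beta}(Y)]$, the function $\mathcal L(\cdot;\theta^\star,\beta)$ is uniquely maximized on $\Theta$ at the equivalence class $[\theta^\star]$, i.e. for $\theta\in\Theta$, $\mathcal L(\theta;\theta^\star,\beta)=\mathcal L(\theta^\star;\theta^\star,\beta)$ if and only if $\theta\sim\theta^\star$. (ii) $\mathcal I^{(W)}_{\mathrm{obs}}(\theta^\star;\beta)$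 is positive definite on $W$, i.e. $w^\top\mathcal I_{\mathrm{obs}}(\theta^\star;\beta)w>0$ for every $0\ne w\in W$.
   Formalization: Θ may have a boundary (a compact full-dimensional submanifold without one cannot exist), with U⋆ open in ℝ^m; (Q) also requires U⋆/∼ to be open in Θ/∼ with the topology of Θ/∼, since otherwise classes near [θ⋆] need not meet U⋆ and part 2 fails. *)

theory Defs
  imports "HOL-Probability.Probability"
begin

section \<open>Linear algebra\<close>

definition orth_proj :: "'a::euclidean_space set \<Rightarrow> 'a \<Rightarrow> 'a" where
  "orth_proj W x = (THE w. w \<in> W \<and> x - w \<in> W\<^sup>\<bottom>)"

definition pos_def :: "real^'m^'m \<Rightarrow> bool" where
  "pos_def S \<longleftrightarrow> transpose S = S \<and> (\<forall>x. x \<noteq> 0 \<longrightarrow> x \<bullet> (S *v x) > 0)"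

lemma orth_proj_eqI:
  assumes W: "subspace W" and w: "w \<in> W" "x - w \<in> W\<^sup>\<bottom>"
  shows "orth_proj W x = w"
  unfolding orth_proj_def
proof (rule the_equality)
  show "w \<in> W \<and> x - w \<in> W\<^sup>\<bottom>" using w by simp
next
  fix v assume v: "v \<in> W \<and> x - v \<in> W\<^sup>\<bottom>"
  have "v - w \<in> W" using W v w by (simp add: subspace_diff)
  then have "(v - w) \<bullet> (x - w) = 0" "(v - w) \<bullet> (x - v) = 0"
    using v w by (auto simp: orthogonal_comp_def orthogonal_def)
  then have "(v - w) \<bullet> (v - w) = 0"
    by (simp add: inner_diff_right)
  then show "v = w" by simp
qed

lemma orth_proj_props:
  assumes "subspace W"
  shows "orth_proj W x \<in> W" "x - orth_proj W x \<in> W\<^sup>\<bottom>"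
proof -
  obtain w z where wz: "w \<in> span W" "\<And>v. v \<in> span W \<Longrightarrow> orthogonal z v" "x = w + z"
    using orthogonal_subspace_decomp_exists by metis
  have sW: "span W = W" using assms by (simp add: span_eq_iff)
  have "x - w \<in> W\<^sup>\<bottom>"
    using wz sW by (auto simp: orthogonal_comp_def orthogonal_commute)
  then have "orth_proj W x = w"
    using orth_proj_eqI assms wz(1) sW by metis
  then show "orth_proj W x \<in> W" "x - orth_proj W x \<in> W\<^sup>\<bottom>"
    using wz(1) sW \<open>x - w \<in> W\<^sup>\<bottom>\<close> by auto
qed

section \<open>Twice continuously differentiable maps and submanifolds of full dimension\<close>

definition C2_on :: "('a::euclidean_space \<Rightarrow> 'b::euclidean_space) \<Rightarrow> 'a set \<Rightarrow> bool" where
  "C2_on f S \<longleftrightarrow> open S \<and>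
     (\<exists>(f' :: 'a \<Rightarrow> 'a \<Rightarrow>\<^sub>L 'b) (f'' :: 'a \<Rightarrow> 'a \<Rightarrow>\<^sub>L 'a \<Rightarrow>\<^sub>L 'b).
        (\<forall>x\<in>S. (f has_derivative blinfun_apply (f' x)) (at x) \<and>
               (f' has_derivative blinfun_apply (f'' x)) (at x)) \<and>
        continuous_on S f'')"

text \<open>A \<open>C\<^sup>2\<close> embedded submanifold, of full dimension, of a Euclidean space. A boundary is allowed
  (but not required): near each of its points \<open>\<Theta>\<close> is flattened by a \<open>C\<^sup>2\<close> diffeomorphism onto a
  relatively open subset of a closed half-space, interior points being those mapped off the
  bounding hyperplane. Without boundary such a set would be open, hence
  never both compact and nonempty.\<close>

definition C2_full_submanifold :: "'a::euclidean_space set \<Rightarrow> bool" where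
  "C2_full_submanifold \<Theta> \<longleftrightarrow>
     (\<forall>x\<in>\<Theta>. \<exists>V \<phi> \<psi> b. x \<in> V \<and> C2_on \<phi> V \<and> C2_on \<psi> (\<phi> ` V) \<and> (\<forall>v\<in>V. \<psi> (\<phi> v) = v) \<and>
        b \<in> Basis \<and> \<phi> ` (\<Theta> \<inter> V) = \<phi> ` V \<inter> {u::'a. 0 \<le> u \<bullet> b})"

section \<open>Abstract \<open>C\<^sup>2\<close> manifolds, submersions, quotient spaces\<close>

text \<open>Charts are pairs \<open>(D, \<phi>)\<close> with values in a fixed linear subspace \<open>E\<close>, whose dimension is that
  of the manifold; using a subspace lets the dimension be quantified over. A map on a relatively
  open subset of \<open>E\<close> is \<open>C\<^sup>2\<close> iff its composition with the orthogonal projection onto \<open>E\<close> is.\<close>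

definition C2_manifold ::
  "'q topology \<Rightarrow> 'a::euclidean_space set \<Rightarrow> ('q set \<times> ('q \<Rightarrow> 'a)) set \<Rightarrow> bool" where
  "C2_manifold X E \<A> \<longleftrightarrow>
     Hausdorff_space X \<and> second_countable X \<and> subspace E \<and>
     (\<forall>(D, \<phi>)\<in>\<A>. openin X D \<and> openin (top_of_set E) (\<phi> ` D) \<and>
        homeomorphic_map (subtopology X D) (top_of_set (\<phi> ` D)) \<phi>) \<and>
     (\<Union>(D, \<phi>)\<in>\<A>. D) = topspace X \<and>
     (\<forall>(D\<^sub>1, \<phi>\<^sub>1)\<in>\<A>. \<forall>(D\<^sub>2, \<phi>\<^sub>2)\<in>\<A>.
        C2_on (\<lambda>u. \<phi>\<^sub>2 (inv_into D\<^sub>1 \<phi>\<^sub>1 (orth_proj E u))) {u. orth_proj E u \<in> \<phi>\<^sub>1 ` (D\<^sub>1 \<inter> D\<^sub>2)})"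

definition C2_submersion ::
  "'b::euclidean_space set \<Rightarrow> 'q topology \<Rightarrow> 'a::euclidean_space set \<Rightarrow> ('q set \<times> ('q \<Rightarrow> 'a)) set \<Rightarrow>
   ('b \<Rightarrow> 'q) \<Rightarrow> bool" where
  "C2_submersion U X E \<A> \<pi> \<longleftrightarrow>
     continuous_map (top_of_set U) X \<pi> \<and>
     (\<forall>(D, \<phi>)\<in>\<A>. C2_on (\<phi> \<circ> \<pi>) {u\<in>U. \<pi> u \<in> D} \<and>
        (\<forall>u\<in>U. \<pi> u \<in> D \<longrightarrow> range (frechet_derivative (\<phi> \<circ> \<pi>) (at u)) = E))"

definition quotient_topology :: "'a topology \<Rightarrow> ('a \<Rightarrow> 'q) \<Rightarrow> 'q topology" where
  "quotient_topology X \<pi> =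
     topology (\<lambda>S. S \<subseteq> \<pi> ` topspace X \<and> openin X {x \<in> topspace X. \<pi> x \<in> S})"

lemma openin_quotient_topology:
  "openin (quotient_topology X \<pi>) S \<longleftrightarrow>
     S \<subseteq> \<pi> ` topspace X \<and> openin X {x \<in> topspace X. \<pi> x \<in> S}"
proof -
  have "istopology (\<lambda>S. S \<subseteq> \<pi> ` topspace X \<and> openin X {x \<in> topspace X. \<pi> x \<in> S})"
    unfolding istopology_def
  proof (intro conjI allI impI; (elim conjE)?)
    fix S T
    assume "openin X {x \<in> topspace X. \<pi> x \<in> S}" "openin X {x \<in> topspace X. \<pi> x \<in> T}"
    then have "openin X ({x \<in> topspace X. \<pi> x \<in> S} \<inter> {x \<in> topspace X. \<pi> x \<in> T})"
      by blast
    then show "openin X {x \<in> topspace X. \<pi> x \<in> S \<inter> T}"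
      by (rule back_subst) auto
  next
    fix K assume "\<forall>S\<in>K. S \<subseteq> \<pi> ` topspace X \<and> openin X {x \<in> topspace X. \<pi> x \<in> S}"
    then have "openin X (\<Union>S\<in>K. {x \<in> topspace X. \<pi> x \<in> S})"
      by blast
    then show "openin X {x \<in> topspace X. \<pi> x \<in> \<Union>K}"
      by (rule back_subst) auto
  qed auto
  then show ?thesis
    by (simp add: quotient_topology_def)
qed

lemma quotient_map_quotient_topology: "quotient_map X (quotient_topology X \<pi>) \<pi>"
proof -
  have "topspace (quotient_topology X \<pi>) = \<pi> ` topspace X"
  proof
    show "topspace (quotient_topology X \<pi>) \<subseteq> \<pi> ` topspace X"
      using openin_quotient_topology[of X \<pi>] openin_topspace by blast
    have "{x \<in> topspace X. \<pi> x \<in> \<pi> ` topspace X} = topspace X" by auto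
    then have "openin (quotient_topology X \<pi>) (\<pi> ` topspace X)"
      by (simp add: openin_quotient_topology)
    then show "\<pi> ` topspace X \<subseteq> topspace (quotient_topology X \<pi>)"
      by (rule openin_subset)
  qed
  then show ?thesis
    by (auto simp: quotient_map_def openin_quotient_topology)
qed

section \<open>Gaussian laws and modes of convergence\<close>

text \<open>Density of \<open>N(0, s\<^sup>2 I)\<close>.\<close>

definition gauss_density :: "real \<Rightarrow> 'a::euclidean_space \<Rightarrow> real" where
  "gauss_density s x = (\<Prod>b\<in>Basis. normal_density 0 s (x \<bullet> b))"

text \<open>\<open>\<nu>\<close> is \<open>N(0, C)\<close>, with a possibly singular covariance operator \<open>C\<close>: the law of \<open>L \<xi>\<close> for a
  standard Gaussian vector \<open>\<xi>\<close> and a linear map \<open>L\<close> with \<open>L L\<^sup>T = C\<close>.\<close>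

definition centred_normal :: "('a::euclidean_space \<Rightarrow> 'a) \<Rightarrow> 'a measure \<Rightarrow> bool" where
  "centred_normal C \<nu> \<longleftrightarrow>
     (\<exists>L :: 'a \<Rightarrow> 'a. linear L \<and> L \<circ> adjoint L = C \<and>
        \<nu> = distr (density lborel (\<lambda>x. ennreal (gauss_density 1 x))) borel L)"

text \<open>Measurability is part of both notions of convergence, since \<open>measure\<close> and the integral
  are 0 by convention on non-measurable arguments.\<close>

definition conv_in_prob ::
  "'w measure \<Rightarrow> (nat \<Rightarrow> 'w \<Rightarrow> 'a::euclidean_space) \<Rightarrow> 'a \<Rightarrow> bool" where
  "conv_in_prob N X c \<longleftrightarrow>
     (\<forall>n. X n \<in> borel_measurable N) \<and>
     (\<forall>\<epsilon>>0. (\<lambda>n. measure N {\<omega> \<in> space N. dist (X n \<omega>) c > \<epsilon>}) \<longlonglongrightarrow> 0)"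

definition conv_in_dist ::
  "'w measure \<Rightarrow> (nat \<Rightarrow> 'w \<Rightarrow> 'a::euclidean_space) \<Rightarrow> 'a measure \<Rightarrow> bool" where
  "conv_in_dist N X \<nu> \<longleftrightarrow>
     (\<forall>n. X n \<in> borel_measurable N) \<and>
     (\<forall>f :: 'a \<Rightarrow> real. continuous_on UNIV f \<and> bounded (range f) \<longrightarrow>
        (\<lambda>n. \<integral>\<omega>. f (X n \<omega>) \<partial>N) \<longlonglongrightarrow> (\<integral>x. f x \<partial>\<nu>))"

section \<open>The observation model\<close>

text \<open>\<open>obs_dens M A \<sigma> \<beta> \<theta>\<close> is the density of \<open>\<beta> A(Z) \<theta> + \<sigma> \<xi>\<close>, where \<open>Z\<close> has law \<open>M\<close>.\<close>

definition obs_dens ::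
  "'z measure \<Rightarrow> ('z \<Rightarrow> real^'m^'d) \<Rightarrow> real \<Rightarrow> real \<Rightarrow> real^'m \<Rightarrow> real^'d \<Rightarrow> real" where
  "obs_dens M A \<sigma> \<beta> \<theta> y = (\<integral>z. gauss_density \<sigma> (y - \<beta> *\<^sub>R (A z *v \<theta>)) \<partial>M)"

definition obs_law ::
  "'z measure \<Rightarrow> ('z \<Rightarrow> real^'m^'d) \<Rightarrow> real \<Rightarrow> real \<Rightarrow> real^'m \<Rightarrow> (real^'d) measure" where
  "obs_law M A \<sigma> \<beta> \<theta> = density lborel (\<lambda>y. ennreal (obs_dens M A \<sigma> \<beta> \<theta> y))"

definition obs_equiv ::
  "'z measure \<Rightarrow> ('z \<Rightarrow> real^'m^'d) \<Rightarrow> real \<Rightarrow> real \<Rightarrow> real^'m \<Rightarrow> real^'m \<Rightarrow> bool" where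
  "obs_equiv M A \<sigma> \<beta> \<theta> \<theta>' \<longleftrightarrow>
     (AE y in lborel. obs_dens M A \<sigma> \<beta> \<theta> y = obs_dens M A \<sigma> \<beta> \<theta>' y)"

definition obs_class ::
  "'z measure \<Rightarrow> ('z \<Rightarrow> real^'m^'d) \<Rightarrow> real \<Rightarrow> real \<Rightarrow> (real^'m) set \<Rightarrow> real^'m \<Rightarrow> (real^'m) set" where
  "obs_class M A \<sigma> \<beta> \<Theta> \<theta> = {\<theta>' \<in> \<Theta>. obs_equiv M A \<sigma> \<beta> \<theta>' \<theta>}"

definition d_eq ::
  "'z measure \<Rightarrow> ('z \<Rightarrow> real^'m^'d) \<Rightarrow> real \<Rightarrow> real \<Rightarrow> (real^'m) set \<Rightarrow> real^'m \<Rightarrow> real^'m \<Rightarrow> real" where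
  "d_eq M A \<sigma> \<beta> \<Theta> \<theta>\<^sub>0 \<theta>\<^sub>1 =
     Inf {norm (a - b) | a b. a \<in> obs_class M A \<sigma> \<beta> \<Theta> \<theta>\<^sub>0 \<and> b \<in> obs_class M A \<sigma> \<beta> \<Theta> \<theta>\<^sub>1}"

text \<open>The velocities at \<open>\<theta>\<close> of the \<open>C\<^sup>1\<close> curves through \<open>\<theta>\<close> that stay in the class of \<open>\<theta>\<close>.\<close>

definition class_tangent ::
  "'z measure \<Rightarrow> ('z \<Rightarrow> real^'m^'d) \<Rightarrow> real \<Rightarrow> real \<Rightarrow> (real^'m) set \<Rightarrow> real^'m \<Rightarrow> (real^'m) set" where
  "class_tangent M A \<sigma> \<beta> \<Theta> \<theta> =
     {v. \<exists>\<epsilon>>0. \<exists>\<gamma>. \<gamma> C1_differentiable_on {-\<epsilon><..<\<epsilon>} \<and> \<gamma> ` {-\<epsilon><..<\<epsilon>} \<subseteq> obs_class M A \<sigma> \<beta> \<Theta> \<theta> \<and>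
        \<gamma> 0 = \<theta> \<and> v = vector_derivative \<gamma> (at 0)}"

definition class_normal ::
  "'z measure \<Rightarrow> ('z \<Rightarrow> real^'m^'d) \<Rightarrow> real \<Rightarrow> real \<Rightarrow> (real^'m) set \<Rightarrow> real^'m \<Rightarrow> (real^'m) set" where
  "class_normal M A \<sigma> \<beta> \<Theta> \<theta> = (class_tangent M A \<sigma> \<beta> \<Theta> \<theta>)\<^sup>\<bottom>"

definition score ::
  "'z measure \<Rightarrow> ('z \<Rightarrow> real^'m^'d) \<Rightarrow> real \<Rightarrow> real \<Rightarrow> real^'m \<Rightarrow> real^'d \<Rightarrow> real^'m" where
  "score M A \<sigma> \<beta> \<theta> y = (THE g. GDERIV (\<lambda>t. ln (obs_dens M A \<sigma> \<beta> t y)) \<theta> :> g)"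

definition fisher_obs ::
  "'z measure \<Rightarrow> ('z \<Rightarrow> real^'m^'d) \<Rightarrow> real \<Rightarrow> real \<Rightarrow> real^'m \<Rightarrow> real^'m^'m" where
  "fisher_obs M A \<sigma> \<beta> \<theta> =
     (\<chi> i j. \<integral>y. score M A \<sigma> \<beta> \<theta> y $ i * score M A \<sigma> \<beta> \<theta> y $ j \<partial>obs_law M A \<sigma> \<beta> \<theta>)"

text \<open>The compression of an operator to a subspace \<open>W\<close>; \<open>inner_compression\<close> shows that it represents
  the bilinear form of \<open>S\<close> on \<open>W\<close>.\<close>

definition compression :: "real^'m^'m \<Rightarrow> (real^'m) set \<Rightarrow> real^'m \<Rightarrow> real^'m" where
  "compression S W g = orth_proj W (S *v g)"

lemma compression_in: "subspace W \<Longrightarrow> compression S W g \<in> W"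
  by (simp add: compression_def orth_proj_props)

lemma inner_compression:
  assumes "subspace W" "h \<in> W"
  shows "h \<bullet> compression S W g = h \<bullet> (S *v g)"
  using orth_proj_props(2)[OF assms(1), of "S *v g"] assms(2)
  by (auto simp: compression_def orthogonal_comp_def orthogonal_def inner_diff_right)

definition fisher_W ::
  "'z measure \<Rightarrow> ('z \<Rightarrow> real^'m^'d) \<Rightarrow> real \<Rightarrow> real \<Rightarrow> (real^'m) set \<Rightarrow> real^'m \<Rightarrow> real^'m \<Rightarrow> real^'m" where
  "fisher_W M A \<sigma> \<beta> \<Theta> \<theta> = compression (fisher_obs M A \<sigma> \<beta> \<theta>) (class_normal M A \<sigma> \<beta> \<Theta> \<theta>)"

text \<open>The inverse of \<open>fisher_W\<close> as a map from \<open>W\<close> to \<open>W\<close>, extended by 0 on the orthogonal complement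
  of \<open>W\<close>: a Gaussian law on \<open>W\<close> is thus regarded as a law on the ambient space.\<close>

definition fisher_W_inverse ::
  "'z measure \<Rightarrow> ('z \<Rightarrow> real^'m^'d) \<Rightarrow> real \<Rightarrow> real \<Rightarrow> (real^'m) set \<Rightarrow> real^'m \<Rightarrow> real^'m \<Rightarrow> real^'m" where
  "fisher_W_inverse M A \<sigma> \<beta> \<Theta> \<theta> u =
     (let W = class_normal M A \<sigma> \<beta> \<Theta> \<theta>
      in inv_into W (fisher_W M A \<sigma> \<beta> \<Theta> \<theta>) (orth_proj W u))"

definition pop_loglik ::
  "'z measure \<Rightarrow> ('z \<Rightarrow> real^'m^'d) \<Rightarrow> real \<Rightarrow> real \<Rightarrow> real^'m \<Rightarrow> real^'m \<Rightarrow> real" where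
  "pop_loglik M A \<sigma> \<beta> \<theta>s \<theta> = (\<integral>y. ln (obs_dens M A \<sigma> \<beta> \<theta> y) \<partial>obs_law M A \<sigma> \<beta> \<theta>s)"

definition emp_loglik ::
  "'z measure \<Rightarrow> ('z \<Rightarrow> real^'m^'d) \<Rightarrow> real \<Rightarrow> real \<Rightarrow> nat \<Rightarrow> (nat \<Rightarrow> real^'d) \<Rightarrow> real^'m \<Rightarrow> real" where
  "emp_loglik M A \<sigma> \<beta> n y \<theta> = 1 / real n * (\<Sum>i<n. ln (obs_dens M A \<sigma> \<beta> \<theta> (y i)))"

section \<open>Standing assumptions\<close>

definition obs_model ::
  "'z measure \<Rightarrow> ('z \<Rightarrow> real^'m^'d) \<Rightarrow> real \<Rightarrow> (real^'m) set \<Rightarrow> real^'m \<Rightarrow> bool" where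
  "obs_model M A \<sigma> \<Theta> \<theta>s \<longleftrightarrow>
     prob_space M \<and> \<sigma> > 0 \<and> A \<in> borel_measurable M \<and>
     integrable M (\<lambda>z. (onorm (\<lambda>x. A z *v x))\<^sup>2) \<and>
     C2_full_submanifold \<Theta> \<and> \<theta>s \<in> \<Theta>"

definition assumption_R :: "'z measure \<Rightarrow> ('z \<Rightarrow> real^'m^'d) \<Rightarrow> (real^'m) set \<Rightarrow> bool" where
  "assumption_R M A \<Theta> \<longleftrightarrow>
     compact \<Theta> \<and>
     (\<exists>amax. AE z in M. onorm (\<lambda>x. A z *v x) \<le> amax) \<and>
     pos_def (\<integral>z. transpose (A z) ** A z \<partial>M)"

text \<open>The quotient \<open>U/\<sim>\<close> is the set of classes \<open>[\<theta>]\<close>, \<open>\<theta> \<in> U\<close>, where \<open>[\<theta>]\<close> is the full class in \<open>\<Theta>\<close>; it is an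
  open part of the quotient space \<open>\<Theta>/\<sim>\<close> and carries the topology of the latter, so that classes
  close to \<open>[\<theta>s]\<close> in \<open>\<Theta>/\<sim>\<close> have a representative in \<open>U\<close>. As for a submanifold without boundary,
  \<open>U\<close> is open in the ambient space.\<close>

definition assumption_Q ::
  "'z measure \<Rightarrow> ('z \<Rightarrow> real^'m^'d) \<Rightarrow> real \<Rightarrow> real \<Rightarrow> (real^'m) set \<Rightarrow> real^'m \<Rightarrow> bool" where
  "assumption_Q M A \<sigma> \<beta> \<Theta> \<theta>s \<longleftrightarrow>
     (let cls = obs_class M A \<sigma> \<beta> \<Theta>;
          Q = quotient_topology (top_of_set \<Theta>) cls
      in \<exists>U. open U \<and> \<theta>s \<in> U \<and> U \<subseteq> \<Theta> \<and> openin Q (cls ` U) \<and>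
           (\<exists>(E :: (real^'m) set) \<A>. C2_manifold (subtopology Q (cls ` U)) E \<A> \<and>
              C2_submersion U (subtopology Q (cls ` U)) E \<A> cls))"

definition assumption_I ::
  "'z measure \<Rightarrow> ('z \<Rightarrow> real^'m^'d) \<Rightarrow> real \<Rightarrow> real \<Rightarrow> (real^'m) set \<Rightarrow> real^'m \<Rightarrow> bool" where
  "assumption_I M A \<sigma> \<beta> \<Theta> \<theta>s \<longleftrightarrow>
     (\<forall>\<theta>\<in>\<Theta>. pop_loglik M A \<sigma> \<beta> \<theta>s \<theta> \<le> pop_loglik M A \<sigma> \<beta> \<theta>s \<theta>s \<and>
        (pop_loglik M A \<sigma> \<beta> \<theta>s \<theta> = pop_loglik M A \<sigma> \<beta> \<theta>s \<theta>s \<longleftrightarrow> obs_equiv M A \<sigma> \<beta> \<theta> \<theta>s)) \<and>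
     (\<forall>w\<in>class_normal M A \<sigma> \<beta> \<Theta> \<theta>s. w \<noteq> 0 \<longrightarrow> w \<bullet> (fisher_obs M A \<sigma> \<beta> \<theta>s *v w) > 0)"

end

theory Submission
  imports Defs
begin

text \<open>Near \<open>[\<theta>s]\<close> the quotient map has a local section with values in \<open>\<theta>s + W\<close>, and the tangent space of the
  class is the kernel of the differential of the quotient map; the representative of the estimator is
  its image under this section. The log-likelihood of one observation is Lipschitz in \<open>\<theta>\<close> with a constant
  of linear growth in the observation, so Wald's argument gives consistency: the estimator leaves
  every compact set of parameters not equivalent to \<open>\<theta>s\<close>. The representative maximizes the likelihood
  over \<open>\<theta>s + W\<close> near \<open>\<theta>s\<close>, where the log-likelihood has a Taylor expansion of order two with a cubic
  remainder of polynomial growth in the observation. The law of large numbers turns the second-order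
  term into minus the Fisher information, and comparing the representative with the maximizer of the
  resulting quadratic function shows that the rescaled error is, up to a term tending to 0 in
  probability, the inverse information applied to the normalized sum of the scores. The limit law follows
  from the one-dimensional central limit theorem through characteristic functions.\<close>

section \<open>Averages of independent identically distributed vectors\<close>

text \<open>Along the class of \<open>\<theta>s\<close> the density does not change, so the
  information vanishes in the tangent directions and only the slice \<open>\<theta>s + W\<close> is
  identified to first order. The estimator may sit anywhere near the whole class, far from
  \<open>\<theta>s\<close> itself; hence the section has to live on a neighbourhood of the class and
  to depend on the class only. The representative is never treated as a zero of the score: its
  optimality over the slice enters through a comparison of maxima, so the Hessian is needed at
  \<open>\<theta>s\<close> alone and the remainder costs a single sample mean, that of
  \<open>(1 + norm v) ^ 3\<close>. All bounds on the log-density come from one-variable calculus: on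
  a line \<open>\<theta> + t w\<close> the Gaussian exponent is quadratic in \<open>t\<close>, and
  the derivatives of the log-density are polynomials in averages under a probability measure on the
  latent space, so that the size of the density never enters. In the limit law the obstacle is that
  a polynomial approximation of a test function is unbounded; polynomials in sines are bounded, and
  tightness controls the region where they fail to approximate.\<close>

lemma (in prob_space) iid_mean_square_deviation:
  fixes X :: "nat \<Rightarrow> 'a \<Rightarrow> 'b::euclidean_space"
  assumes indep: "indep_vars (\<lambda>_. borel) X UNIV"
    and distr: "\<And>i. distr M borel (X i) = \<mu>"
    and sq: "integrable \<mu> (\<lambda>x. (norm x)\<^sup>2)"
    and n: "n > 0"
  defines "m \<equiv> \<integral>x. x \<partial>\<mu>"
  shows "integrable M (\<lambda>\<omega>. (norm ((1 / real n) *\<^sub>R (\<Sum>i<n. X i \<omega>) - m))\<^sup>2)"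
    and "expectation (\<lambda>\<omega>. (norm ((1 / real n) *\<^sub>R (\<Sum>i<n. X i \<omega>) - m))\<^sup>2) =
      (\<integral>x. (norm (x - m))\<^sup>2 \<partial>\<mu>) / real n"
proof -
  have rv[measurable]: "random_variable borel (X i)" for i
    using indep unfolding indep_vars_def2 by simp
  have \<mu>: "prob_space \<mu>" "sets \<mu> = sets borel" "space \<mu> = UNIV"
    using distr[of 0] by (auto simp flip: distr[of 0] intro!: prob_space_distr)
  interpret \<mu>: prob_space \<mu> by fact
  have id\<mu>: "(\<lambda>x. x) \<in> borel_measurable \<mu>" by (simp add: measurable_ident_sets \<mu>)
  have nle: "norm x \<le> 1 + (norm x)\<^sup>2" for x :: 'b
    using zero_le_power2[of "norm x - 1"] by (simp add: power2_eq_square algebra_simps)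
      (smt (verit) norm_ge_zero zero_le_mult_iff)
  have int1: "integrable \<mu> (\<lambda>x. x)"
    by (rule Bochner_Integration.integrable_bound[of _ "\<lambda>x. 1 + (norm x)\<^sup>2"])
       (use sq id\<mu> nle in \<open>auto intro!: AE_I2\<close>)
  define Z where "Z i \<omega> = X i \<omega> - m" for i \<omega>
  have [measurable]: "random_variable borel (Z i)" for i unfolding Z_def by measurable
  have norm2: "(norm (x - m))\<^sup>2 \<le> 2 * (norm x)\<^sup>2 + 2 * (norm m)\<^sup>2" for x :: 'b
    using norm_triangle_ineq4[of x m] zero_le_power2[of "norm x - norm m"]
    by (smt (verit) norm_ge_zero power2_diff power2_sum power_mono)
  have sqm: "integrable \<mu> (\<lambda>x. (norm (x - m))\<^sup>2)"
    by (rule Bochner_Integration.integrable_bound[of _ "\<lambda>x. 2 * (norm x)\<^sup>2 + 2 * (norm m)\<^sup>2"])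
       (use sq id\<mu> norm2 in \<open>auto intro!: AE_I2\<close>)
  have ZI: "integrable M (\<lambda>\<omega>. (norm (Z i \<omega>))\<^sup>2)" for i
    using sqm unfolding distr[of i, symmetric] Z_def by (subst (asm) integrable_distr_eq) auto
  have Z1: "integrable M (Z i)" for i
    using int1 unfolding distr[of i, symmetric] Z_def by (subst (asm) integrable_distr_eq) auto
  have EZ: "expectation (Z i) = 0" for i
  proof -
    have "integrable M (X i)"
      using int1 unfolding distr[of i, symmetric] by (subst (asm) integrable_distr_eq) auto
    moreover have "expectation (X i) = m"
      unfolding m_def distr[of i, symmetric] by (subst integral_distr) auto
    ultimately show ?thesis unfolding Z_def by (simp add: prob_space)
  qed
  have EZ2: "expectation (\<lambda>\<omega>. (norm (Z i \<omega>))\<^sup>2) = (\<integral>x. (norm (x - m))\<^sup>2 \<partial>\<mu>)" for i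
    unfolding Z_def distr[of i, symmetric] by (subst integral_distr) auto
  have Zb: "indep_var borel (\<lambda>\<omega>. Z i \<omega> \<bullet> b) borel (\<lambda>\<omega>. Z j \<omega> \<bullet> b)" if "i \<noteq> j" for i j b
  proof -
    have "indep_vars (\<lambda>_. borel) (\<lambda>i \<omega>. Z i \<omega> \<bullet> b) UNIV"
      unfolding Z_def by (rule indep_vars_compose2[OF indep]) auto
    then have "indep_vars (\<lambda>_. borel) (\<lambda>i \<omega>. Z i \<omega> \<bullet> b) (insert i {j})"
      by (rule indep_vars_subset) simp
    \<comment> \<open>Pairwise independence is read off from the independence of one variable and
      the sum over a singleton.\<close>
    from indep_vars_sum[OF _ _ this] show ?thesis using that by simp
  qed
  have Zb1: "integrable M (\<lambda>\<omega>. Z i \<omega> \<bullet> b)" "expectation (\<lambda>\<omega>. Z i \<omega> \<bullet> b) = 0" for i b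
    using Z1[of i] EZ[of i] by auto
  have ZZI: "integrable M (\<lambda>\<omega>. Z i \<omega> \<bullet> Z j \<omega>)" for i j
  proof (rule Bochner_Integration.integrable_bound[of _ "\<lambda>\<omega>. (norm (Z i \<omega>))\<^sup>2 + (norm (Z j \<omega>))\<^sup>2"])
    have "\<bar>x \<bullet> y\<bar> \<le> (norm x)\<^sup>2 + (norm y)\<^sup>2" for x y :: 'b
      using Cauchy_Schwarz_ineq2[of x y] sum_squares_bound[of "norm x" "norm y"]
        mult_nonneg_nonneg[OF norm_ge_zero norm_ge_zero, of x y] by linarith
    then show "AE \<omega> in M. norm (Z i \<omega> \<bullet> Z j \<omega>) \<le> norm ((norm (Z i \<omega>))\<^sup>2 + (norm (Z j \<omega>))\<^sup>2)"
      by (intro AE_I2) (simp only: real_norm_def abs_of_nonneg[OF add_nonneg_nonneg] zero_le_power2)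
  qed (use ZI in auto)
  have ZZ: "expectation (\<lambda>\<omega>. Z i \<omega> \<bullet> Z j \<omega>) = (if i = j then \<integral>x. (norm (x - m))\<^sup>2 \<partial>\<mu> else 0)" for i j
  proof (cases "i = j")
    case True then show ?thesis using EZ2[of j] by (simp add: power2_norm_eq_inner)
  next
    case False
    \<comment> \<open>The product rule for independent variables concerns scalar products, so the
      inner product is split into coordinates.\<close>
    have "expectation (\<lambda>\<omega>. Z i \<omega> \<bullet> Z j \<omega>) = expectation (\<lambda>\<omega>. \<Sum>b\<in>Basis. (Z i \<omega> \<bullet> b) * (Z j \<omega> \<bullet> b))"
      by (intro Bochner_Integration.integral_cong refl euclidean_inner)
    also have "\<dots> = (\<Sum>b\<in>Basis. expectation (\<lambda>\<omega>. (Z i \<omega> \<bullet> b) * (Z j \<omega> \<bullet> b)))"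
      by (rule Bochner_Integration.integral_sum)
         (rule indep_var_integrable[OF Zb[OF False] Zb1(1) Zb1(1)])
    also have "\<dots> = 0"
      by (rule sum.neutral) (subst indep_var_lebesgue_integral[OF Zb[OF False] Zb1(1) Zb1(1)], simp add: Zb1(2))
    finally show ?thesis using False by simp
  qed
  have eq: "(norm ((1 / real n) *\<^sub>R (\<Sum>i<n. X i \<omega>) - m))\<^sup>2 =
      (1 / (real n)\<^sup>2) * (\<Sum>i<n. \<Sum>j<n. Z i \<omega> \<bullet> Z j \<omega>)" for \<omega>
  proof -
    have "(1 / real n) *\<^sub>R (\<Sum>i<n. X i \<omega>) - m = (1 / real n) *\<^sub>R (\<Sum>i<n. Z i \<omega>)"
      using n by (simp add: Z_def sum_subtractf scaleR_diff_right sum_constant_scaleR)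
    moreover have "(norm ((1 / real n) *\<^sub>R (\<Sum>i<n. Z i \<omega>)))\<^sup>2 =
        (1 / (real n)\<^sup>2) * ((\<Sum>i<n. Z i \<omega>) \<bullet> (\<Sum>j<n. Z j \<omega>))"
      unfolding power2_norm_eq_inner inner_scaleR_left inner_scaleR_right by (simp add: power2_eq_square)
    moreover have "(\<Sum>i<n. Z i \<omega>) \<bullet> (\<Sum>j<n. Z j \<omega>) = (\<Sum>i<n. \<Sum>j<n. Z i \<omega> \<bullet> Z j \<omega>)"
      unfolding inner_sum_left unfolding inner_sum_right ..
    ultimately show ?thesis by metis
  qed
  show "integrable M (\<lambda>\<omega>. (norm ((1 / real n) *\<^sub>R (\<Sum>i<n. X i \<omega>) - m))\<^sup>2)"
    unfolding eq using ZZI by (intro integrable_mult_right Bochner_Integration.integrable_sum) auto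
  have "expectation (\<lambda>\<omega>. (norm ((1 / real n) *\<^sub>R (\<Sum>i<n. X i \<omega>) - m))\<^sup>2) =
      (1 / (real n)\<^sup>2) * (\<Sum>i<n. \<Sum>j<n. expectation (\<lambda>\<omega>. Z i \<omega> \<bullet> Z j \<omega>))"
    unfolding eq using ZZI by (simp add: Bochner_Integration.integral_sum)
  also have "\<dots> = (\<integral>x. (norm (x - m))\<^sup>2 \<partial>\<mu>) / real n"
    using n by (simp add: ZZ sum.delta power2_eq_square)
  finally show "expectation (\<lambda>\<omega>. (norm ((1 / real n) *\<^sub>R (\<Sum>i<n. X i \<omega>) - m))\<^sup>2) =
      (\<integral>x. (norm (x - m))\<^sup>2 \<partial>\<mu>) / real n" .
qed

text \<open>Chebyshev's inequality for the squared norm. The explicit rate in \<open>n\<close> and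
  \<open>e\<close> is what later gives tightness of the mean score at the scale
  \<open>1 / sqrt n\<close>.\<close>

lemma (in prob_space) iid_mean_deviation_prob:
  fixes X :: "nat \<Rightarrow> 'a \<Rightarrow> 'b::euclidean_space"
  assumes indep: "indep_vars (\<lambda>_. borel) X UNIV"
    and distr: "\<And>i. distr M borel (X i) = \<mu>"
    and sq: "integrable \<mu> (\<lambda>x. (norm x)\<^sup>2)"
    and n: "n > 0" and e: "e > 0"
  defines "m \<equiv> \<integral>x. x \<partial>\<mu>"
  shows "prob {\<omega>\<in>space M. norm ((1 / real n) *\<^sub>R (\<Sum>i<n. X i \<omega>) - m) \<ge> e} \<le>
     (\<integral>x. (norm (x - m))\<^sup>2 \<partial>\<mu>) / (real n * e\<^sup>2)"
proof -
  have rv[measurable]: "random_variable borel (X i)" for i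
    using indep unfolding indep_vars_def2 by simp
  let ?f = "\<lambda>\<omega>. (norm ((1 / real n) *\<^sub>R (\<Sum>i<n. X i \<omega>) - m))\<^sup>2"
  have "{\<omega>\<in>space M. norm ((1 / real n) *\<^sub>R (\<Sum>i<n. X i \<omega>) - m) \<ge> e} = {\<omega>\<in>space M. ?f \<omega> \<ge> e\<^sup>2}"
    using e by (auto intro: power_mono dest: power2_le_imp_le)
  also have "prob \<dots> \<le> expectation ?f / e\<^sup>2"
    using e iid_mean_square_deviation(1)[OF indep distr sq n]
    by (intro integral_Markov_inequality_measure[where A = "{}"]) (auto simp: m_def)
  finally show ?thesis
    using iid_mean_square_deviation(2)[OF indep distr sq n] by (simp add: m_def)
qed

lemma (in prob_space) iid_weak_law:
  fixes X :: "nat \<Rightarrow> 'a \<Rightarrow> 'b::euclidean_space"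
  assumes indep: "indep_vars (\<lambda>_. borel) X UNIV"
    and distr: "\<And>i. distr M borel (X i) = \<mu>"
    and sq: "integrable \<mu> (\<lambda>x. (norm x)\<^sup>2)" and e: "e > 0"
  shows "(\<lambda>n. prob {\<omega>\<in>space M. norm ((1 / real n) *\<^sub>R (\<Sum>i<n. X i \<omega>) - (\<integral>x. x \<partial>\<mu>)) \<ge> e}) \<longlonglongrightarrow> 0"
proof (rule tendsto_sandwich[OF _ _ tendsto_const])
  let ?V = "\<integral>x. (norm (x - (\<integral>x. x \<partial>\<mu>)))\<^sup>2 \<partial>\<mu>"
  show "\<forall>\<^sub>F n in sequentially. prob {\<omega>\<in>space M. norm ((1 / real n) *\<^sub>R (\<Sum>i<n. X i \<omega>) - (\<integral>x. x \<partial>\<mu>)) \<ge> e}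
      \<le> (?V / e\<^sup>2) * (1 / real n)"
    using eventually_gt_at_top[of 0]
    by eventually_elim (use iid_mean_deviation_prob[OF indep distr sq _ e] in \<open>simp add: field_simps\<close>)
  show "(\<lambda>n. (?V / e\<^sup>2) * (1 / real n)) \<longlonglongrightarrow> 0"
    by (intro tendsto_mult_right_zero lim_1_over_n)
qed auto

text \<open>Evaluating the characteristic function of the standardized sum at \<open>sqrt v\<close>
  undoes the standardization. Standardizing requires a positive variance; the degenerate direction
  is treated where the lemma is applied.\<close>

lemma (in prob_space) iid_central_limit_cis:
  fixes X :: "nat \<Rightarrow> 'a \<Rightarrow> real"
  assumes indep: "indep_vars (\<lambda>_. borel) X UNIV"
    and distr: "\<And>i. distr M borel (X i) = \<mu>"
    and sq: "integrable \<mu> (\<lambda>x. x\<^sup>2)" and mean: "(\<integral>x. x \<partial>\<mu>) = 0"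
    and v: "v = (\<integral>x. x\<^sup>2 \<partial>\<mu>)" "v > 0"
  shows "(\<lambda>n. expectation (\<lambda>\<omega>. cis (sqrt (real n) * ((1 / real n) * (\<Sum>i<n. X i \<omega>)))))
    \<longlonglongrightarrow> complex_of_real (exp (- v / 2))"
proof -
  have rv[measurable]: "random_variable borel (X i)" for i
    using indep unfolding indep_vars_def2 by simp
  define s where "s = sqrt v"
  have s: "s > 0" "s\<^sup>2 = v" using v by (auto simp: s_def)
  have E0: "expectation (X i) = 0" for i
    using mean unfolding distr[of i, symmetric] by (subst (asm) integral_distr) auto
  have I2: "integrable M (\<lambda>x. (X i x)\<^sup>2)" for i
    using sq unfolding distr[of i, symmetric] by (subst (asm) integrable_distr_eq) auto
  have V: "variance (X i) = s\<^sup>2" for i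
    using v(1) E0[of i] unfolding s(2) distr[of i, symmetric] by (subst (asm) integral_distr) auto
  let ?S = "\<lambda>n x. (\<Sum>i<n. X i x) / sqrt (real n * s\<^sup>2)"
  have "weak_conv_m (\<lambda>n. distr M borel (?S n)) std_normal_distribution"
    by (rule central_limit_theorem_zero_mean[OF indep E0 s(1) I2 V distr])
  then have "(\<lambda>n. char (distr M borel (?S n)) s) \<longlonglongrightarrow> char std_normal_distribution s"
    by (intro levy_continuity1) (auto intro!: real_distribution_distr real_dist_normal_dist)
  moreover have "char (distr M borel (?S n)) s =
     expectation (\<lambda>\<omega>. cis (sqrt (real n) * ((1 / real n) * (\<Sum>i<n. X i \<omega>))))" for n
  proof -
    have "s * ?S n \<omega> = sqrt (real n) * ((1 / real n) * (\<Sum>i<n. X i \<omega>))" for \<omega>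
      using s by (cases "n = 0") (auto simp: real_sqrt_mult field_simps)
    then have *: "iexp (s * ?S n \<omega>) = cis (sqrt (real n) * ((1 / real n) * (\<Sum>i<n. X i \<omega>)))" for \<omega>
      unfolding cis_conv_exp by presburger
    have "char (distr M borel (?S n)) s = expectation (\<lambda>\<omega>. iexp (s * ?S n \<omega>))"
      unfolding char_def by (subst integral_distr) auto
    then show ?thesis unfolding * .
  qed
  ultimately show ?thesis
    by (simp add: char_std_normal_distribution s(2))
qed

section \<open>Convergence in distribution from characteristic functions\<close>

text \<open>The finite linear combinations of characters, to which convergence of characteristic
  functions extends by linearity. Complex coefficients are needed to express the sine.\<close>

inductive trig_polynomial :: "('a::euclidean_space \<Rightarrow> complex) \<Rightarrow> bool" where
  monomial: "trig_polynomial (\<lambda>x. c * cis (t \<bullet> x))"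
| add: "trig_polynomial f \<Longrightarrow> trig_polynomial g \<Longrightarrow> trig_polynomial (\<lambda>x. f x + g x)"

lemma trig_polynomial_const: "trig_polynomial (\<lambda>x. c)"
  using trig_polynomial.monomial[of c 0] by simp

lemma trig_polynomial_sum:
  "finite I \<Longrightarrow> (\<And>i. i \<in> I \<Longrightarrow> trig_polynomial (f i)) \<Longrightarrow> trig_polynomial (\<lambda>x. \<Sum>i\<in>I. f i x)"
  by (induction I rule: finite_induct) (auto intro: trig_polynomial_const trig_polynomial.add)

text \<open>Frequencies of characters add under multiplication; this is what makes a polynomial in
  sines a trigonometric polynomial.\<close>

lemma trig_polynomial_mult:
  assumes "trig_polynomial f" "trig_polynomial g"
  shows "trig_polynomial (\<lambda>x. f x * g x)"
  using assms(1)
proof induction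
  case (monomial c t)
  show ?case using assms(2)
  proof induction
    case (monomial d u)
    have "c * cis (t \<bullet> x) * (d * cis (u \<bullet> x)) = (c * d) * cis ((t + u) \<bullet> x)" for x
      by (simp add: cis_mult inner_add_left)
    then show ?case using trig_polynomial.monomial[of "c * d" "t + u"] by (simp only:)
  next
    case (add f g)
    then show ?case using trig_polynomial.add by (simp add: distrib_left)
  qed
next
  case (add f g)
  then show ?case using trig_polynomial.add by (simp add: distrib_right)
qed

lemma trig_polynomial_sin: "trig_polynomial (\<lambda>x. complex_of_real (sin (t \<bullet> x)))"
proof -
  have "complex_of_real (sin u) = (- \<i> / 2) * cis u + (\<i> / 2) * cis (- u)" for u
    by (auto simp: complex_eq_iff)
  then have "(\<lambda>x. complex_of_real (sin (t \<bullet> x))) =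
      (\<lambda>x. (- \<i> / 2) * cis (t \<bullet> x) + (\<i> / 2) * cis ((- t) \<bullet> x))"
    by (simp add: fun_eq_iff)
  then show ?thesis using trig_polynomial.intros by metis
qed

text \<open>Levy's continuity theorem in several variables, with tightness as a hypothesis. A
  bounded continuous \<open>f\<close> is compared with a trigonometric polynomial \<open>h\<close>
  that is close to \<open>f\<close> on a large ball and bounded everywhere, so the complement of the
  ball costs only a multiple of its probability.\<close>

lemma conv_in_dist_of_char:
  fixes X :: "nat \<Rightarrow> 'w \<Rightarrow> 'a::euclidean_space"
  assumes N: "prob_space N" and \<nu>: "prob_space \<nu>" "sets \<nu> = sets borel"
    and X[measurable]: "\<And>n. X n \<in> borel_measurable N"
    and char: "\<And>t. (\<lambda>n. \<integral>\<omega>. cis (t \<bullet> X n \<omega>) \<partial>N) \<longlonglongrightarrow> (\<integral>x. cis (t \<bullet> x) \<partial>\<nu>)"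
    and tight: "\<And>e. e > 0 \<Longrightarrow> \<exists>K. \<forall>\<^sub>F n in sequentially. measure N {\<omega>\<in>space N. norm (X n \<omega>) > K} \<le> e"
  shows "conv_in_dist N X \<nu>"
  unfolding conv_in_dist_def
proof (intro conjI allI impI, fact X, elim conjE)
  interpret N: prob_space N by fact
  interpret \<nu>: prob_space \<nu> by fact
  have sp[simp]: "space \<nu> = UNIV" using sets_eq_imp_space_eq[OF \<nu>(2)] by simp
  have meas\<nu>: "f \<in> borel_measurable borel \<Longrightarrow> f \<in> borel_measurable \<nu>" for f :: "'a \<Rightarrow> 'c::topological_space"
    using \<nu>(2) by (simp cong: measurable_cong_sets)
  have trig: "(f \<in> borel_measurable borel \<and> (\<exists>B. \<forall>x. norm (f x) \<le> B)) \<and>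
      (\<lambda>n. \<integral>\<omega>. f (X n \<omega>) \<partial>N) \<longlonglongrightarrow> (\<integral>x. f x \<partial>\<nu>)" if "trig_polynomial f" for f :: "'a \<Rightarrow> complex"
    using that
  proof induction
    case (monomial c t)
    have "(\<lambda>x. cis (t \<bullet> x)) \<in> borel_measurable borel"
      by (intro borel_measurable_continuous_onI continuous_intros)
    moreover have "\<forall>x. norm (c * cis (t \<bullet> x)) \<le> norm c" by (simp add: norm_mult)
    ultimately show ?case
      using tendsto_mult_left[OF char[of t], of c] by auto
  next
    case (add f g)
    have [measurable]: "f \<in> borel_measurable borel" "g \<in> borel_measurable borel" using add by auto
    obtain B C where B: "\<And>x. norm (f x) \<le> B" and C: "\<And>x. norm (g x) \<le> C" using add by auto
    have "norm (f x + g x) \<le> B + C" for x using B C norm_triangle_mono by blast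
    moreover have "integrable N (\<lambda>\<omega>. f (X n \<omega>))" "integrable N (\<lambda>\<omega>. g (X n \<omega>))" for n
      by (rule N.integrable_const_bound[of _ B], use B in simp_all)
         (rule N.integrable_const_bound[of _ C], use C in simp_all)
    moreover have "integrable \<nu> f" "integrable \<nu> g"
      by (rule \<nu>.integrable_const_bound[of _ B], use B in \<open>simp_all add: meas\<nu>\<close>)
         (rule \<nu>.integrable_const_bound[of _ C], use C in \<open>simp_all add: meas\<nu>\<close>)
    ultimately show ?case
      using tendsto_add[of _ _ _ "\<lambda>n. \<integral>\<omega>. g (X n \<omega>) \<partial>N"] add.IH by (auto simp: exI[of _ "B + C"])
  qed
  fix f :: "'a \<Rightarrow> real" assume f: "continuous_on UNIV f" "bounded (range f)"
  have [measurable]: "f \<in> borel_measurable borel" using f(1) by (rule borel_measurable_continuous_onI)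
  obtain B where B: "\<And>x. \<bar>f x\<bar> \<le> B" using f(2) by (auto simp: bounded_iff)
  have B0: "B \<ge> 0" using B[of 0] by linarith
  show "(\<lambda>n. \<integral>\<omega>. f (X n \<omega>) \<partial>N) \<longlonglongrightarrow> (\<integral>x. f x \<partial>\<nu>)"
  proof (rule LIMSEQ_I)
    fix r :: real assume r: "r > 0"
    \<comment> \<open>Replacing \<open>f\<close> by \<open>h\<close> costs at most
      \<open>e + 2 * B * e\<close> under each of the two laws, altogether
      \<open>r - 2 * e\<close>.\<close>
    define e where "e = r / (4 + 4 * B)"
    have e: "e > 0" using r B0 by (simp add: e_def)
    have er: "2 * e + 4 * B * e < r"
    proof -
      have "(4 + 4 * B) * e = r" using B0 by (simp add: e_def)
      then have "2 * e + 4 * B * e = r - 2 * e" by (simp add: algebra_simps)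
      then show ?thesis using e by simp
    qed
    obtain K0 where K0: "\<forall>\<^sub>F n in sequentially. measure N {\<omega>\<in>space N. norm (X n \<omega>) > K0} \<le> e"
      using tight[OF e] by blast
    \<comment> \<open>Tightness of the limit: the complements of the balls decrease to the empty
      set.\<close>
    have "(\<lambda>k. \<nu>.prob {x. norm x > real k}) \<longlonglongrightarrow> \<nu>.prob (\<Inter>k. {x. norm x > real k})"
      by (rule \<nu>.finite_Lim_measure_decseq) (auto simp: \<nu>(2) decseq_def)
    moreover have "(\<Inter>k. {x::'a. norm x > real k}) = {}"
      using real_arch_simple by (auto simp: not_less[symmetric])
    ultimately have "(\<lambda>k. \<nu>.prob {x. norm x > real k}) \<longlonglongrightarrow> 0" by simp
    then have "\<forall>\<^sub>F k in sequentially. \<nu>.prob {x. norm x > real k} < e"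
      using e by (rule order_tendstoD)
    then obtain k where k: "\<nu>.prob {x. norm x > real k} < e"
      using eventually_happens trivial_limit_sequentially by blast
    define K where "K = max 1 (max K0 (real k))"
    have K: "K > 0" by (simp add: K_def)
    have K\<nu>: "\<nu>.prob {x. norm x > K} \<le> e"
      by (rule order.trans[OF \<nu>.finite_measure_mono less_imp_le[OF k]]) (auto simp: K_def \<nu>(2))
    have KX: "\<forall>\<^sub>F n in sequentially. measure N {\<omega>\<in>space N. norm (X n \<omega>) > K} \<le> e"
      using K0 by eventually_elim
        (erule order.trans[rotated], rule N.finite_measure_mono, auto simp: K_def)
    \<comment> \<open>On the ball of radius \<open>K\<close> the arcsine inverts \<open>\<phi>\<close>, so there \<open>f\<close> is the function \<open>F\<close> of the sines; a polynomial
      close to \<open>F\<close> on the cube yields a trigonometric polynomial that is bounded on the whole space.\<close>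
    define \<phi> where "\<phi> x = (\<Sum>b\<in>Basis. sin (((pi / (2 * K)) *\<^sub>R b) \<bullet> x) *\<^sub>R b)" for x :: 'a
    define F where "F s = f (\<Sum>b\<in>Basis. ((2 * K / pi) * arcsin (s \<bullet> b)) *\<^sub>R b)" for s :: 'a
    have \<phi>b: "\<phi> x \<bullet> b = sin (pi / (2 * K) * (x \<bullet> b))" if "b \<in> Basis" for x b
      using that by (simp add: \<phi>_def inner_commute[of b x])
    have \<phi>c: "\<phi> x \<in> cbox (- One) One" for x
      by (auto simp: mem_box \<phi>b)
    have F\<phi>: "F (\<phi> x) = f x" if "norm x \<le> K" for x
    proof -
      have "2 * K / pi * arcsin (\<phi> x \<bullet> b) = x \<bullet> b" if b: "b \<in> Basis" for b
      proof -
        have "\<bar>x \<bullet> b\<bar> \<le> K" using Basis_le_norm[OF b, of x] \<open>norm x \<le> K\<close> by linarith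
        then have "\<bar>pi / (2 * K) * (x \<bullet> b)\<bar> \<le> pi / 2"
          using K by (simp add: abs_mult field_simps)
        then have "arcsin (sin (pi / (2 * K) * (x \<bullet> b))) = pi / (2 * K) * (x \<bullet> b)"
          by (intro arcsin_sin) linarith+
        then show ?thesis using K by (simp add: \<phi>b[OF b])
      qed
      then show ?thesis unfolding F_def by (simp add: euclidean_representation)
    qed
    \<comment> \<open>The cube keeps the arguments of the arcsine in its domain and contains the
      whole range of \<open>\<phi>\<close>, so an approximation there suffices.\<close>
    have "continuous_on (cbox (- One) One) F"
      unfolding F_def
      by (intro continuous_on_compose2[OF f(1)] continuous_intros) (auto simp: mem_box)
    then obtain q where q: "real_polynomial_function q" "\<And>s. s \<in> cbox (- One) One \<Longrightarrow> \<bar>F s - q s\<bar> < e"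
      using Stone_Weierstrass_real_polynomial_function[OF compact_cbox _ e] by metis
    define h where "h x = q (\<phi> x)" for x
    have "trig_polynomial (\<lambda>x. complex_of_real (q (\<phi> x)))" using q(1)
    proof induction
      case (linear l)
      interpret l: bounded_linear l by fact
      have "l (\<phi> x) = (\<Sum>b\<in>Basis. sin (((pi / (2 * K)) *\<^sub>R b) \<bullet> x) * l b)" for x
        unfolding \<phi>_def by (simp add: l.sum l.scaleR)
      then have "(\<lambda>x. complex_of_real (l (\<phi> x))) =
          (\<lambda>x. \<Sum>b\<in>Basis. complex_of_real (sin (((pi / (2 * K)) *\<^sub>R b) \<bullet> x)) * complex_of_real (l b))"
        by simp
      then show ?case
        by (auto intro!: trig_polynomial_sum trig_polynomial_mult trig_polynomial_sin trig_polynomial_const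
            simp del: inner_scaleR_left)
    qed (auto intro: trig_polynomial_const trig_polynomial.add trig_polynomial_mult)
    then have th: "trig_polynomial (\<lambda>x. complex_of_real (h x))" by (simp add: h_def)
    have hc: "(\<lambda>x. complex_of_real (h x)) \<in> borel_measurable borel"
      "(\<lambda>n. \<integral>\<omega>. complex_of_real (h (X n \<omega>)) \<partial>N) \<longlonglongrightarrow> (\<integral>x. complex_of_real (h x) \<partial>\<nu>)"
      using trig[OF th] by auto
    have hm[measurable]: "h \<in> borel_measurable borel" using measurable_compose[OF hc(1) borel_measurable_Re] by simp
    \<comment> \<open>\<open>F\<close> takes only values of \<open>f\<close>, also where the arcsine
      does not undo \<open>\<phi>\<close>; hence this bound is global.\<close>
    have h1: "\<bar>h x\<bar> \<le> B + e" for x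
      using q(2)[OF \<phi>c, of x] B[of "\<Sum>b\<in>Basis. ((2 * K / pi) * arcsin (\<phi> x \<bullet> b)) *\<^sub>R b"]
      by (simp add: h_def F_def)
    have h2: "\<bar>f x - h x\<bar> \<le> e + (2 * B) * indicator {x. norm x > K} x" for x
    proof (cases "norm x > K")
      case True
      then show ?thesis using h1[of x] B[of x] by simp
    next
      case False
      then show ?thesis using q(2)[OF \<phi>c, of x] F\<phi>[of x] by (simp add: h_def)
    qed
    have "(\<lambda>n. \<integral>\<omega>. h (X n \<omega>) \<partial>N) \<longlonglongrightarrow> (\<integral>x. h x \<partial>\<nu>)"
      using tendsto_Re[OF hc(2)] by simp
    then have "\<forall>\<^sub>F n in sequentially. dist (\<integral>\<omega>. h (X n \<omega>) \<partial>N) (\<integral>x. h x \<partial>\<nu>) < r - (2 * e + 4 * B * e)"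
      using er by (intro tendstoD) auto
    then have "\<forall>\<^sub>F n in sequentially. norm ((\<integral>\<omega>. f (X n \<omega>) \<partial>N) - (\<integral>x. f x \<partial>\<nu>)) < r"
      using KX
    proof eventually_elim
      case (elim n)
      have int: "integrable N (\<lambda>\<omega>. f (X n \<omega>))" "integrable N (\<lambda>\<omega>. h (X n \<omega>))"
        "integrable \<nu> f" "integrable \<nu> h"
        by (rule N.integrable_const_bound[of _ B] N.integrable_const_bound[of _ "B + e"]
           \<nu>.integrable_const_bound[of _ B] \<nu>.integrable_const_bound[of _ "B + e"],
           use B h1 in \<open>simp_all add: meas\<nu>\<close>; fail)+
      have "\<bar>(\<integral>\<omega>. f (X n \<omega>) \<partial>N) - (\<integral>\<omega>. h (X n \<omega>) \<partial>N)\<bar> = \<bar>\<integral>\<omega>. f (X n \<omega>) - h (X n \<omega>) \<partial>N\<bar>"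
        using int by simp
      also have "\<dots> \<le> (\<integral>\<omega>. \<bar>f (X n \<omega>) - h (X n \<omega>)\<bar> \<partial>N)"
        by (rule integral_abs_bound)
      also have "\<dots> \<le> (\<integral>\<omega>. e + (2 * B) * indicator {\<omega>\<in>space N. norm (X n \<omega>) > K} \<omega> \<partial>N)"
      proof (rule integral_mono)
        fix \<omega> assume "\<omega> \<in> space N"
        then show "\<bar>f (X n \<omega>) - h (X n \<omega>)\<bar> \<le> e + (2 * B) * indicator {\<omega>\<in>space N. norm (X n \<omega>) > K} \<omega>"
          using h2[of "X n \<omega>"] by (simp add: indicator_def)
      next
        show "integrable N (\<lambda>\<omega>. e + (2 * B) * indicator {\<omega>\<in>space N. norm (X n \<omega>) > K} \<omega>)"
          by (intro Bochner_Integration.integrable_add integrable_mult_right integrable_real_indicator)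
            (auto simp: N.emeasure_eq_measure)
      qed (use int in simp)
      also have "\<dots> = e + 2 * B * measure N {\<omega>\<in>space N. norm (X n \<omega>) > K}"
        using N.prob_space by (simp add: N.emeasure_eq_measure)
      also have "\<dots> \<le> e + 2 * B * e" using elim(2) B0 by (simp add: mult_left_mono)
      finally have 1: "\<bar>(\<integral>\<omega>. f (X n \<omega>) \<partial>N) - (\<integral>\<omega>. h (X n \<omega>) \<partial>N)\<bar> \<le> e + 2 * B * e" .
      have "\<bar>(\<integral>x. f x \<partial>\<nu>) - (\<integral>x. h x \<partial>\<nu>)\<bar> = \<bar>\<integral>x. f x - h x \<partial>\<nu>\<bar>"
        using int by simp
      also have "\<dots> \<le> (\<integral>x. \<bar>f x - h x\<bar> \<partial>\<nu>)"
        by (rule integral_abs_bound)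
      also have "\<dots> \<le> (\<integral>x. e + (2 * B) * indicator {x. norm x > K} x \<partial>\<nu>)"
      proof (rule integral_mono)
        show "\<bar>f x - h x\<bar> \<le> e + (2 * B) * indicator {x. norm x > K} x" for x
          by (rule h2)
        show "integrable \<nu> (\<lambda>x. e + (2 * B) * indicator {x. norm x > K} x)"
          by (intro Bochner_Integration.integrable_add integrable_mult_right integrable_real_indicator)
            (auto simp: \<nu>(2) \<nu>.emeasure_eq_measure)
      qed (use int in simp)
      also have "\<dots> = e + 2 * B * measure \<nu> {x. norm x > K}"
        using \<nu>.prob_space by (simp add: \<nu>(2) \<nu>.emeasure_eq_measure)
      also have "\<dots> \<le> e + 2 * B * e" using K\<nu> B0 by (simp add: mult_left_mono)
      finally have 2: "\<bar>(\<integral>x. f x \<partial>\<nu>) - (\<integral>x. h x \<partial>\<nu>)\<bar> \<le> e + 2 * B * e" .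
      show ?case using 1 2 elim(1) by (simp add: dist_real_def)
    qed
    then show "\<exists>no. \<forall>n\<ge>no. norm ((\<integral>\<omega>. f (X n \<omega>) \<partial>N) - (\<integral>x. f x \<partial>\<nu>)) < r"
      by (simp add: eventually_sequentially)
  qed
qed

section \<open>Gaussian integrals\<close>

text \<open>\<open>lborel\<close> is the image of a product of one-dimensional Lebesgue measures
  under the coordinate map, so the integral factors by Fubini.\<close>

lemma
  fixes f :: "'a::euclidean_space \<Rightarrow> real \<Rightarrow> 'c::{real_normed_field,banach,second_countable_topology}"
  assumes f: "\<And>b. b \<in> Basis \<Longrightarrow> integrable lborel (f b)"
  shows integrable_lborel_prod: "integrable lborel (\<lambda>x. \<Prod>b\<in>Basis. f b (x \<bullet> b))"
    and integral_lborel_prod: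
      "(\<integral>x. (\<Prod>b\<in>Basis. f b (x \<bullet> b)) \<partial>lborel) = (\<Prod>b\<in>Basis. \<integral>u. f b u \<partial>lborel)"
proof -
  interpret product_sigma_finite "\<lambda>_. lborel" by standard
  let ?T = "\<lambda>x :: 'a \<Rightarrow> real. \<Sum>b\<in>Basis. x b *\<^sub>R b"
  have T[measurable]: "?T \<in> (\<Pi>\<^sub>M b\<in>Basis. lborel) \<rightarrow>\<^sub>M borel"
    by (intro borel_measurable_sum borel_measurable_scaleR measurable_component_singleton borel_measurable_const)
       (auto intro: measurable_component_singleton simp: measurable_lborel1 cong: measurable_cong_sets)
  have [measurable]: "f b \<in> borel_measurable borel" if "b \<in> Basis" for b
    using f[OF that] by auto
  have [measurable]: "(\<lambda>x. \<Prod>b\<in>Basis. f b (x \<bullet> b)) \<in> borel_measurable borel"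
    by (intro borel_measurable_prod) (auto intro!: measurable_compose[of "\<lambda>x. x \<bullet> _" borel borel])
  have eq: "(\<Prod>b\<in>Basis. f b (?T x \<bullet> b)) = (\<Prod>b\<in>Basis. f b (x b))" for x
    by (intro prod.cong refl) simp
  have g: "(\<lambda>x. \<Prod>b\<in>Basis. f b (x \<bullet> b)) \<in> borel_measurable borel" by measurable
  show "integrable lborel (\<lambda>x. \<Prod>b\<in>Basis. f b (x \<bullet> b))"
    unfolding lborel_eq[where 'a = 'a] integrable_distr_eq[OF T g] eq
    by (intro product_integrable_prod f finite_Basis)
  show "(\<integral>x. (\<Prod>b\<in>Basis. f b (x \<bullet> b)) \<partial>lborel) = (\<Prod>b\<in>Basis. \<integral>u. f b u \<partial>lborel)"
    unfolding lborel_eq[where 'a = 'a] integral_distr[OF T g] eq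
    by (intro product_integral_prod f finite_Basis)
qed

lemma gauss_density_eq:
  "gauss_density s (x::'a::euclidean_space) =
     (1 / sqrt (2 * pi * s\<^sup>2)) ^ DIM('a) * exp (- (norm x)\<^sup>2 / (2 * s\<^sup>2))"
proof -
  have "(norm x)\<^sup>2 = (\<Sum>b\<in>Basis. (x \<bullet> b)\<^sup>2)"
    unfolding power2_norm_eq_inner unfolding power2_eq_square by (rule euclidean_inner)
  then show ?thesis
    by (simp add: gauss_density_def normal_density_def prod.distrib exp_sum[symmetric]
        sum_negf sum_divide_distrib power_divide prod_dividef)
qed

lemma gauss_density_pos: "s > 0 \<Longrightarrow> gauss_density s x > 0"
  by (simp add: gauss_density_eq)

lemma integrable_gauss_density: "s > 0 \<Longrightarrow> integrable lborel (gauss_density s)"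
  unfolding gauss_density_def[abs_def] by (intro integrable_lborel_prod integrable_normal_density)

lemma integral_gauss_density: "s > 0 \<Longrightarrow> (\<integral>x. gauss_density s x \<partial>lborel) = 1"
  unfolding gauss_density_def by (subst integral_lborel_prod) simp_all

lemma continuous_on_gauss_density: "continuous_on S (gauss_density s)"
  unfolding gauss_density_eq[abs_def] divide_inverse by (intro continuous_intros)

lemma power_le_fact_exp: "x \<ge> 0 \<Longrightarrow> x ^ k \<le> fact k * exp (x::real)"
proof -
  assume "x \<ge> 0"
  then have "(\<Sum>n\<in>{k}. x ^ n /\<^sub>R fact n) \<le> (\<Sum>n. x ^ n /\<^sub>R fact n)"
    by (intro sum_le_suminf summable_exp_generic) auto
  then show ?thesis by (simp add: exp_def field_simps)
qed

text \<open>Half of the Gaussian decay absorbs the polynomial: \<open>(1 + r) ^ k\<close> is at most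
  \<open>fact k * exp (1 + r)\<close>, and \<open>r \<le> c / 2 * r\<^sup>2 + 1 / (2 * c)\<close> is
  a form of \<open>(c * r - 1)\<^sup>2 \<ge> 0\<close>.\<close>

lemma integrable_poly_gauss:
  assumes c: "c > 0"
  shows "integrable lborel (\<lambda>x::'a::euclidean_space. (1 + norm x) ^ k * exp (- (c * (norm x)\<^sup>2)))"
proof -
  \<comment> \<open>With this scale \<open>gauss_density s\<close> is a multiple of the remaining
    half of the decay.\<close>
  define s where "s = 1 / sqrt c"
  have s: "s > 0" "1 / (2 * s\<^sup>2) = c / 2" using c by (auto simp: s_def power_divide)
  define D where "D = (1 / sqrt (2 * pi * s\<^sup>2)) ^ DIM('a)"
  have D: "D > 0" using s by (simp add: D_def)
  have g: "gauss_density s x = D * exp (- (c / 2 * (norm x)\<^sup>2))" for x :: 'a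
  proof -
    have "- (norm x)\<^sup>2 / (2 * s\<^sup>2) = - ((1 / (2 * s\<^sup>2)) * (norm x)\<^sup>2)" by simp
    then show ?thesis unfolding gauss_density_eq D_def s(2) by (simp only: s(2))
  qed
  have le: "(1 + r) ^ k * exp (- (c * r\<^sup>2)) \<le> fact k * exp (1 + 1 / (2 * c)) * exp (- (c / 2 * r\<^sup>2))"
    if r: "r \<ge> 0" for r
  proof -
    have "2 * c * r \<le> c * c * r\<^sup>2 + 1"
      using zero_le_power2[of "c * r - 1"] by (simp add: power2_eq_square algebra_simps)
    then have "r \<le> (c * c * r\<^sup>2 + 1) / (2 * c)" using c by (simp add: pos_le_divide_eq mult.commute)
    also have "\<dots> = c / 2 * r\<^sup>2 + 1 / (2 * c)" using c by (simp add: add_divide_distrib)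
    finally have "r \<le> c / 2 * r\<^sup>2 + 1 / (2 * c)" .
    then have "exp (1 + r - c * r\<^sup>2) \<le> exp (1 + 1 / (2 * c) - c / 2 * r\<^sup>2)" by simp
    then have *: "exp (1 + r) * exp (- (c * r\<^sup>2)) \<le> exp (1 + 1 / (2 * c)) * exp (- (c / 2 * r\<^sup>2))"
      unfolding mult_exp_exp by (simp add: algebra_simps)
    have "(1 + r) ^ k * exp (- (c * r\<^sup>2)) \<le> (fact k * exp (1 + r)) * exp (- (c * r\<^sup>2))"
      using power_le_fact_exp[of "1 + r" k] r by (intro mult_right_mono) auto
    also have "\<dots> \<le> fact k * exp (1 + 1 / (2 * c)) * exp (- (c / 2 * r\<^sup>2))"
      using * by (simp add: mult.assoc)
    finally show ?thesis .
  qed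
  show ?thesis
  proof (rule Bochner_Integration.integrable_bound)
    show "integrable lborel (\<lambda>x::'a. (fact k * exp (1 + 1 / (2 * c)) / D) * gauss_density s x)"
      by (intro integrable_mult_right integrable_gauss_density s)
    show "AE x in lborel. norm ((1 + norm (x::'a)) ^ k * exp (- (c * (norm x)\<^sup>2)))
        \<le> norm ((fact k * exp (1 + 1 / (2 * c)) / D) * gauss_density s x)"
      using le[OF norm_ge_zero] D by (auto simp: g abs_mult mult.assoc intro!: AE_I2)
  qed measurable
qed

lemma borel_measurable_gauss_density[measurable]: "gauss_density s \<in> borel_measurable borel"
  by (intro borel_measurable_continuous_onI continuous_on_gauss_density)

section \<open>Characteristic functions of the standard Gaussian law and of its linear
  images\<close>

lemma prob_space_std_gauss: "prob_space (density lborel (\<lambda>x::'a::euclidean_space. ennreal (gauss_density 1 x)))"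
proof
  have "(\<integral>\<^sup>+x. ennreal (gauss_density 1 (x::'a)) \<partial>lborel) = ennreal (\<integral>x. gauss_density 1 (x::'a) \<partial>lborel)"
    by (rule nn_integral_eq_integral) (auto intro!: integrable_gauss_density less_imp_le[OF gauss_density_pos])
  then show "emeasure (density lborel (\<lambda>x::'a. ennreal (gauss_density 1 x)))
      (space (density lborel (\<lambda>x::'a. ennreal (gauss_density 1 x)))) = 1"
    by (subst emeasure_density)
      (auto simp: integral_gauss_density)
qed

text \<open>Both the density and the character factor over the coordinates, which reduces the
  formula to the real line.\<close>

lemma integral_cis_std_gauss:
  "(\<integral>x. gauss_density 1 x *\<^sub>R cis (u \<bullet> x) \<partial>lborel) = complex_of_real (exp (- (norm (u::'a::euclidean_space))\<^sup>2 / 2))"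
proof -
  let ?h = "\<lambda>b v. complex_of_real (std_normal_density v) * iexp ((u \<bullet> b) * v)"
  have I: "integrable lborel (?h b)" for b
    by (rule Bochner_Integration.integrable_bound[of _ std_normal_density]) (auto simp: norm_mult)
  have int: "(\<integral>v. ?h b v \<partial>lborel) = complex_of_real (exp (- (u \<bullet> b)\<^sup>2 / 2))" for b
  proof -
    have "(\<integral>v. ?h b v \<partial>lborel) = char std_normal_distribution (u \<bullet> b)"
      unfolding char_def by (subst integral_density) (auto simp: scaleR_conv_of_real)
    then show ?thesis by (simp add: char_std_normal_distribution)
  qed
  have "gauss_density 1 x *\<^sub>R cis (u \<bullet> x) = (\<Prod>b\<in>Basis. ?h b (x \<bullet> b))" for x
  proof -
    have "iexp (u \<bullet> x) = (\<Prod>b\<in>Basis. iexp ((u \<bullet> b) * (x \<bullet> b)))"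
      by (subst euclidean_inner) (simp add: exp_sum[symmetric] sum_distrib_left)
    then show ?thesis
      by (simp add: gauss_density_def prod.distrib scaleR_conv_of_real cis_conv_exp)
  qed
  then have "(\<integral>x. gauss_density 1 x *\<^sub>R cis (u \<bullet> x) \<partial>lborel) = (\<Prod>b\<in>Basis. complex_of_real (exp (- (u \<bullet> b)\<^sup>2 / 2)))"
    using integral_lborel_prod[of ?h] I int by simp
  also have "\<dots> = complex_of_real (exp (- (norm u)\<^sup>2 / 2))"
  proof -
    have "(norm u)\<^sup>2 = (\<Sum>b\<in>Basis. (u \<bullet> b)\<^sup>2)"
      unfolding power2_norm_eq_inner unfolding power2_eq_square by (rule euclidean_inner)
    then have "(\<Prod>b\<in>Basis. exp (- (u \<bullet> b)\<^sup>2 / 2)) = exp (- (norm u)\<^sup>2 / 2)"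
      by (simp add: exp_sum[symmetric] sum_negf sum_divide_distrib)
    then show ?thesis by (metis of_real_prod)
  qed
  finally show ?thesis .
qed

text \<open>Moving \<open>L\<close> to the frequency gives the standard characteristic function at
  \<open>adjoint L t\<close>, whose squared norm is the quadratic form of
  \<open>L \<circ> adjoint L\<close> at \<open>t\<close>.\<close>

lemma
  fixes L :: "'a::euclidean_space \<Rightarrow> 'a"
  assumes L: "linear L"
  defines "\<nu> \<equiv> distr (density lborel (\<lambda>x. ennreal (gauss_density 1 x))) borel L"
  shows prob_space_gauss_image: "prob_space \<nu>"
    and integral_cis_gauss_image: "(\<integral>x. cis (t \<bullet> x) \<partial>\<nu>) = complex_of_real (exp (- (t \<bullet> L (adjoint L t)) / 2))"
proof -
  have [measurable]: "L \<in> borel_measurable borel"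
    using linear_conv_bounded_linear[THEN iffD1, OF L]
    by (intro borel_measurable_continuous_onI linear_continuous_on)
  have [measurable]: "(\<lambda>x::'a. cis (t \<bullet> x)) \<in> borel_measurable borel" for t
    by (intro borel_measurable_continuous_onI continuous_intros)
  show "prob_space \<nu>"
    unfolding \<nu>_def by (rule prob_space.prob_space_distr[OF prob_space_std_gauss]) simp
  have adj: "adjoint L t \<bullet> x = t \<bullet> L x" for x
    using adjoint_works[OF L, of x t] by (simp add: inner_commute)
  have "(\<integral>x. cis (t \<bullet> x) \<partial>\<nu>) = (\<integral>x. gauss_density 1 x *\<^sub>R cis (adjoint L t \<bullet> x) \<partial>lborel)"
    unfolding \<nu>_def
    by (simp add: integral_distr integral_density less_imp_le gauss_density_pos adj)
  also have "\<dots> = complex_of_real (exp (- (t \<bullet> L (adjoint L t)) / 2))"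
    unfolding integral_cis_std_gauss unfolding power2_norm_eq_inner adj ..
  finally show "(\<integral>x. cis (t \<bullet> x) \<partial>\<nu>) = complex_of_real (exp (- (t \<bullet> L (adjoint L t)) / 2))" .
qed

section \<open>Exponents that are quadratic in a parameter\<close>

text \<open>Dominated convergence along sequences: the mean value inequality bounds every difference
  quotient by \<open>w\<close>. Only a tail of the sequence stays in the interval, hence the shift
  of the index by \<open>n\<close>.\<close>

lemma has_real_derivative_integral:
  fixes f f' :: "real \<Rightarrow> 'a \<Rightarrow> real"
  assumes t0: "t0 \<in> {a<..<b}"
    and int: "\<And>t. t \<in> {a<..<b} \<Longrightarrow> integrable M (f t)"
    and meas: "f' t0 \<in> borel_measurable M"
    and w: "integrable M w"
    and der: "AE x in M. \<forall>t\<in>{a<..<b}. ((\<lambda>t. f t x) has_real_derivative f' t x) (at t) \<and> \<bar>f' t x\<bar> \<le> w x"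
  shows "((\<lambda>t. \<integral>x. f t x \<partial>M) has_real_derivative (\<integral>x. f' t0 x \<partial>M)) (at t0)"
  unfolding has_field_derivative_iff tendsto_at_iff_sequentially
proof safe
  fix X :: "nat \<Rightarrow> real" assume X: "\<forall>i. X i \<in> UNIV - {t0}" "X \<longlonglongrightarrow> t0"
  have "eventually (\<lambda>i. X i \<in> {a<..<b}) sequentially"
    using X(2) t0 by (intro topological_tendstoD) auto
  then obtain n where n: "\<And>i. i \<ge> n \<Longrightarrow> X i \<in> {a<..<b}"
    by (auto simp: eventually_sequentially)
  have "(\<lambda>i. \<integral>x. (f (X (i + n)) x - f t0 x) / (X (i + n) - t0) \<partial>M) \<longlonglongrightarrow> (\<integral>x. f' t0 x \<partial>M)"
  proof (rule integral_dominated_convergence[where w = w])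
    show "f' t0 \<in> borel_measurable M" "integrable M w" by fact+
    show "(\<lambda>x. (f (X (i + n)) x - f t0 x) / (X (i + n) - t0)) \<in> borel_measurable M" for i
      using int[OF n[of "i + n"]] int[OF t0] by (intro borel_measurable_divide borel_measurable_diff) auto
    show "AE x in M. (\<lambda>i. (f (X (i + n)) x - f t0 x) / (X (i + n) - t0)) \<longlonglongrightarrow> f' t0 x"
      using der
    proof eventually_elim
      case (elim x)
      have "((\<lambda>y. (f y x - f t0 x) / (y - t0)) \<longlongrightarrow> f' t0 x) (at t0)"
        using elim t0 by (auto simp: has_field_derivative_iff)
      then have "((\<lambda>y. (f y x - f t0 x) / (y - t0)) \<circ> X) \<longlonglongrightarrow> f' t0 x"
        using X by (auto simp: tendsto_at_iff_sequentially)
      from LIMSEQ_ignore_initial_segment[OF this, of n] show ?case by (simp add: o_def)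
    qed
    show "AE x in M. norm ((f (X (i + n)) x - f t0 x) / (X (i + n) - t0)) \<le> w x" for i
      using der
    proof eventually_elim
      case (elim x)
      have "norm (f (X (i + n)) x - f t0 x) \<le> w x * norm (X (i + n) - t0)"
        using elim n[of "i + n"] t0
        by (intro field_differentiable_bound[where S = "{a<..<b}" and f' = "\<lambda>t. f' t x"])
           (auto intro: has_field_derivative_at_within)
      then show ?case using X(1) by (auto simp: norm_divide divide_simps)
    qed
  qed
  moreover have "(\<integral>x. (f (X (i + n)) x - f t0 x) / (X (i + n) - t0) \<partial>M) =
      ((\<integral>x. f (X (i + n)) x \<partial>M) - (\<integral>x. f t0 x \<partial>M)) / (X (i + n) - t0)" for i
    using int[OF n[of "i + n"]] int[OF t0] by simp
  ultimately have "(\<lambda>i. ((\<integral>x. f (X (i + n)) x \<partial>M) - (\<integral>x. f t0 x \<partial>M)) / (X (i + n) - t0))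
      \<longlonglongrightarrow> (\<integral>x. f' t0 x \<partial>M)"
    by (simp only:)
  from LIMSEQ_offset[OF this]
  show "((\<lambda>y. ((\<integral>x. f y x \<partial>M) - (\<integral>x. f t0 x \<partial>M)) / (y - t0)) \<circ> X) \<longlonglongrightarrow> (\<integral>x. f' t0 x \<partial>M)"
    by (simp add: o_def)
qed

text \<open>The likelihood along a line, up to a constant factor. The bound \<open>K\<close> serves
  integrability and differentiation under the integral; the quantitative estimates use the finer
  bounds \<open>u\<close> and \<open>v\<close> below.\<close>

locale quadratic_exponent = prob_space M for M :: "'z measure" +
  fixes a b c :: "'z \<Rightarrow> real" and K :: real
  assumes meas[measurable]: "a \<in> borel_measurable M" "b \<in> borel_measurable M" "c \<in> borel_measurable M"
    and bound: "AE z in M. \<bar>a z\<bar> \<le> K \<and> \<bar>b z\<bar> \<le> K \<and> \<bar>c z\<bar> \<le> K"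
begin

definition expo :: "'z \<Rightarrow> real \<Rightarrow> real" where "expo z t = a z + b z * t + c z * t\<^sup>2"
definition slope :: "'z \<Rightarrow> real \<Rightarrow> real" where "slope z t = b z + 2 * c z * t"

text \<open>Each differentiation multiplies by \<open>slope\<close>, whose own derivative is
  \<open>2 * c\<close>; this produces the polynomial factors of \<open>f2\<close> and
  \<open>f3\<close>.\<close>

definition f0 :: "real \<Rightarrow> real" where "f0 t = (\<integral>z. exp (expo z t) \<partial>M)"
definition f1 :: "real \<Rightarrow> real" where "f1 t = (\<integral>z. slope z t * exp (expo z t) \<partial>M)"
definition f2 :: "real \<Rightarrow> real" where
  "f2 t = (\<integral>z. (2 * c z + (slope z t)\<^sup>2) * exp (expo z t) \<partial>M)"
definition f3 :: "real \<Rightarrow> real" where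
  "f3 t = (\<integral>z. (6 * c z * slope z t + (slope z t)^3) * exp (expo z t) \<partial>M)"

lemma measurable_expo[measurable]:
  "(\<lambda>z. expo z t) \<in> borel_measurable M" "(\<lambda>z. slope z t) \<in> borel_measurable M"
  unfolding expo_def slope_def by measurable

lemma K_nonneg: "K \<ge> 0"
proof -
  have "AE z in M. 0 \<le> K" using bound by eventually_elim auto
  then show ?thesis by simp
qed

text \<open>The interval contains the segment from 0 to 1 in its interior, so two-sided derivatives
  exist at both ends of it. The constants are \<open>1 + 2 + 4\<close> and \<open>1 + 2 * 2\<close>,
  from \<open>\<bar>t\<bar> \<le> 2\<close>.\<close>

lemma expo_bound: "AE z in M. \<forall>t\<in>{-2<..<2}. \<bar>expo z t\<bar> \<le> 7 * K \<and> \<bar>slope z t\<bar> \<le> 5 * K \<and> \<bar>c z\<bar> \<le> K"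
  using bound
proof eventually_elim
  case (elim z)
  show ?case
  proof
    fix t :: real assume t: "t \<in> {-2<..<2}"
    have t2: "\<bar>t\<bar> \<le> 2" "t\<^sup>2 \<le> 4" using t abs_square_le_1[of "t / 2"] by (auto simp: power_divide)
    have "\<bar>b z * t\<bar> \<le> K * 2" using elim t2 unfolding abs_mult by (intro mult_mono) auto
    moreover have "\<bar>c z * t\<^sup>2\<bar> \<le> K * 4" using elim t2 unfolding abs_mult by (intro mult_mono) auto
    moreover have "\<bar>c z * t\<bar> \<le> K * 2" using elim t2 unfolding abs_mult by (intro mult_mono) auto
    ultimately show "\<bar>expo z t\<bar> \<le> 7 * K \<and> \<bar>slope z t\<bar> \<le> 5 * K \<and> \<bar>c z\<bar> \<le> K"
      using elim unfolding expo_def slope_def by linarith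
  qed
qed

lemma integrable_exp_mult:
  assumes [measurable]: "P \<in> borel_measurable M" and P: "AE z in M. \<bar>P z\<bar> \<le> C" and t: "t \<in> {-2<..<2}"
  shows "integrable M (\<lambda>z. P z * exp (expo z t))"
proof (rule integrable_const_bound[of _ "\<bar>C\<bar> * exp (7 * K)"])
  show "AE z in M. norm (P z * exp (expo z t)) \<le> \<bar>C\<bar> * exp (7 * K)"
    using P expo_bound
  proof eventually_elim
    case (elim z)
    then have "\<bar>P z\<bar> \<le> \<bar>C\<bar>" "expo z t \<le> 7 * K" using t by force+
    then show ?case by (auto simp: abs_mult intro!: mult_mono)
  qed
qed measurable

lemma integrable_exp: "t \<in> {-2<..<2} \<Longrightarrow> integrable M (\<lambda>z. exp (expo z t))"
  using integrable_exp_mult[of "\<lambda>_. 1" 1] by simp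

lemma f0_pos: assumes t: "t \<in> {-2<..<2}" shows "f0 t > 0"
proof -
  have "(\<integral>z. exp (- (7 * K)) \<partial>M) \<le> f0 t"
    unfolding f0_def
  proof (rule integral_mono_AE)
    show "AE z in M. exp (- (7 * K)) \<le> exp (expo z t)"
      using expo_bound by eventually_elim (use t in force)
  qed (use integrable_exp[OF t] in auto)
  then show ?thesis by (simp add: prob_space) (meson exp_gt_zero less_le_trans)
qed

lemma has_real_derivative_exp_mult:
  assumes t: "t \<in> {-2<..<2}"
    and P: "\<And>z t. ((\<lambda>t. P z t) has_real_derivative P' z t) (at t)"
    and [measurable]: "\<And>t. (\<lambda>z. P z t) \<in> borel_measurable M" "\<And>t. (\<lambda>z. P' z t) \<in> borel_measurable M"
    and C: "AE z in M. \<forall>t\<in>{-2<..<2}. \<bar>P z t\<bar> \<le> C \<and> \<bar>P' z t\<bar> \<le> C"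
  shows "((\<lambda>t. \<integral>z. P z t * exp (expo z t) \<partial>M) has_real_derivative
           (\<integral>z. (P' z t + P z t * slope z t) * exp (expo z t) \<partial>M)) (at t)"
proof (rule has_real_derivative_integral[where w = "\<lambda>_. (\<bar>C\<bar> + \<bar>C\<bar> * (5 * K)) * exp (7 * K)", OF t])
  show "integrable M (\<lambda>z. P z t * exp (expo z t))" if "t \<in> {-2<..<2}" for t
  proof (rule integrable_exp_mult[OF _ _ that])
    show "AE z in M. \<bar>P z t\<bar> \<le> C" using C by eventually_elim (use that in blast)
  qed measurable
  show "(\<lambda>z. (P' z t + P z t * slope z t) * exp (expo z t)) \<in> borel_measurable M"
    by measurable
  show "AE z in M. \<forall>t\<in>{-2<..<2}. ((\<lambda>t. P z t * exp (expo z t)) has_real_derivative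
      (P' z t + P z t * slope z t) * exp (expo z t)) (at t) \<and>
      \<bar>(P' z t + P z t * slope z t) * exp (expo z t)\<bar> \<le> (\<bar>C\<bar> + \<bar>C\<bar> * (5 * K)) * exp (7 * K)"
    using C expo_bound
  proof eventually_elim
    case (elim z)
    show ?case
    proof
      fix t :: real assume t: "t \<in> {-2<..<2}"
      have E: "((\<lambda>t. exp (expo z t)) has_real_derivative slope z t * exp (expo z t)) (at t)"
        unfolding expo_def slope_def by (auto intro!: derivative_eq_intros simp: algebra_simps)
      have 1: "((\<lambda>t. P z t * exp (expo z t)) has_real_derivative
          (P' z t + P z t * slope z t) * exp (expo z t)) (at t)"
        by (rule DERIV_cong[OF DERIV_mult[OF P E]]) (simp add: algebra_simps)
      have b: "\<bar>P z t\<bar> \<le> \<bar>C\<bar>" "\<bar>P' z t\<bar> \<le> \<bar>C\<bar>" "\<bar>slope z t\<bar> \<le> 5 * K" "expo z t \<le> 7 * K"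
        using elim t by force+
      have "\<bar>P z t * slope z t\<bar> \<le> \<bar>C\<bar> * (5 * K)"
        unfolding abs_mult using b by (intro mult_mono) auto
      then have "\<bar>P' z t + P z t * slope z t\<bar> \<le> \<bar>C\<bar> + \<bar>C\<bar> * (5 * K)"
        using b by linarith
      then have "\<bar>(P' z t + P z t * slope z t) * exp (expo z t)\<bar> \<le> (\<bar>C\<bar> + \<bar>C\<bar> * (5 * K)) * exp (7 * K)"
        using b unfolding abs_mult by (intro mult_mono) auto
      then show "((\<lambda>t. P z t * exp (expo z t)) has_real_derivative
          (P' z t + P z t * slope z t) * exp (expo z t)) (at t) \<and>
          \<bar>(P' z t + P z t * slope z t) * exp (expo z t)\<bar> \<le> (\<bar>C\<bar> + \<bar>C\<bar> * (5 * K)) * exp (7 * K)"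
        using 1 by simp
    qed
  qed
qed simp

text \<open>One constant for all the factors of the exponential that get differentiated and for
  their derivatives in \<open>t\<close>.\<close>

lemma bounds_exist: "\<exists>C. AE z in M. \<forall>t\<in>{-2<..<2}. \<bar>1\<bar> \<le> C \<and> \<bar>slope z t\<bar> \<le> C \<and> \<bar>2 * c z\<bar> \<le> C \<and>
  \<bar>2 * c z + (slope z t)\<^sup>2\<bar> \<le> C \<and> \<bar>4 * c z * slope z t\<bar> \<le> C"
proof
  let ?C = "1 + 5 * K + 2 * K + (5 * K)\<^sup>2 + 4 * K * (5 * K)"
  show "AE z in M. \<forall>t\<in>{-2<..<2}. \<bar>1\<bar> \<le> ?C \<and> \<bar>slope z t\<bar> \<le> ?C \<and> \<bar>2 * c z\<bar> \<le> ?C \<and>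
    \<bar>2 * c z + (slope z t)\<^sup>2\<bar> \<le> ?C \<and> \<bar>4 * c z * slope z t\<bar> \<le> ?C"
    using expo_bound
  proof eventually_elim
    case (elim z)
    show ?case
    proof
      fix t :: real assume t: "t \<in> {-2<..<2}"
      have b: "\<bar>slope z t\<bar> \<le> 5 * K" "\<bar>c z\<bar> \<le> K" using elim t by auto
      have 1: "(slope z t)\<^sup>2 \<le> (5 * K)\<^sup>2" using b(1) by (rule abs_le_square_iff[THEN iffD1, OF order.trans]) simp
      have 2: "\<bar>4 * c z * slope z t\<bar> \<le> 4 * K * (5 * K)"
        unfolding abs_mult using b by (intro mult_mono) auto
      have "0 \<le> (5 * K)\<^sup>2" "0 \<le> 4 * K * (5 * K)" "(slope z t)\<^sup>2 \<ge> 0" using K_nonneg by simp_all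
      then show "\<bar>1\<bar> \<le> ?C \<and> \<bar>slope z t\<bar> \<le> ?C \<and> \<bar>2 * c z\<bar> \<le> ?C \<and>
          \<bar>2 * c z + (slope z t)\<^sup>2\<bar> \<le> ?C \<and> \<bar>4 * c z * slope z t\<bar> \<le> ?C"
        using b 1 2 K_nonneg by linarith
    qed
  qed
qed

lemma slope_deriv: "(slope z has_real_derivative 2 * c z) (at t)"
  unfolding slope_def[abs_def] by (auto intro!: derivative_eq_intros)

lemma DERIV_f:
  assumes t: "t \<in> {-2<..<2}"
  shows "(f0 has_real_derivative f1 t) (at t)" "(f1 has_real_derivative f2 t) (at t)"
    "(f2 has_real_derivative f3 t) (at t)"
proof -
  obtain C where C: "AE z in M. \<forall>t\<in>{-2<..<2}. \<bar>1\<bar> \<le> C \<and> \<bar>slope z t\<bar> \<le> C \<and> \<bar>2 * c z\<bar> \<le> C \<and>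
    \<bar>2 * c z + (slope z t)\<^sup>2\<bar> \<le> C \<and> \<bar>4 * c z * slope z t\<bar> \<le> C"
    using bounds_exist by blast
  show "(f0 has_real_derivative f1 t) (at t)"
  proof -
    have "((\<lambda>t. \<integral>z. 1 * exp (expo z t) \<partial>M) has_real_derivative
           (\<integral>z. (0 + 1 * slope z t) * exp (expo z t) \<partial>M)) (at t)"
      by (rule has_real_derivative_exp_mult[OF t, of _ _ 1]) auto
    then show ?thesis by (simp add: f0_def[abs_def] f1_def)
  qed
  have C1: "AE z in M. \<forall>t\<in>{-2<..<2}. \<bar>slope z t\<bar> \<le> C \<and> \<bar>2 * c z\<bar> \<le> C"
    using C by eventually_elim blast
  have C2: "AE z in M. \<forall>t\<in>{-2<..<2}. \<bar>2 * c z + (slope z t)\<^sup>2\<bar> \<le> C \<and> \<bar>4 * c z * slope z t\<bar> \<le> C"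
    using C by eventually_elim blast
  have "((\<lambda>t. \<integral>z. slope z t * exp (expo z t) \<partial>M) has_real_derivative
           (\<integral>z. (2 * c z + slope z t * slope z t) * exp (expo z t) \<partial>M)) (at t)"
    by (rule has_real_derivative_exp_mult[OF t slope_deriv _ _ C1]) measurable
  then show "(f1 has_real_derivative f2 t) (at t)"
    by (simp add: f1_def[abs_def] f2_def power2_eq_square)
  have "((\<lambda>t. \<integral>z. (2 * c z + (slope z t)\<^sup>2) * exp (expo z t) \<partial>M) has_real_derivative
           (\<integral>z. (4 * c z * slope z t + (2 * c z + (slope z t)\<^sup>2) * slope z t) * exp (expo z t) \<partial>M)) (at t)"
  proof (rule has_real_derivative_exp_mult[OF t _ _ _ C2])
    show "((\<lambda>t. 2 * c z + (slope z t)\<^sup>2) has_real_derivative 4 * c z * slope z t) (at t)" for z t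
      by (auto intro!: derivative_eq_intros slope_deriv)
  qed measurable
  also have "(\<integral>z. (4 * c z * slope z t + (2 * c z + (slope z t)\<^sup>2) * slope z t) * exp (expo z t) \<partial>M) = f3 t"
    unfolding f3_def by (intro Bochner_Integration.integral_cong refl) (simp add: algebra_simps power3_eq_cube power2_eq_square)
  finally show "(f2 has_real_derivative f3 t) (at t)"
    by (simp add: f2_def[abs_def])
qed

text \<open>The ratio is an average under the probability measure with density
  \<open>exp (expo z t) / f0 t\<close>, so a bound on the integrand survives without any loss from
  the normalization.\<close>

lemma abs_integral_exp_le:
  assumes [measurable]: "P \<in> borel_measurable M" and P: "AE z in M. \<bar>P z\<bar> \<le> C" and t: "t \<in> {-2<..<2}"
  shows "\<bar>(\<integral>z. P z * exp (expo z t) \<partial>M) / f0 t\<bar> \<le> C"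
proof -
  have "\<bar>\<integral>z. P z * exp (expo z t) \<partial>M\<bar> \<le> (\<integral>z. \<bar>P z * exp (expo z t)\<bar> \<partial>M)"
    by (rule integral_abs_bound)
  also have "\<dots> \<le> (\<integral>z. C * exp (expo z t) \<partial>M)"
  proof (rule integral_mono_AE)
    show "AE z in M. \<bar>P z * exp (expo z t)\<bar> \<le> C * exp (expo z t)"
      using P by eventually_elim (auto simp: abs_mult)
  qed (use integrable_exp_mult[OF assms] integrable_exp[OF t] in auto)
  also have "\<dots> = C * f0 t" by (simp add: f0_def)
  finally show ?thesis using f0_pos[OF t] by (simp add: abs_divide pos_divide_le_eq)
qed

text \<open>The relation between moments and cumulants, written in the ratios to \<open>f0\<close>,
  each of which is an average under the tilted measure.\<close>

lemma DERIV_ln_f0: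
  assumes t: "t \<in> {-2<..<2}"
  shows "((\<lambda>t. ln (f0 t)) has_real_derivative f1 t / f0 t) (at t)"
    "((\<lambda>t. f1 t / f0 t) has_real_derivative f2 t / f0 t - (f1 t / f0 t)\<^sup>2) (at t)"
    "((\<lambda>t. f2 t / f0 t - (f1 t / f0 t)\<^sup>2) has_real_derivative
       f3 t / f0 t - 3 * (f1 t / f0 t) * (f2 t / f0 t) + 2 * (f1 t / f0 t) ^ 3) (at t)"
proof -
  note D = DERIV_f[OF t] and p = f0_pos[OF t]
  then have nz: "f0 t \<noteq> 0" by simp
  show "((\<lambda>t. ln (f0 t)) has_real_derivative f1 t / f0 t) (at t)"
    using p by (auto intro!: derivative_eq_intros D)
  show 1: "((\<lambda>t. f1 t / f0 t) has_real_derivative f2 t / f0 t - (f1 t / f0 t)\<^sup>2) (at t)"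
    by (rule DERIV_cong[OF DERIV_divide[OF D(2) D(1) nz]])
       (use nz in \<open>simp add: field_simps power2_eq_square\<close>)
  have 2: "((\<lambda>t. f2 t / f0 t) has_real_derivative f3 t / f0 t - (f1 t / f0 t) * (f2 t / f0 t)) (at t)"
    by (rule DERIV_cong[OF DERIV_divide[OF D(3) D(1) nz]])
       (use nz in \<open>simp add: field_simps power2_eq_square\<close>)
  show "((\<lambda>t. f2 t / f0 t - (f1 t / f0 t)\<^sup>2) has_real_derivative
       f3 t / f0 t - 3 * (f1 t / f0 t) * (f2 t / f0 t) + 2 * (f1 t / f0 t) ^ 3) (at t)"
    by (rule DERIV_cong[OF DERIV_diff[OF 2 DERIV_power[OF 1, of 2]]])
       (simp add: power2_eq_square power3_eq_cube algebra_simps)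
qed

context
  fixes u v :: real
  assumes uv: "AE z in M. (\<forall>t\<in>{-1..1}. \<bar>slope z t\<bar> \<le> u) \<and> \<bar>2 * c z\<bar> \<le> v"
begin

lemma ratio_bounds:
  assumes t: "t \<in> {-1..1}"
  shows "\<bar>f1 t / f0 t\<bar> \<le> u" "\<bar>f2 t / f0 t\<bar> \<le> v + u\<^sup>2" "\<bar>f3 t / f0 t\<bar> \<le> 3 * v * u + u ^ 3" "u \<ge> 0" "v \<ge> 0"
proof -
  have t': "t \<in> {-2<..<2}" using t by auto
  have uv': "AE z in M. \<bar>slope z t\<bar> \<le> u \<and> \<bar>2 * c z\<bar> \<le> v"
    using uv by eventually_elim (use t in auto)
  then have "AE z in M. 0 \<le> u \<and> 0 \<le> v" by eventually_elim auto
  then have uv0: "u \<ge> 0" "v \<ge> 0" by auto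
  then show "u \<ge> 0" "v \<ge> 0" .
  show "\<bar>f1 t / f0 t\<bar> \<le> u"
    unfolding f1_def by (rule abs_integral_exp_le[OF _ _ t']) (use uv' in \<open>auto elim!: AE_mp intro!: AE_I2\<close>)
  show "\<bar>f2 t / f0 t\<bar> \<le> v + u\<^sup>2"
    unfolding f2_def
  proof (rule abs_integral_exp_le[OF _ _ t'])
    show "AE z in M. \<bar>2 * c z + (slope z t)\<^sup>2\<bar> \<le> v + u\<^sup>2"
      using uv'
    proof eventually_elim
      case (elim z)
      have "(slope z t)\<^sup>2 \<le> u\<^sup>2" using elim uv0 by (simp add: abs_le_square_iff[symmetric])
      then show ?case using elim by (smt (verit) zero_le_power2)
    qed
  qed measurable
  show "\<bar>f3 t / f0 t\<bar> \<le> 3 * v * u + u ^ 3"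
    unfolding f3_def
  proof (rule abs_integral_exp_le[OF _ _ t'])
    show "AE z in M. \<bar>6 * c z * slope z t + (slope z t)^3\<bar> \<le> 3 * v * u + u ^ 3"
      using uv'
    proof eventually_elim
      case (elim z)
      have "\<bar>slope z t\<bar> ^ 3 \<le> u ^ 3" using elim by (intro power_mono) auto
      then have 1: "\<bar>(slope z t) ^ 3\<bar> \<le> u ^ 3" by (simp add: power_abs)
      have "\<bar>2 * c z\<bar> * \<bar>slope z t\<bar> \<le> v * u" using elim uv0 by (intro mult_mono) auto
      then have "\<bar>(2 * c z) * slope z t\<bar> \<le> v * u" by (simp only: abs_mult)
      then show ?case using 1 by (simp add: abs_le_iff)
    qed
  qed measurable
qed

lemma ln_f0_Taylor1: "\<bar>ln (f0 1) - ln (f0 0)\<bar> \<le> u"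
proof -
  obtain t where t: "0 < t" "t < 1" "ln (f0 1) - ln (f0 0) = (1 - 0) * (f1 t / f0 t)"
    using MVT2[of 0 1 "\<lambda>t. ln (f0 t)" "\<lambda>t. f1 t / f0 t"] DERIV_ln_f0(1) by auto
  then show ?thesis using ratio_bounds(1)[of t] by simp
qed

text \<open>The second derivative is at most \<open>2 * (v + u\<^sup>2)\<close>, and the factor 2
  cancels against the factorial in the remainder.\<close>

lemma ln_f0_Taylor2: "\<bar>ln (f0 1) - ln (f0 0) - f1 0 / f0 0\<bar> \<le> v + u\<^sup>2"
proof -
  let ?d = "\<lambda>(m::nat) t. (if m = 0 then ln (f0 t) else if m = 1 then f1 t / f0 t
     else f2 t / f0 t - (f1 t / f0 t)\<^sup>2)"
  have d: "\<forall>m t. m < 2 \<and> 0 \<le> t \<and> t \<le> 1 \<longrightarrow> (?d m has_real_derivative ?d (Suc m) t) (at t)"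
  proof (intro allI impI)
    fix m :: nat and t :: real assume mt: "m < 2 \<and> 0 \<le> t \<and> t \<le> 1"
    then have t: "t \<in> {-2<..<2}" and m: "m = 0 \<or> m = 1" by auto
    from m show "(?d m has_real_derivative ?d (Suc m) t) (at t)"
      using DERIV_ln_f0[OF t] by (elim disjE) simp_all
  qed
  obtain t where t: "0 < t" "t < 1"
    "ln (f0 1) = (\<Sum>m<2. ?d m 0 / fact m * 1 ^ m) + ?d 2 t / fact 2 * 1 ^ 2"
    using Maclaurin[of 1 2 ?d "\<lambda>t. ln (f0 t)", OF _ _ _ d] by auto
  then have eq: "ln (f0 1) - ln (f0 0) - f1 0 / f0 0 = (f2 t / f0 t - (f1 t / f0 t)\<^sup>2) / 2"
    by (simp add: numeral_2_eq_2)
  have t': "t \<in> {-1..1}" using t by auto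
  have "(f1 t / f0 t)\<^sup>2 \<le> u\<^sup>2"
    using ratio_bounds[OF t'] by (simp add: abs_le_square_iff[symmetric])
  then have "\<bar>f2 t / f0 t - (f1 t / f0 t)\<^sup>2\<bar> \<le> 2 * (v + u\<^sup>2)"
    using ratio_bounds[OF t'] by (smt (verit) zero_le_power2)
  then show ?thesis unfolding eq by simp
qed

text \<open>The ratio bounds give
  \<open>(3 * v * u + u ^ 3) + 3 * u * (v + u\<^sup>2) + 2 * u ^ 3\<close> for the third derivative.
  This is \<open>6 * (v * u + u ^ 3)\<close>, and 6 is the factorial in the remainder.\<close>

lemma ln_f0_Taylor3:
  "\<bar>ln (f0 1) - ln (f0 0) - f1 0 / f0 0 - (f2 0 / f0 0 - (f1 0 / f0 0)\<^sup>2) / 2\<bar> \<le> v * u + u ^ 3"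
proof -
  let ?d = "\<lambda>(m::nat) t. (if m = 0 then ln (f0 t) else if m = 1 then f1 t / f0 t
     else if m = 2 then f2 t / f0 t - (f1 t / f0 t)\<^sup>2
     else f3 t / f0 t - 3 * (f1 t / f0 t) * (f2 t / f0 t) + 2 * (f1 t / f0 t) ^ 3)"
  have d: "\<forall>m t. m < 3 \<and> 0 \<le> t \<and> t \<le> 1 \<longrightarrow> (?d m has_real_derivative ?d (Suc m) t) (at t)"
  proof (intro allI impI)
    fix m :: nat and t :: real assume mt: "m < 3 \<and> 0 \<le> t \<and> t \<le> 1"
    then have t: "t \<in> {-2<..<2}" and m: "m = 0 \<or> m = 1 \<or> m = 2" by auto
    from m show "(?d m has_real_derivative ?d (Suc m) t) (at t)"
      using DERIV_ln_f0[OF t] by (elim disjE) (simp_all add: numeral_2_eq_2)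
  qed
  obtain t where t: "0 < t" "t < 1"
    "ln (f0 1) = (\<Sum>m<3. ?d m 0 / fact m * 1 ^ m) + ?d 3 t / fact 3 * 1 ^ 3"
    using Maclaurin[of 1 3 ?d "\<lambda>t. ln (f0 t)", OF _ _ _ d] by auto
  then have eq: "ln (f0 1) - ln (f0 0) - f1 0 / f0 0 - (f2 0 / f0 0 - (f1 0 / f0 0)\<^sup>2) / 2 =
     (f3 t / f0 t - 3 * (f1 t / f0 t) * (f2 t / f0 t) + 2 * (f1 t / f0 t) ^ 3) / 6"
    by (simp add: numeral_3_eq_3 numeral_2_eq_2)
  have t': "t \<in> {-1..1}" using t by auto
  note r = ratio_bounds[OF t']
  have 1: "\<bar>(f1 t / f0 t) * (f2 t / f0 t)\<bar> \<le> u * (v + u\<^sup>2)"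
    unfolding abs_mult using r by (intro mult_mono) auto
  have "\<bar>f1 t / f0 t\<bar> ^ 3 \<le> u ^ 3" using r by (intro power_mono) auto
  then have 2: "\<bar>(f1 t / f0 t) ^ 3\<bar> \<le> u ^ 3" by (simp only: power_abs)
  have comb: "\<bar>x - 3 * y + 2 * z\<bar> \<le> A + 3 * B + 2 * D"
    if "\<bar>x\<bar> \<le> A" "\<bar>y\<bar> \<le> B" "\<bar>z\<bar> \<le> D" for x y z A B D :: real
    using that by linarith
  have "u * (v + u\<^sup>2) = v * u + u ^ 3" by (simp add: algebra_simps power2_eq_square power3_eq_cube)
  then have "\<bar>f3 t / f0 t - 3 * ((f1 t / f0 t) * (f2 t / f0 t)) + 2 * (f1 t / f0 t) ^ 3\<bar> \<le> 6 * (v * u + u ^ 3)"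
    using comb[OF r(3) 1 2] by (simp add: algebra_simps)
  then show ?thesis unfolding eq by (simp add: mult.assoc)
qed

end

end

section \<open>The density of the observations\<close>

text \<open>All estimates are uniform over the ball of radius \<open>R\<close>. The parameter set will lie in the ball of radius
  \<open>R / 3\<close>, so that the line through two of its points stays in the large ball on the time interval
  \<open>[-1, 1]\<close>.\<close>

locale mixture_model = prob_space M for M :: "'z measure" +
  fixes A :: "'z \<Rightarrow> real^'m^'d" and \<sigma> \<beta> \<kappa> R :: real
  assumes A_meas[measurable]: "A \<in> borel_measurable M"
    and sigma: "\<sigma> > 0" and kappa: "\<kappa> \<ge> 0" and R: "R > 0"
    and A_bound: "AE z in M. \<forall>x. norm (\<beta> *\<^sub>R (A z *v x)) \<le> \<kappa> * norm x"
begin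

abbreviation p :: "real^'m \<Rightarrow> real^'d \<Rightarrow> real" where "p \<equiv> obs_dens M A \<sigma> \<beta>"
abbreviation P :: "real^'m \<Rightarrow> (real^'d) measure" where "P \<equiv> obs_law M A \<sigma> \<beta>"

definition act :: "'z \<Rightarrow> real^'m \<Rightarrow> real^'d" where "act z x = \<beta> *\<^sub>R (A z *v x)"
definition c0 :: real where "c0 = (1 / sqrt (2 * pi * \<sigma>\<^sup>2)) ^ DIM(real^'d)"

text \<open>The exponent at \<open>\<theta> + t w\<close> is \<open>ea \<theta> + t eb \<theta> w + t\<^sup>2 ec w w\<close>.\<close>

definition ea :: "real^'m \<Rightarrow> real^'d \<Rightarrow> 'z \<Rightarrow> real" where
  "ea \<theta> y z = - (norm (y - act z \<theta>))\<^sup>2 / (2 * \<sigma>\<^sup>2)"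
definition eb :: "real^'m \<Rightarrow> real^'d \<Rightarrow> real^'m \<Rightarrow> 'z \<Rightarrow> real" where
  "eb \<theta> y w z = ((y - act z \<theta>) \<bullet> act z w) / \<sigma>\<^sup>2"
definition ec :: "real^'m \<Rightarrow> real^'m \<Rightarrow> 'z \<Rightarrow> real" where
  "ec v w z = - (act z v \<bullet> act z w) / (2 * \<sigma>\<^sup>2)"

lemma measurable_act[measurable]: "(\<lambda>z. act z x) \<in> borel_measurable M"
proof -
  have "continuous_on UNIV (\<lambda>B::real^'m^'d. B *v x)"
    by (intro linear_continuous_on linear_conv_bounded_linear[THEN iffD1] linearI)
       (simp_all add: matrix_vector_mult_add_rdistrib scaleR_matrix_vector_assoc)
  then have "(\<lambda>z. A z *v x) \<in> borel_measurable M"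
    by (intro measurable_compose[OF A_meas] borel_measurable_continuous_onI)
  then show ?thesis unfolding act_def by simp
qed

lemma measurable_exponents[measurable]:
  "(\<lambda>z. ea \<theta> y z) \<in> borel_measurable M" "(\<lambda>z. eb \<theta> y w z) \<in> borel_measurable M"
  "(\<lambda>z. ec v w z) \<in> borel_measurable M"
  "(\<lambda>(y, z). ea \<theta> y z) \<in> borel_measurable (borel \<Otimes>\<^sub>M M)" "(\<lambda>(y, z). eb \<theta> y w z) \<in> borel_measurable (borel \<Otimes>\<^sub>M M)"
  unfolding ea_def eb_def ec_def by measurable

lemma act_linear: "act z (x + y) = act z x + act z y" "act z (r *\<^sub>R x) = r *\<^sub>R act z x"
  by (simp_all add: act_def matrix_vector_right_distrib scaleR_right_distrib
      matrix_vector_mult_scaleR[symmetric] mult.commute)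

lemma act_bound: "AE z in M. \<forall>x. norm (act z x) \<le> \<kappa> * norm x"
  using A_bound by (simp add: act_def)

lemma c0_pos: "c0 > 0" using sigma by (simp add: c0_def)

lemma p_eq: "p \<theta> y = c0 * (\<integral>z. exp (ea \<theta> y z) \<partial>M)"
  unfolding obs_dens_def gauss_density_eq c0_def[symmetric] ea_def act_def by simp

lemma ea_line: "ea (\<theta> + t *\<^sub>R w) y z = ea \<theta> y z + eb \<theta> y w z * t + ec w w z * t\<^sup>2"
proof -
  let ?r = "y - act z \<theta>" and ?a = "act z w"
  have "(norm (?r - t *\<^sub>R ?a))\<^sup>2 = (norm ?r)\<^sup>2 - 2 * t * (?r \<bullet> ?a) + t\<^sup>2 * (?a \<bullet> ?a)"
    unfolding power2_norm_eq_inner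
    by (simp only: inner_diff_left inner_diff_right inner_scaleR_left inner_scaleR_right)
       (simp add: inner_commute power2_eq_square algebra_simps)
  moreover have "y - act z (\<theta> + t *\<^sub>R w) = ?r - t *\<^sub>R ?a" by (simp add: act_linear)
  ultimately have "ea (\<theta> + t *\<^sub>R w) y z =
      - ((norm ?r)\<^sup>2 - 2 * t * (?r \<bullet> ?a) + t\<^sup>2 * (?a \<bullet> ?a)) / (2 * \<sigma>\<^sup>2)"
    by (simp only: ea_def)
  also have "\<dots> = ea \<theta> y z + eb \<theta> y w z * t + ec w w z * t\<^sup>2"
    by (simp add: ea_def eb_def ec_def diff_divide_distrib add_divide_distrib mult_ac)
  finally show ?thesis .
qed

lemma eb_line: "eb (\<theta> + t *\<^sub>R w) y w z = eb \<theta> y w z + 2 * ec w w z * t"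
  using sigma
  by (simp add: eb_def ec_def act_linear inner_diff_left inner_add_left field_simps)

lemma eb_bound: "AE z in M. \<forall>\<theta> w. \<bar>eb \<theta> y w z\<bar> \<le> (norm y + \<kappa> * norm \<theta>) * (\<kappa> * norm w) / \<sigma>\<^sup>2"
  using act_bound
proof eventually_elim
  case (elim z)
  show ?case
  proof (intro allI)
    fix \<theta> w
    have "\<bar>(y - act z \<theta>) \<bullet> act z w\<bar> \<le> norm (y - act z \<theta>) * norm (act z w)"
      by (rule Cauchy_Schwarz_ineq2)
    also have "\<dots> \<le> (norm y + \<kappa> * norm \<theta>) * (\<kappa> * norm w)"
      using elim[rule_format, of \<theta>] elim[rule_format, of w] norm_triangle_ineq4[of y "act z \<theta>"] kappa
      by (intro mult_mono) auto
    finally show "\<bar>eb \<theta> y w z\<bar> \<le> (norm y + \<kappa> * norm \<theta>) * (\<kappa> * norm w) / \<sigma>\<^sup>2"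
      using sigma by (simp add: eb_def abs_divide divide_right_mono)
  qed
qed

lemma ec_bound: "AE z in M. \<forall>v w. \<bar>2 * ec v w z\<bar> \<le> (\<kappa> * norm v) * (\<kappa> * norm w) / \<sigma>\<^sup>2"
  using act_bound
proof eventually_elim
  case (elim z)
  show ?case
  proof (intro allI)
    fix v w
    have "\<bar>act z v \<bullet> act z w\<bar> \<le> norm (act z v) * norm (act z w)"
      by (rule Cauchy_Schwarz_ineq2)
    also have "\<dots> \<le> (\<kappa> * norm v) * (\<kappa> * norm w)"
      using elim kappa by (intro mult_mono) auto
    finally show "\<bar>2 * ec v w z\<bar> \<le> (\<kappa> * norm v) * (\<kappa> * norm w) / \<sigma>\<^sup>2"
      using sigma by (simp add: ec_def abs_divide divide_right_mono)
  qed
qed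

lemma ea_bound: "AE z in M. \<forall>\<theta>. \<bar>ea \<theta> y z\<bar> \<le> (norm y + \<kappa> * norm \<theta>)\<^sup>2 / (2 * \<sigma>\<^sup>2)"
  using act_bound
proof eventually_elim
  case (elim z)
  show ?case
  proof
    fix \<theta>
    have "norm (y - act z \<theta>) \<le> norm y + \<kappa> * norm \<theta>"
      using elim[rule_format, of \<theta>] norm_triangle_ineq4[of y "act z \<theta>"] by linarith
    then have "(norm (y - act z \<theta>))\<^sup>2 \<le> (norm y + \<kappa> * norm \<theta>)\<^sup>2"
      by (intro power_mono) auto
    then show "\<bar>ea \<theta> y z\<bar> \<le> (norm y + \<kappa> * norm \<theta>)\<^sup>2 / (2 * \<sigma>\<^sup>2)"
      using sigma by (simp add: ea_def abs_divide divide_right_mono)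
  qed
qed

lemma ea_nonpos: "ea \<theta> y z \<le> 0" using sigma by (simp add: ea_def)

lemma quadratic_exponent_model:
  "\<exists>K. quadratic_exponent M (ea \<theta> y) (eb \<theta> y w) (ec w w) K"
proof -
  define K1 where "K1 = (norm y + \<kappa> * norm \<theta>)\<^sup>2 / (2 * \<sigma>\<^sup>2)"
  define K2 where "K2 = (norm y + \<kappa> * norm \<theta>) * (\<kappa> * norm w) / \<sigma>\<^sup>2"
  define K3 where "K3 = (\<kappa> * norm w) * (\<kappa> * norm w) / \<sigma>\<^sup>2"
  have nn: "K1 \<ge> 0" "K2 \<ge> 0" "K3 \<ge> 0"
    using kappa by (simp_all add: K1_def K2_def K3_def)
  have "quadratic_exponent M (ea \<theta> y) (eb \<theta> y w) (ec w w) (K1 + K2 + K3)"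
  proof
    show "AE z in M. \<bar>ea \<theta> y z\<bar> \<le> K1 + K2 + K3 \<and> \<bar>eb \<theta> y w z\<bar> \<le> K1 + K2 + K3 \<and> \<bar>ec w w z\<bar> \<le> K1 + K2 + K3"
      using ea_bound[of y] eb_bound[of y] ec_bound
    proof eventually_elim
      case (elim z)
      from elim(1)[rule_format, of \<theta>] elim(2)[rule_format, of \<theta> w] elim(3)[rule_format, of w w]
      have "\<bar>ea \<theta> y z\<bar> \<le> K1" "\<bar>eb \<theta> y w z\<bar> \<le> K2" "\<bar>2 * ec w w z\<bar> \<le> K3"
        by (simp_all only: K1_def K2_def K3_def)
      with nn show ?case by (intro conjI; linarith)
    qed
  qed measurable
  then show ?thesis by blast
qed

section \<open>Positivity, tails and total mass of the density\<close>

definition wt :: "real^'m \<Rightarrow> real^'d \<Rightarrow> real" where "wt \<theta> y = (\<integral>z. exp (ea \<theta> y z) \<partial>M)"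

lemma p_wt: "p \<theta> y = c0 * wt \<theta> y" by (simp add: p_eq wt_def)

lemma integrable_exp_ea_mult:
  assumes [measurable]: "f \<in> borel_measurable M" and f: "AE z in M. \<bar>f z\<bar> \<le> C"
  shows "integrable M (\<lambda>z. f z * exp (ea \<theta> y z))"
proof (rule integrable_const_bound[of _ C])
  show "AE z in M. norm (f z * exp (ea \<theta> y z)) \<le> C"
    using f
  proof eventually_elim
    case (elim z)
    have "\<bar>f z\<bar> * exp (ea \<theta> y z) \<le> C * 1" using elim ea_nonpos by (intro mult_mono) auto
    then show ?case by (simp add: abs_mult)
  qed
qed measurable

lemma wt_pos: "wt \<theta> y > 0"
proof -
  obtain K where "quadratic_exponent M (ea \<theta> y) (eb \<theta> y 0) (ec 0 0) K" using quadratic_exponent_model by blast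
  then interpret quadratic_exponent M "ea \<theta> y" "eb \<theta> y 0" "ec 0 0" K .
  have "f0 0 > 0" by (rule f0_pos) simp
  then show ?thesis by (simp add: f0_def expo_def wt_def)
qed

lemma p_pos: "p \<theta> y > 0" using wt_pos c0_pos by (simp add: p_wt)

lemma measurable_wt[measurable]: "wt \<theta> \<in> borel_measurable borel"
  unfolding wt_def by measurable

lemma measurable_p[measurable]: "p \<theta> \<in> borel_measurable borel"
proof -
  have "p \<theta> = (\<lambda>y. c0 * wt \<theta> y)" by (simp add: fun_eq_iff p_wt)
  then show ?thesis by simp
qed

text \<open>A shift of the centre by a bounded vector costs a constant and half of the decay rate,
  because \<open>norm y\<close> squared is at most twice the sum of the squared norms of
  \<open>y - act z \<theta>\<close> and \<open>act z \<theta>\<close>.\<close>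

lemma wt_upper:
  assumes "norm \<theta> \<le> R"
  shows "wt \<theta> y \<le> exp (\<kappa>\<^sup>2 * R\<^sup>2 / (2 * \<sigma>\<^sup>2)) * exp (- (1 / (4 * \<sigma>\<^sup>2) * (norm y)\<^sup>2))"
proof -
  let ?c = "exp (\<kappa>\<^sup>2 * R\<^sup>2 / (2 * \<sigma>\<^sup>2)) * exp (- (1 / (4 * \<sigma>\<^sup>2) * (norm y)\<^sup>2))"
  have "wt \<theta> y \<le> (\<integral>z. ?c \<partial>M)"
    unfolding wt_def
  proof (rule integral_mono_AE)
    show "integrable M (\<lambda>z. exp (ea \<theta> y z))" using integrable_exp_ea_mult[of "\<lambda>_. 1" 1] by simp
    show "AE z in M. exp (ea \<theta> y z) \<le> ?c"
      using act_bound
    proof eventually_elim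
      case (elim z)
      have a: "norm (act z \<theta>) \<le> \<kappa> * R"
        using elim[rule_format, of \<theta>] assms kappa by (meson mult_left_mono order.trans)
      have "(norm (act z \<theta>))\<^sup>2 \<le> (\<kappa> * R)\<^sup>2" using a by (intro power_mono) auto
      then have a2: "(norm (act z \<theta>))\<^sup>2 \<le> \<kappa>\<^sup>2 * R\<^sup>2" by (simp add: power_mult_distrib)
      have "norm y \<le> norm (y - act z \<theta>) + norm (act z \<theta>)" by (metis diff_add_cancel norm_triangle_ineq)
      then have "(norm y)\<^sup>2 \<le> (norm (y - act z \<theta>) + norm (act z \<theta>))\<^sup>2" by (intro power_mono) auto
      also have "\<dots> \<le> 2 * (norm (y - act z \<theta>))\<^sup>2 + 2 * (norm (act z \<theta>))\<^sup>2"
        using zero_le_power2[of "norm (y - act z \<theta>) - norm (act z \<theta>)"]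
        by (simp add: power2_sum power2_diff)
      finally have "(norm y)\<^sup>2 / 2 - \<kappa>\<^sup>2 * R\<^sup>2 \<le> (norm (y - act z \<theta>))\<^sup>2" using a2 by simp
      then have "((norm y)\<^sup>2 / 2 - \<kappa>\<^sup>2 * R\<^sup>2) / (2 * \<sigma>\<^sup>2) \<le> (norm (y - act z \<theta>))\<^sup>2 / (2 * \<sigma>\<^sup>2)"
        by (intro divide_right_mono) auto
      then have "ea \<theta> y z \<le> \<kappa>\<^sup>2 * R\<^sup>2 / (2 * \<sigma>\<^sup>2) + - (1 / (4 * \<sigma>\<^sup>2) * (norm y)\<^sup>2)"
        unfolding ea_def by (simp add: diff_divide_distrib)
      then show ?case unfolding mult_exp_exp by simp
    qed
  qed simp
  then show ?thesis by (simp add: prob_space)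
qed

text \<open>Exchanging the integrals and translating reduces the total mass to that of one Gaussian
  density.\<close>

lemma nn_integral_p: "(\<integral>\<^sup>+y. ennreal (p \<theta> y) \<partial>lborel) = 1"
proof -
  interpret pair_sigma_finite M "lborel :: (real^'d) measure" by standard
  have g: "gauss_density \<sigma> (y - act z \<theta>) = c0 * exp (ea \<theta> y z)" for y z
    by (simp add: gauss_density_eq c0_def ea_def)
  have int: "integrable M (\<lambda>z. c0 * exp (ea \<theta> y z))" for y
    using integrable_exp_ea_mult[of "\<lambda>_. 1" 1] by simp
  have "(\<integral>\<^sup>+y. ennreal (p \<theta> y) \<partial>lborel) = (\<integral>\<^sup>+y. \<integral>\<^sup>+z. ennreal (c0 * exp (ea \<theta> y z)) \<partial>M \<partial>lborel)"
    using c0_pos int by (intro nn_integral_cong) (simp add: p_eq nn_integral_eq_integral)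
  also have "\<dots> = (\<integral>\<^sup>+z. \<integral>\<^sup>+y. ennreal (c0 * exp (ea \<theta> y z)) \<partial>lborel \<partial>M)"
  proof (rule Fubini')
    show "(\<lambda>(z, y). ennreal (c0 * exp (ea \<theta> y z))) \<in> borel_measurable (M \<Otimes>\<^sub>M lborel)"
      unfolding ea_def by measurable
  qed
  also have "\<dots> = (\<integral>\<^sup>+z. 1 \<partial>M)"
  proof (intro nn_integral_cong)
    fix z
    have "(\<integral>\<^sup>+y. ennreal (gauss_density \<sigma> (y - act z \<theta>)) \<partial>lborel) =
        (\<integral>\<^sup>+y. ennreal (gauss_density \<sigma> (y - act z \<theta>)) \<partial>distr lborel borel ((+) (act z \<theta>)))"
      by (simp add: lborel_distr_plus)
    also have "\<dots> = (\<integral>\<^sup>+y. ennreal (gauss_density \<sigma> (y::real^'d)) \<partial>lborel)"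
      by (subst nn_integral_distr) auto
    also have "\<dots> = 1"
      using nn_integral_eq_integral[OF integrable_gauss_density[OF sigma]] sigma
      by (simp add: integral_gauss_density less_imp_le gauss_density_pos)
    finally show "(\<integral>\<^sup>+y. ennreal (c0 * exp (ea \<theta> y z)) \<partial>lborel) = 1" by (simp add: g)
  qed
  also have "\<dots> = 1" using emeasure_space_1 by simp
  finally show ?thesis .
qed

lemma integral_p: "integrable lborel (p \<theta>)" "(\<integral>y. p \<theta> y \<partial>lborel) = 1"
proof -
  show "integrable lborel (p \<theta>)"
    using nn_integral_p[of \<theta>] less_imp_le[OF p_pos] by (intro integrableI_nonneg) auto
  then show "(\<integral>y. p \<theta> y \<partial>lborel) = 1"
    using nn_integral_p[of \<theta>] less_imp_le[OF p_pos]
    by (subst (asm) nn_integral_eq_integral) auto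
qed

lemma P_simps[simp]: "sets (P \<theta>) = sets borel" "space (P \<theta>) = UNIV"
  by (simp_all add: obs_law_def)

lemma measurable_P_iff[simp]: "borel_measurable (P \<theta>) = borel_measurable borel"
  by (simp cong: measurable_cong_sets)

lemma integral_P:
  fixes f :: "real^'d \<Rightarrow> 'b::{banach, second_countable_topology}"
  assumes "f \<in> borel_measurable borel"
  shows "(\<integral>y. f y \<partial>P \<theta>) = (\<integral>y. p \<theta> y *\<^sub>R f y \<partial>lborel)"
    and "integrable (P \<theta>) f \<longleftrightarrow> integrable lborel (\<lambda>y. p \<theta> y *\<^sub>R f y)"
  unfolding obs_law_def using assms less_imp_le[OF p_pos]
  by (auto simp: integral_density integrable_density)

lemma integrable_poly_wt:
  fixes f :: "real^'d \<Rightarrow> real"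
  assumes [measurable]: "f \<in> borel_measurable borel"
    and f: "\<And>y. \<bar>f y\<bar> \<le> C * (1 + norm y) ^ k * wt \<theta> y" and \<theta>: "norm \<theta> \<le> R" and C: "C \<ge> 0"
  shows "integrable lborel f"
proof (rule Bochner_Integration.integrable_bound)
  let ?D = "exp (\<kappa>\<^sup>2 * R\<^sup>2 / (2 * \<sigma>\<^sup>2))" and ?c = "1 / (4 * \<sigma>\<^sup>2)"
  show "integrable lborel (\<lambda>y::real^'d. C * ?D * ((1 + norm y) ^ k * exp (- (?c * (norm y)\<^sup>2))))"
    using sigma by (intro integrable_mult_right integrable_poly_gauss) simp
  show "AE y in lborel. norm (f y) \<le> norm (C * ?D * ((1 + norm y) ^ k * exp (- (?c * (norm y)\<^sup>2))))"
  proof (rule AE_I2)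
    fix y
    have "\<bar>f y\<bar> \<le> C * (1 + norm y) ^ k * wt \<theta> y" by (rule f)
    also have "\<dots> \<le> C * (1 + norm y) ^ k * (?D * exp (- (?c * (norm y)\<^sup>2)))"
      using C by (intro mult_left_mono wt_upper \<theta>) auto
    finally show "norm (f y) \<le> norm (C * ?D * ((1 + norm y) ^ k * exp (- (?c * (norm y)\<^sup>2))))"
      using C by (simp add: abs_mult mult_ac)
  qed
qed measurable

text \<open>The Gaussian tail of the density dominates every polynomial; from here on integrability
  is checked through polynomial growth.\<close>

lemma integrable_P_poly:
  fixes f :: "real^'d \<Rightarrow> 'b::euclidean_space"
  assumes [measurable]: "f \<in> borel_measurable borel"
    and f: "\<And>y. norm (f y) \<le> C * (1 + norm y) ^ k" and \<theta>: "norm \<theta> \<le> R"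
  shows "integrable (P \<theta>) f"
proof -
  have C: "C \<ge> 0" using order.trans[OF norm_ge_zero f[of 0]] by simp
  have "integrable lborel (\<lambda>y. p \<theta> y * norm (f y))"
  proof (rule integrable_poly_wt[OF _ _ \<theta>])
    show "\<bar>p \<theta> y * norm (f y)\<bar> \<le> (c0 * C) * (1 + norm y) ^ k * wt \<theta> y" for y
      using f[of y] c0_pos wt_pos[of \<theta> y] by (simp add: p_wt abs_mult mult_left_mono mult_ac)
  qed (use C c0_pos in auto)
  then have "integrable (P \<theta>) (\<lambda>y. norm (f y))"
    by (simp add: integral_P)
  then show ?thesis by (rule integrable_norm_cancel) simp
qed

lemma continuous_p: "continuous_on UNIV (p \<theta>)"
  unfolding continuous_on_sequentially
proof safe
  fix X and y :: "real^'d" assume X: "X \<longlonglongrightarrow> y"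
  have "(\<lambda>i. \<integral>z. exp (ea \<theta> (X i) z) \<partial>M) \<longlonglongrightarrow> (\<integral>z. exp (ea \<theta> y z) \<partial>M)"
  proof (rule integral_dominated_convergence[where w = "\<lambda>_. 1"])
    show "AE z in M. (\<lambda>i. exp (ea \<theta> (X i) z)) \<longlonglongrightarrow> exp (ea \<theta> y z)"
      unfolding ea_def using sigma by (intro AE_I2 tendsto_intros X) auto
  qed (auto simp: ea_nonpos)
  then show "(p \<theta> \<circ> X) \<longlonglongrightarrow> p \<theta> y"
    unfolding p_eq o_def by (intro tendsto_intros)
qed

text \<open>Both densities are continuous, so the set where they differ is open, and an open null
  set is empty. A class thereby becomes a level set of \<open>p\<close>, which later makes it
  closed.\<close>

lemma obs_equiv_iff: "obs_equiv M A \<sigma> \<beta> \<theta> \<theta>' \<longleftrightarrow> p \<theta> = p \<theta>'"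
proof
  assume "obs_equiv M A \<sigma> \<beta> \<theta> \<theta>'"
  then have ae: "AE y in lborel. y \<notin> {y. p \<theta> y \<noteq> p \<theta>' y}" unfolding obs_equiv_def by simp
  have op: "open {y. p \<theta> y \<noteq> p \<theta>' y}"
    by (rule open_Collect_neq[OF continuous_p continuous_p])
  have "{y. p \<theta> y \<noteq> p \<theta>' y} \<in> null_sets lborel"
    using ae op by (subst AE_iff_null_sets) auto
  then have "negligible {y. p \<theta> y \<noteq> p \<theta>' y}"
    by (simp add: negligible_iff_null_sets null_sets_completionI)
  then have "{y. p \<theta> y \<noteq> p \<theta>' y} = {}" using open_not_negligible[OF op] by blast
  then show "p \<theta> = p \<theta>'" by auto
qed (simp add: obs_equiv_def)

end

section \<open>Score and second derivative of the log-likelihood\<close>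

text \<open>A bilinear form is recovered from its matrix in the standard basis; used for the
  information and for the Hessian, which are both given by entries.\<close>

lemma inner_matrix_of_bilinear:
  fixes h :: "real^'m \<Rightarrow> real^'m \<Rightarrow> real"
  assumes 1: "\<And>w. linear (\<lambda>v. h v w)" and 2: "\<And>v. linear (h v)"
  shows "v \<bullet> ((\<chi> i j. h (axis i 1) (axis j 1)) *v w) = h v w"
proof -
  have ax: "(\<Sum>i\<in>UNIV. (x $ i) *\<^sub>R axis i 1) = x" for x :: "real^'m"
    by (simp add: vec_eq_iff axis_def if_distrib sum.delta cong: if_cong)
  have "h v w = h (\<Sum>i\<in>UNIV. (v $ i) *\<^sub>R axis i 1) (\<Sum>j\<in>UNIV. (w $ j) *\<^sub>R axis j 1)"
    by (simp only: ax)
  also have "\<dots> = (\<Sum>i\<in>UNIV. v $ i * (\<Sum>j\<in>UNIV. w $ j * h (axis i 1) (axis j 1)))"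
    by (subst linear_sum[OF 1], subst linear_cmul[OF 1], subst linear_sum[OF 2], subst linear_cmul[OF 2]) simp
  also have "\<dots> = v \<bullet> ((\<chi> i j. h (axis i 1) (axis j 1)) *v w)"
    by (simp add: inner_vec_def matrix_vector_mult_def mult.commute)
  finally show ?thesis by simp
qed

lemma norm_matrix_le: "norm (H :: real^'n^'m) \<le> (\<Sum>i\<in>UNIV. \<Sum>j\<in>UNIV. \<bar>H $ i $ j\<bar>)"
proof -
  have "norm H \<le> (\<Sum>i\<in>UNIV. norm (H $ i))"
    unfolding norm_vec_def by (rule L2_set_le_sum) simp
  also have "\<dots> \<le> (\<Sum>i\<in>UNIV. \<Sum>j\<in>UNIV. \<bar>H $ i $ j\<bar>)"
    by (intro sum_mono norm_le_l1_cart)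
  finally show ?thesis .
qed

lemma borel_measurable_matrixI:
  fixes H :: "'a \<Rightarrow> real^'n^'m"
  assumes "\<And>i j. (\<lambda>x. H x $ i $ j) \<in> borel_measurable M"
  shows "H \<in> borel_measurable M"
  using assms
  by (subst borel_measurable_euclidean_space) (auto simp: Basis_vec_def inner_axis)

context mixture_model
begin

text \<open>\<open>dscore\<close> is the derivative of the log-density in direction
  \<open>w\<close>: the slope of the exponent averaged over the latent variable given the
  observation. \<open>dhess\<close> is a second derivative of the density divided by the density,
  not one of the logarithm.\<close>

definition dscore :: "real^'m \<Rightarrow> real^'m \<Rightarrow> real^'d \<Rightarrow> real" where
  "dscore \<theta> w y = (\<integral>z. eb \<theta> y w z * exp (ea \<theta> y z) \<partial>M) / wt \<theta> y"
definition dhess :: "real^'m \<Rightarrow> real^'m \<Rightarrow> real^'m \<Rightarrow> real^'d \<Rightarrow> real" where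
  "dhess \<theta> v w y = (\<integral>z. (2 * ec v w z + eb \<theta> y v z * eb \<theta> y w z) * exp (ea \<theta> y z) \<partial>M) / wt \<theta> y"

text \<open>Along the direction \<open>w\<close> the exponent has slope at most \<open>C1 (1 + \<bar>y\<bar>) \<bar>w\<bar>\<close> and curvature at most
  \<open>C2 \<bar>w\<bar>\<^sup>2\<close>.\<close>

definition C1 :: real where "C1 = \<kappa> * (1 + \<kappa> * R) / \<sigma>\<^sup>2"
definition C2 :: real where "C2 = \<kappa>\<^sup>2 / \<sigma>\<^sup>2"

lemma C_nonneg: "C1 \<ge> 0" "C2 \<ge> 0" using kappa R by (simp_all add: C1_def C2_def)

lemma measurable_dscore[measurable]: "dscore \<theta> w \<in> borel_measurable borel"
  unfolding dscore_def by measurable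

lemma measurable_dhess[measurable]: "dhess \<theta> v w \<in> borel_measurable borel"
  unfolding dhess_def by measurable

lemma eb_bound': "AE z in M. \<forall>\<theta> w. norm \<theta> \<le> R \<longrightarrow> \<bar>eb \<theta> y w z\<bar> \<le> C1 * (1 + norm y) * norm w"
  using eb_bound[of y]
proof eventually_elim
  case (elim z)
  show ?case
  proof (intro allI impI)
    fix \<theta> w :: "real^'m" assume \<theta>: "norm \<theta> \<le> R"
    have "norm y + \<kappa> * norm \<theta> \<le> norm y + \<kappa> * R"
      using \<theta> kappa by (simp add: mult_left_mono)
    also have "\<dots> \<le> (1 + \<kappa> * R) * (1 + norm y)"
      using kappa R by (simp add: algebra_simps)
    finally have "(norm y + \<kappa> * norm \<theta>) * (\<kappa> * norm w) / \<sigma>\<^sup>2 \<le> ((1 + \<kappa> * R) * (1 + norm y)) * (\<kappa> * norm w) / \<sigma>\<^sup>2"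
      using kappa by (intro divide_right_mono mult_right_mono) auto
    also have "\<dots> = C1 * (1 + norm y) * norm w" by (simp add: C1_def)
    finally show "\<bar>eb \<theta> y w z\<bar> \<le> C1 * (1 + norm y) * norm w" using elim order.trans by blast
  qed
qed

lemma ec_bound': "AE z in M. \<forall>v w. \<bar>2 * ec v w z\<bar> \<le> C2 * norm v * norm w"
  using ec_bound by eventually_elim (simp add: C2_def power2_eq_square mult_ac)

lemma abs_ratio_le:
  assumes [measurable]: "f \<in> borel_measurable M" and f: "AE z in M. \<bar>f z\<bar> \<le> C"
  shows "\<bar>(\<integral>z. f z * exp (ea \<theta> y z) \<partial>M) / wt \<theta> y\<bar> \<le> C"
proof -
  have "\<bar>\<integral>z. f z * exp (ea \<theta> y z) \<partial>M\<bar> \<le> (\<integral>z. \<bar>f z * exp (ea \<theta> y z)\<bar> \<partial>M)"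
    by (rule integral_abs_bound)
  also have "\<dots> \<le> (\<integral>z. C * exp (ea \<theta> y z) \<partial>M)"
  proof (rule integral_mono_AE)
    show "AE z in M. \<bar>f z * exp (ea \<theta> y z)\<bar> \<le> C * exp (ea \<theta> y z)"
      using f by eventually_elim (auto simp: abs_mult)
  qed (use integrable_exp_ea_mult[OF assms] integrable_exp_ea_mult[of "\<lambda>_. C" "\<bar>C\<bar>"] in auto)
  also have "\<dots> = C * wt \<theta> y" by (simp add: wt_def)
  finally show ?thesis using wt_pos[of \<theta> y] by (simp add: abs_divide pos_divide_le_eq)
qed

lemma dscore_bound:
  assumes "norm \<theta> \<le> R" shows "\<bar>dscore \<theta> w y\<bar> \<le> C1 * (1 + norm y) * norm w"
  unfolding dscore_def
proof (rule abs_ratio_le)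
  show "AE z in M. \<bar>eb \<theta> y w z\<bar> \<le> C1 * (1 + norm y) * norm w"
    using eb_bound'[of y] by eventually_elim (use assms in blast)
qed measurable

lemma hess_integrand_bound:
  assumes "norm \<theta> \<le> R"
  shows "AE z in M. \<bar>2 * ec v w z + eb \<theta> y v z * eb \<theta> y w z\<bar> \<le> (C2 + C1\<^sup>2) * (1 + norm y)\<^sup>2 * (norm v * norm w)"
  using eb_bound'[of y] ec_bound'
proof eventually_elim
  case (elim z)
  have "\<bar>eb \<theta> y v z * eb \<theta> y w z\<bar> \<le> (C1 * (1 + norm y) * norm v) * (C1 * (1 + norm y) * norm w)"
    unfolding abs_mult using elim(1) assms C_nonneg by (intro mult_mono) auto
  also have "\<dots> = C1\<^sup>2 * (1 + norm y)\<^sup>2 * (norm v * norm w)" by (simp add: power2_eq_square)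
  finally have 1: "\<bar>eb \<theta> y v z * eb \<theta> y w z\<bar> \<le> C1\<^sup>2 * (1 + norm y)\<^sup>2 * (norm v * norm w)" .
  have "1 \<le> (1 + norm y)\<^sup>2" by simp
  then have "C2 * norm v * norm w * 1 \<le> C2 * norm v * norm w * (1 + norm y)\<^sup>2"
    using C_nonneg by (intro mult_left_mono) auto
  then have 2: "\<bar>2 * ec v w z\<bar> \<le> C2 * (1 + norm y)\<^sup>2 * (norm v * norm w)"
    using elim(2)[rule_format, of v w] by (simp add: mult_ac)
  have "(C2 + C1\<^sup>2) * (1 + norm y)\<^sup>2 * (norm v * norm w) =
      C2 * (1 + norm y)\<^sup>2 * (norm v * norm w) + C1\<^sup>2 * (1 + norm y)\<^sup>2 * (norm v * norm w)"
    by (simp only: distrib_right)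
  then show ?case using 1 2 by linarith
qed

lemma dhess_bound:
  assumes "norm \<theta> \<le> R" shows "\<bar>dhess \<theta> v w y\<bar> \<le> (C2 + C1\<^sup>2) * (1 + norm y)\<^sup>2 * (norm v * norm w)"
  unfolding dhess_def by (rule abs_ratio_le[OF _ hess_integrand_bound[OF assms]]) measurable

lemma norm_line:
  assumes "norm \<theta> + norm (w::real^'m) \<le> R" "\<bar>t\<bar> \<le> 1" shows "norm (\<theta> + t *\<^sub>R w) \<le> R"
proof -
  have "norm (\<theta> + t *\<^sub>R w) \<le> norm \<theta> + \<bar>t\<bar> * norm w" by (metis norm_scaleR norm_triangle_ineq)
  also have "\<bar>t\<bar> * norm w \<le> 1 * norm w" using assms(2) by (intro mult_right_mono) auto
  finally show ?thesis using assms(1) by simp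
qed

text \<open>The one-variable estimates at \<open>t = 1\<close>, with the slope bound
  \<open>C1 * (1 + norm y) * norm w\<close> and the curvature bound
  \<open>C2 * norm w * norm w\<close>. The hypothesis keeps the line in the ball of radius
  \<open>R\<close> for all \<open>\<bar>t\<bar> \<le> 1\<close>.\<close>

lemma
  assumes tw: "norm \<theta> + norm w \<le> R"
  shows ln_p_Taylor1: "\<bar>ln (p (\<theta> + w) y) - ln (p \<theta> y)\<bar> \<le> C1 * (1 + norm y) * norm w"
    and ln_p_Taylor2: "\<bar>ln (p (\<theta> + w) y) - ln (p \<theta> y) - dscore \<theta> w y\<bar> \<le>
      (C2 + C1\<^sup>2) * (1 + norm y)\<^sup>2 * (norm w)\<^sup>2"
    and ln_p_Taylor3: "\<bar>ln (p (\<theta> + w) y) - ln (p \<theta> y) - dscore \<theta> w y - (dhess \<theta> w w y - (dscore \<theta> w y)\<^sup>2) / 2\<bar> \<le>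
      (C2 * C1 + C1 ^ 3) * (1 + norm y) ^ 3 * norm w ^ 3"
    and DERIV_wt: "t \<in> {-1<..<1} \<Longrightarrow> ((\<lambda>t. wt (\<theta> + t *\<^sub>R w) y) has_real_derivative
      dscore (\<theta> + t *\<^sub>R w) w y * wt (\<theta> + t *\<^sub>R w) y) (at t)"
    and DERIV_dscore: "t \<in> {-1<..<1} \<Longrightarrow> ((\<lambda>t. dscore (\<theta> + t *\<^sub>R w) w y * wt (\<theta> + t *\<^sub>R w) y) has_real_derivative
      dhess (\<theta> + t *\<^sub>R w) w w y * wt (\<theta> + t *\<^sub>R w) y) (at t)"
proof -
  obtain K where "quadratic_exponent M (ea \<theta> y) (eb \<theta> y w) (ec w w) K" using quadratic_exponent_model by blast
  then interpret q: quadratic_exponent M "ea \<theta> y" "eb \<theta> y w" "ec w w" K .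
  have ex: "q.expo z t = ea (\<theta> + t *\<^sub>R w) y z" for z t by (simp add: q.expo_def ea_line)
  have sl: "q.slope z t = eb (\<theta> + t *\<^sub>R w) y w z" for z t by (simp add: q.slope_def eb_line)
  have q0: "q.f0 t = wt (\<theta> + t *\<^sub>R w) y" for t by (simp add: q.f0_def ex wt_def)
  have q1: "q.f1 t = dscore (\<theta> + t *\<^sub>R w) w y * wt (\<theta> + t *\<^sub>R w) y" for t
    using wt_pos[of "\<theta> + t *\<^sub>R w" y] by (simp add: q.f1_def ex sl dscore_def)
  have q2: "q.f2 t = dhess (\<theta> + t *\<^sub>R w) w w y * wt (\<theta> + t *\<^sub>R w) y" for t
    using wt_pos[of "\<theta> + t *\<^sub>R w" y] by (simp add: q.f2_def ex sl dhess_def power2_eq_square)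
  show "t \<in> {-1<..<1} \<Longrightarrow> ((\<lambda>t. wt (\<theta> + t *\<^sub>R w) y) has_real_derivative
      dscore (\<theta> + t *\<^sub>R w) w y * wt (\<theta> + t *\<^sub>R w) y) (at t)"
    using q.DERIV_f(1)[of t] unfolding q0[abs_def] q1 by auto
  show "t \<in> {-1<..<1} \<Longrightarrow> ((\<lambda>t. dscore (\<theta> + t *\<^sub>R w) w y * wt (\<theta> + t *\<^sub>R w) y) has_real_derivative
      dhess (\<theta> + t *\<^sub>R w) w w y * wt (\<theta> + t *\<^sub>R w) y) (at t)"
    using q.DERIV_f(2)[of t] unfolding q1[abs_def] q2 by auto
  have ln_p: "ln (p \<theta>' y) = ln c0 + ln (wt \<theta>' y)" for \<theta>'
    using c0_pos wt_pos[of \<theta>' y] by (simp add: p_wt ln_mult)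
  have e1: "ln (q.f0 1) - ln (q.f0 0) = ln (p (\<theta> + w) y) - ln (p \<theta> y)"
    by (simp add: q0 ln_p)
  have e2: "q.f1 0 / q.f0 0 = dscore \<theta> w y" and e3: "q.f2 0 / q.f0 0 = dhess \<theta> w w y"
    using wt_pos[of \<theta> y] by (simp_all add: q0 q1 q2)
  let ?u = "C1 * (1 + norm y) * norm w" and ?v = "C2 * norm w * norm w"
  have uv: "AE z in M. (\<forall>t\<in>{-1..1}. \<bar>q.slope z t\<bar> \<le> ?u) \<and> \<bar>2 * ec w w z\<bar> \<le> ?v"
    using eb_bound'[of y] ec_bound' 
  proof eventually_elim
    case (elim z)
    have "\<bar>q.slope z t\<bar> \<le> ?u" if "t \<in> {-1..1}" for t
      unfolding sl using elim(1) norm_line[OF tw, of t] that by (auto simp: abs_le_iff)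
    then show ?case using elim(2) by blast
  qed
  show "\<bar>ln (p (\<theta> + w) y) - ln (p \<theta> y)\<bar> \<le> ?u"
    using q.ln_f0_Taylor1[OF uv] by (simp only: e1)
  \<comment> \<open>Powers of \<open>1 + norm y\<close> are inserted so that the curvature terms get
    the same growth factor as the slope terms.\<close>
  have one: "1 \<le> 1 + norm y" "1 \<le> (1 + norm y)\<^sup>2" by simp_all
  have "?v * 1 \<le> ?v * (1 + norm y)\<^sup>2" using C_nonneg one by (intro mult_left_mono) auto
  then have "?v + ?u\<^sup>2 \<le> (C2 + C1\<^sup>2) * (1 + norm y)\<^sup>2 * (norm w)\<^sup>2"
  proof -
    have "?u\<^sup>2 = C1\<^sup>2 * (1 + norm y)\<^sup>2 * (norm w)\<^sup>2" by (simp only: power_mult_distrib)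
    moreover have "(C2 + C1\<^sup>2) * (1 + norm y)\<^sup>2 * (norm w)\<^sup>2 =
        ?v * (1 + norm y)\<^sup>2 + C1\<^sup>2 * (1 + norm y)\<^sup>2 * (norm w)\<^sup>2"
      by (simp add: distrib_right power2_eq_square[of "norm w"])
    ultimately show ?thesis using \<open>?v * 1 \<le> ?v * (1 + norm y)\<^sup>2\<close> by linarith
  qed
  then show "\<bar>ln (p (\<theta> + w) y) - ln (p \<theta> y) - dscore \<theta> w y\<bar> \<le> (C2 + C1\<^sup>2) * (1 + norm y)\<^sup>2 * (norm w)\<^sup>2"
    using q.ln_f0_Taylor2[OF uv] by (simp only: e1 e2)
  have "(?v * ?u) * 1 \<le> (?v * ?u) * (1 + norm y)\<^sup>2"
    using C_nonneg one by (intro mult_left_mono) auto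
  then have "?v * ?u + ?u ^ 3 \<le> (C2 * C1 + C1 ^ 3) * (1 + norm y) ^ 3 * norm w ^ 3"
    by (simp add: power_mult_distrib power3_eq_cube power2_eq_square algebra_simps)
  then show "\<bar>ln (p (\<theta> + w) y) - ln (p \<theta> y) - dscore \<theta> w y - (dhess \<theta> w w y - (dscore \<theta> w y)\<^sup>2) / 2\<bar> \<le>
      (C2 * C1 + C1 ^ 3) * (1 + norm y) ^ 3 * norm w ^ 3"
    using q.ln_f0_Taylor3[OF uv] by (simp only: e1 e2 e3)
qed

section \<open>Linearity in the directions; gradient and Hessian of the log-density\<close>

lemma integrable_eb_mult: "integrable M (\<lambda>z. eb \<theta> y w z * exp (ea \<theta> y z))"
proof (rule integrable_exp_ea_mult)
  show "AE z in M. \<bar>eb \<theta> y w z\<bar> \<le> (norm y + \<kappa> * norm \<theta>) * (\<kappa> * norm w) / \<sigma>\<^sup>2"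
    using eb_bound[of y] by eventually_elim blast
qed measurable

lemma integrable_ec_mult:
  assumes "norm \<theta> \<le> R"
  shows "integrable M (\<lambda>z. (2 * ec v w z + eb \<theta> y v z * eb \<theta> y w z) * exp (ea \<theta> y z))"
  by (rule integrable_exp_ea_mult[OF _ hess_integrand_bound[OF assms]]) measurable

lemma eb_linear: "eb \<theta> y (v + w) z = eb \<theta> y v z + eb \<theta> y w z" "eb \<theta> y (r *\<^sub>R w) z = r * eb \<theta> y w z"
  by (simp_all add: eb_def act_linear inner_add_right add_divide_distrib)

lemma ec_linear: "ec (u + v) w z = ec u w z + ec v w z" "ec (r *\<^sub>R u) w z = r * ec u w z"
  by (simp_all add: ec_def act_linear inner_add_left add_divide_distrib diff_divide_distrib)

lemma ec_commute: "ec u w z = ec w u z"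
  by (simp add: ec_def inner_commute)

lemma linear_dscore: "linear (\<lambda>w. dscore \<theta> w y)"
proof (rule linearI)
  show "dscore \<theta> (v + w) y = dscore \<theta> v y + dscore \<theta> w y" for v w
    using integrable_eb_mult[of \<theta> y v] integrable_eb_mult[of \<theta> y w]
    by (simp add: dscore_def eb_linear distrib_right add_divide_distrib)
  show "dscore \<theta> (r *\<^sub>R w) y = r *\<^sub>R dscore \<theta> w y" for r w
    by (simp add: dscore_def eb_linear mult.assoc)
qed

lemma dhess_commute: "dhess \<theta> v w y = dhess \<theta> w v y"
  unfolding dhess_def by (simp add: ec_commute[of w v] mult.commute)

lemma linear_dhess:
  assumes \<theta>: "norm \<theta> \<le> R"
  shows "linear (\<lambda>v. dhess \<theta> v w y)" "linear (\<lambda>w. dhess \<theta> v w y)"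
proof -
  show 1: "linear (\<lambda>v. dhess \<theta> v w y)" for w
  proof (rule linearI)
    show "dhess \<theta> (u + v) w y = dhess \<theta> u w y + dhess \<theta> v w y" for u v
    proof -
      have eq: "(2 * ec (u + v) w z + eb \<theta> y (u + v) z * eb \<theta> y w z) * exp (ea \<theta> y z) =
        (2 * ec u w z + eb \<theta> y u z * eb \<theta> y w z) * exp (ea \<theta> y z) +
        (2 * ec v w z + eb \<theta> y v z * eb \<theta> y w z) * exp (ea \<theta> y z)" for z
        by (simp add: eb_linear ec_linear algebra_simps)
      show ?thesis
        unfolding dhess_def eq
        by (subst Bochner_Integration.integral_add[OF integrable_ec_mult[OF \<theta>] integrable_ec_mult[OF \<theta>]])
           (rule add_divide_distrib)
    qed
    show "dhess \<theta> (r *\<^sub>R v) w y = r *\<^sub>R dhess \<theta> v w y" for r v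
    proof -
      have eq: "(2 * ec (r *\<^sub>R v) w z + eb \<theta> y (r *\<^sub>R v) z * eb \<theta> y w z) * exp (ea \<theta> y z) =
        r * ((2 * ec v w z + eb \<theta> y v z * eb \<theta> y w z) * exp (ea \<theta> y z))" for z
        by (simp add: eb_linear ec_linear algebra_simps)
      show ?thesis unfolding dhess_def eq by simp
    qed
  qed
  show "linear (\<lambda>w. dhess \<theta> v w y)"
    using 1[of v] by (simp add: dhess_commute[of \<theta> v])
qed

definition sc :: "real^'m \<Rightarrow> real^'d \<Rightarrow> real^'m" where
  "sc \<theta> y = (\<Sum>b\<in>Basis. dscore \<theta> b y *\<^sub>R b)"

lemma inner_sc: "w \<bullet> sc \<theta> y = dscore \<theta> w y"
proof -
  have "dscore \<theta> w y = dscore \<theta> (\<Sum>b\<in>Basis. (w \<bullet> b) *\<^sub>R b) y" by (simp add: euclidean_representation)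
  also have "\<dots> = (\<Sum>b\<in>Basis. (w \<bullet> b) * dscore \<theta> b y)"
    by (subst linear_sum[OF linear_dscore], subst linear_cmul[OF linear_dscore]) simp
  finally show ?thesis by (simp add: sc_def inner_sum_right mult.commute)
qed

lemma measurable_sc[measurable]: "sc \<theta> \<in> borel_measurable borel"
  unfolding sc_def by measurable

text \<open>The directional bound is tested in the direction of the score itself.\<close>

lemma sc_bound:
  assumes "norm \<theta> \<le> R" shows "norm (sc \<theta> y) \<le> C1 * (1 + norm y)"
proof -
  have "norm (sc \<theta> y) * norm (sc \<theta> y) \<le> C1 * (1 + norm y) * norm (sc \<theta> y)"
    using dscore_bound[OF assms, of "sc \<theta> y" y] inner_sc[of "sc \<theta> y" \<theta> y]
    by (simp add: power2_norm_eq_inner[symmetric] power2_eq_square)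
  then show ?thesis using C_nonneg by (cases "sc \<theta> y = 0") auto
qed

text \<open>The quadratic error of the first-order expansion makes \<open>sc\<close> the gradient in
  the Frechet sense. The unit of room in the radius is the neighbourhood on which the expansion is
  available.\<close>

lemma score_eq:
  assumes "norm \<theta> + 1 \<le> R" shows "score M A \<sigma> \<beta> \<theta> y = sc \<theta> y"
proof -
  have "((\<lambda>t. ln (p t y)) has_derivative (\<lambda>h. h \<bullet> sc \<theta> y)) (at \<theta>)"
  proof (rule has_derivativeI_sandwich[of 1])
    show "bounded_linear (\<lambda>h. h \<bullet> sc \<theta> y)" by (rule bounded_linear_inner_left)
    let ?C = "(C2 + C1\<^sup>2) * (1 + norm y)\<^sup>2"
    have "((\<lambda>x. ?C * norm (x - \<theta>)) \<longlongrightarrow> ?C * norm (\<theta> - \<theta>)) (at \<theta>)"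
      by (intro tendsto_intros)
    then show "((\<lambda>x. ?C * norm (x - \<theta>)) \<longlongrightarrow> 0) (at \<theta>)" by simp
    fix x assume x: "x \<noteq> \<theta>" "dist x \<theta> < 1"
    have "norm \<theta> + norm (x - \<theta>) \<le> R" using assms x by (simp add: dist_norm)
    from ln_p_Taylor2[OF this, of y]
    have "norm (ln (p x y) - ln (p \<theta> y) - (x - \<theta>) \<bullet> sc \<theta> y) \<le> ?C * norm (x - \<theta>) * norm (x - \<theta>)"
      by (simp add: inner_sc power2_eq_square mult.assoc)
    then show "norm (ln (p x y) - ln (p \<theta> y) - (x - \<theta>) \<bullet> sc \<theta> y) / norm (x - \<theta>) \<le> ?C * norm (x - \<theta>)"
      using x by (simp add: pos_divide_le_eq)
  qed simp
  then have g: "GDERIV (\<lambda>t. ln (p t y)) \<theta> :> sc \<theta> y" by (simp add: gderiv_def)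
  show ?thesis
    unfolding score_def
  proof (rule the_equality)
    show "GDERIV (\<lambda>t. ln (p t y)) \<theta> :> sc \<theta> y" by (rule g)
  next
    fix g' assume "GDERIV (\<lambda>t. ln (p t y)) \<theta> :> g'"
    then have "(\<lambda>h. h \<bullet> g') = (\<lambda>h. h \<bullet> sc \<theta> y)"
      using g has_derivative_unique unfolding gderiv_def by blast
    then have "(g' - sc \<theta> y) \<bullet> (g' - sc \<theta> y) = 0" by (simp add: inner_diff_right fun_eq_iff)
    then show "g' = sc \<theta> y" by simp
  qed
qed

lemma inner_fisher:
  assumes "norm \<theta> + 1 \<le> R"
  shows "v \<bullet> (fisher_obs M A \<sigma> \<beta> \<theta> *v w) = (\<integral>y. (v \<bullet> sc \<theta> y) * (w \<bullet> sc \<theta> y) \<partial>P \<theta>)"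
proof -
  have \<theta>: "norm \<theta> \<le> R" using assms by simp
  let ?h = "\<lambda>v w. \<integral>y. (v \<bullet> sc \<theta> y) * (w \<bullet> sc \<theta> y) \<partial>P \<theta>"
  have int: "integrable (P \<theta>) (\<lambda>y. (v \<bullet> sc \<theta> y) * (w \<bullet> sc \<theta> y))" for v w
  proof (rule integrable_P_poly[OF _ _ \<theta>])
    fix y
    have "\<bar>(v \<bullet> sc \<theta> y) * (w \<bullet> sc \<theta> y)\<bar> \<le> (C1 * (1 + norm y) * norm v) * (C1 * (1 + norm y) * norm w)"
      unfolding abs_mult inner_sc using C_nonneg by (intro mult_mono dscore_bound \<theta>) auto
    then show "norm ((v \<bullet> sc \<theta> y) * (w \<bullet> sc \<theta> y)) \<le> (C1\<^sup>2 * norm v * norm w) * (1 + norm y)\<^sup>2"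
      by (simp add: power2_eq_square mult_ac)
  qed measurable
  have l1: "linear (\<lambda>v. ?h v w)" for w
    by (rule linearI) (simp_all add: int inner_add_left distrib_right mult.assoc)
  have l2: "linear (\<lambda>w. ?h v w)" for v
    using l1[of v] by (simp add: mult.commute)
  have "fisher_obs M A \<sigma> \<beta> \<theta> = (\<chi> i j. ?h (axis i 1) (axis j 1))"
    by (simp add: fisher_obs_def score_eq[OF assms] inner_axis' vec_eq_iff)
  then show ?thesis using inner_matrix_of_bilinear[of ?h, OF l1 l2] by simp
qed

text \<open>The Hessian of the log-density: \<open>dhess\<close> differentiates the density, and the
  product of the scores is the correction for the logarithm.\<close>

definition hess :: "real^'m \<Rightarrow> real^'d \<Rightarrow> real^'m^'m" where
  "hess \<theta> y = (\<chi> i j. dhess \<theta> (axis i 1) (axis j 1) y - dscore \<theta> (axis i 1) y * dscore \<theta> (axis j 1) y)"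

lemma inner_hess:
  assumes "norm \<theta> \<le> R"
  shows "v \<bullet> (hess \<theta> y *v w) = dhess \<theta> v w y - dscore \<theta> v y * dscore \<theta> w y"
  unfolding hess_def
proof (rule inner_matrix_of_bilinear)
  have *: "linear (\<lambda>w. dscore \<theta> w y * c)" "linear (\<lambda>w. c * dscore \<theta> w y)" for c
    using linear_compose_scale_right[OF linear_dscore, of c \<theta> y] by (simp_all add: mult.commute)
  show "linear (\<lambda>v. dhess \<theta> v w y - dscore \<theta> v y * dscore \<theta> w y)" for w
    by (intro linear_compose_sub linear_dhess assms *)
  show "linear (\<lambda>w. dhess \<theta> v w y - dscore \<theta> v y * dscore \<theta> w y)" for v
    by (intro linear_compose_sub linear_dhess assms *)
qed

lemma measurable_hess[measurable]: "hess \<theta> \<in> borel_measurable borel"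
  by (rule borel_measurable_matrixI) (simp add: hess_def)

lemma hess_bound:
  assumes \<theta>: "norm \<theta> \<le> R"
  shows "norm (hess \<theta> y) \<le> (real CARD('m) * real CARD('m) * (C2 + 2 * C1\<^sup>2)) * (1 + norm y)\<^sup>2"
proof -
  have "\<bar>hess \<theta> y $ i $ j\<bar> \<le> (C2 + 2 * C1\<^sup>2) * (1 + norm y)\<^sup>2" for i j
  proof -
    have "\<bar>dscore \<theta> (axis i 1) y * dscore \<theta> (axis j 1) y\<bar> \<le> (C1 * (1 + norm y) * 1) * (C1 * (1 + norm y) * 1)"
      unfolding abs_mult using dscore_bound[OF \<theta>, of "axis i 1" y] dscore_bound[OF \<theta>, of "axis j 1" y] C_nonneg
      by (intro mult_mono) auto
    then have 1: "\<bar>dscore \<theta> (axis i 1) y * dscore \<theta> (axis j 1) y\<bar> \<le> C1\<^sup>2 * (1 + norm y)\<^sup>2"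
      by (simp add: power2_eq_square mult_ac)
    have 2: "\<bar>dhess \<theta> (axis i 1) (axis j 1) y\<bar> \<le> (C2 + C1\<^sup>2) * (1 + norm y)\<^sup>2"
      using dhess_bound[OF \<theta>, of "axis i 1" "axis j 1" y] by simp
    have "(C2 + 2 * C1\<^sup>2) * (1 + norm y)\<^sup>2 = (C2 + C1\<^sup>2) * (1 + norm y)\<^sup>2 + C1\<^sup>2 * (1 + norm y)\<^sup>2"
      by (simp add: algebra_simps)
    then show ?thesis using 1 2 unfolding hess_def by simp
  qed
  then have "(\<Sum>i\<in>UNIV. \<Sum>j\<in>UNIV. \<bar>hess \<theta> y $ i $ j\<bar>) \<le> (\<Sum>i\<in>(UNIV::'m set). \<Sum>j\<in>(UNIV::'m set). (C2 + 2 * C1\<^sup>2) * (1 + norm y)\<^sup>2)"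
    by (intro sum_mono)
  then show ?thesis using norm_matrix_le[of "hess \<theta> y"] by (simp add: mult_ac)
qed

text \<open>The integral of the density is 1 for every \<open>\<theta> + t w\<close>; differentiate it twice in \<open>t\<close>.\<close>

lemma
  assumes tw: "norm \<theta> + norm w \<le> R"
  shows integral_dscore_wt: "t \<in> {-1<..<1} \<Longrightarrow> (\<integral>y. dscore (\<theta> + t *\<^sub>R w) w y * wt (\<theta> + t *\<^sub>R w) y \<partial>lborel) = 0"
    and integral_dhess_wt: "(\<integral>y. dhess \<theta> w w y * wt \<theta> y \<partial>lborel) = 0"
proof -
  let ?th = "\<lambda>t. \<theta> + t *\<^sub>R w"
  let ?D = "exp (\<kappa>\<^sup>2 * R\<^sup>2 / (2 * \<sigma>\<^sup>2))" and ?c = "1 / (4 * \<sigma>\<^sup>2)"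
  \<comment> \<open>An integrable majorant, independent of \<open>t\<close>, for the weight times
    any factor of growth \<open>(1 + norm y) ^ k\<close>.\<close>
  define dom where "dom C k y = C * ?D * ((1 + norm y) ^ k * exp (- (?c * (norm y)\<^sup>2)))" for C k and y :: "real^'d"
  have dom: "integrable lborel (dom C k)" for C k
    unfolding dom_def[abs_def] using sigma by (intro integrable_mult_right integrable_poly_gauss) simp
  have \<theta>: "norm (?th t) \<le> R" if "t \<in> {-1<..<1}" for t using that by (intro norm_line[OF tw]) auto
  have wt_dom: "\<bar>f\<bar> * wt (?th t) y \<le> dom C k y"
    if "t \<in> {-1<..<1}" "\<bar>f\<bar> \<le> C * (1 + norm y) ^ k" for f C k t y
  proof -
    have "\<bar>f\<bar> * wt (?th t) y \<le> (C * (1 + norm y) ^ k) * (?D * exp (- (?c * (norm y)\<^sup>2)))"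
      using that(2) wt_upper[OF \<theta>[OF that(1)], of y] wt_pos[of "?th t" y]
      by (intro mult_mono) auto
    then show ?thesis by (simp add: dom_def mult_ac)
  qed
  have s_dom: "\<bar>dscore (?th t) w y * wt (?th t) y\<bar> \<le> dom (C1 * norm w) 1 y" if "t \<in> {-1<..<1}" for t y
    using wt_dom[OF that, of "dscore (?th t) w y" "C1 * norm w" y 1] dscore_bound[OF \<theta>[OF that], of w y] wt_pos[of "?th t" y]
    by (simp add: abs_mult mult_ac)
  have h_dom: "\<bar>dhess (?th t) w w y * wt (?th t) y\<bar> \<le> dom ((C2 + C1\<^sup>2) * (norm w * norm w)) 2 y" if "t \<in> {-1<..<1}" for t y
    using wt_dom[OF that, of "dhess (?th t) w w y" "(C2 + C1\<^sup>2) * (norm w * norm w)" y 2] dhess_bound[OF \<theta>[OF that], of w w y] wt_pos[of "?th t" y]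
    by (simp add: abs_mult mult_ac)
  have wt_int: "integrable lborel (wt (?th t))" "(\<integral>y. wt (?th t) y \<partial>lborel) = 1 / c0" for t
  proof -
    have "wt (?th t) = (\<lambda>y. (1 / c0) * p (?th t) y)" using c0_pos by (simp add: fun_eq_iff p_wt)
    then show "integrable lborel (wt (?th t))" "(\<integral>y. wt (?th t) y \<partial>lborel) = 1 / c0"
      using integral_p[of "?th t"] by simp_all
  qed
  have 1: "((\<lambda>t. \<integral>y. wt (?th t) y \<partial>lborel) has_real_derivative
      (\<integral>y. dscore (?th t) w y * wt (?th t) y \<partial>lborel)) (at t)" if t: "t \<in> {-1<..<1}" for t
    by (rule has_real_derivative_integral[where f' = "\<lambda>t y. dscore (?th t) w y * wt (?th t) y", OF t wt_int(1) _ dom])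
      (auto intro!: AE_I2 DERIV_wt[OF tw] s_dom)
  show z: "(\<integral>y. dscore (?th t) w y * wt (?th t) y \<partial>lborel) = 0" if t: "t \<in> {-1<..<1}" for t
    using 1[OF t] unfolding wt_int(2) by (rule DERIV_unique) simp
  \<comment> \<open>The function differentiated here vanishes on the whole interval by the previous
    fact, so its derivative at 0, the integral in question, is 0.\<close>
  have "((\<lambda>t. \<integral>y. dscore (?th t) w y * wt (?th t) y \<partial>lborel) has_real_derivative
      (\<integral>y. dhess (?th 0) w w y * wt (?th 0) y \<partial>lborel)) (at 0)"
  proof (rule has_real_derivative_integral[where f' = "\<lambda>t y. dhess (?th t) w w y * wt (?th t) y" and a = "-1" and b = 1, OF _ _ _ dom])
    show "integrable lborel (\<lambda>y. dscore (?th t) w y * wt (?th t) y)" if "t \<in> {-1<..<1}" for t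
      by (rule Bochner_Integration.integrable_bound[OF dom]) (use s_dom[OF that] in \<open>auto intro!: AE_I2 order.trans[OF _ abs_ge_self]\<close>)
  qed (auto intro!: AE_I2 DERIV_dscore[OF tw] h_dom)
  then have "(\<integral>y. dhess (?th 0) w w y * wt (?th 0) y \<partial>lborel) = 0"
    by (rule DERIV_local_const[of _ _ _ 1]) (use z[of 0] z in \<open>auto simp: abs_less_iff\<close>)
  then show "(\<integral>y. dhess \<theta> w w y * wt \<theta> y \<partial>lborel) = 0" by simp
qed

section \<open>Moments of score and Hessian at a fixed parameter\<close>

context
  fixes \<theta> :: "real^'m" assumes \<theta>1: "norm \<theta> + 1 \<le> R"
begin

lemma norm_\<theta>_le: "norm \<theta> \<le> R" using \<theta>1 by simp

lemma integral_dscore: "(\<integral>y. dscore \<theta> w y \<partial>P \<theta>) = 0"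
proof (cases "w = 0")
  case True then show ?thesis using linear_0[OF linear_dscore] by simp
next
  case False
  \<comment> \<open>The identity is known for directions that keep the line in the ball; a unit
    direction does, and homogeneity restores the length of \<open>w\<close>.\<close>
  let ?w = "(1 / norm w) *\<^sub>R w"
  have w: "norm \<theta> + norm ?w \<le> R" using False \<theta>1 by simp
  have "dscore \<theta> w y = norm w * dscore \<theta> ?w y" for y
  proof -
    have "dscore \<theta> w y = dscore \<theta> (norm w *\<^sub>R ?w) y" using False by simp
    then show ?thesis by (simp only: linear_cmul[OF linear_dscore] real_scaleR_def)
  qed
  then have "(\<integral>y. dscore \<theta> w y \<partial>P \<theta>) = norm w * c0 * (\<integral>y. dscore \<theta> ?w y * wt \<theta> y \<partial>lborel)"
    by (simp add: integral_P p_wt mult_ac)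
  then show ?thesis using integral_dscore_wt[OF w, of 0] by simp
qed

lemma integral_dhess: "(\<integral>y. dhess \<theta> w w y \<partial>P \<theta>) = 0"
proof (cases "w = 0")
  case True then show ?thesis using linear_0[OF linear_dhess(1)[OF norm_\<theta>_le]] by simp
next
  case False
  let ?w = "(1 / norm w) *\<^sub>R w"
  have w: "norm \<theta> + norm ?w \<le> R" using False \<theta>1 by simp
  have "dhess \<theta> w w y = norm w * norm w * dhess \<theta> ?w ?w y" for y
  proof -
    have "dhess \<theta> (r *\<^sub>R u) (r *\<^sub>R u) y = r * r * dhess \<theta> u u y" for r u
      by (simp only: linear_cmul[OF linear_dhess(1)[OF norm_\<theta>_le]] linear_cmul[OF linear_dhess(2)[OF norm_\<theta>_le]]
        real_scaleR_def mult.assoc)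
    from this[of "norm w" ?w] show ?thesis using False by simp
  qed
  then have "(\<integral>y. dhess \<theta> w w y \<partial>P \<theta>) = norm w * norm w * c0 * (\<integral>y. dhess \<theta> ?w ?w y * wt \<theta> y \<partial>lborel)"
    by (simp add: integral_P p_wt mult_ac)
  then show ?thesis using integral_dhess_wt[OF w] by simp
qed

lemma integrable_sc: "integrable (P \<theta>) (sc \<theta>)" "integrable (P \<theta>) (\<lambda>y. (norm (sc \<theta> y))\<^sup>2)"
proof -
  show "integrable (P \<theta>) (sc \<theta>)"
    by (rule integrable_P_poly[OF _ _ norm_\<theta>_le, of _ C1 1]) (use sc_bound[OF norm_\<theta>_le] in auto)
  show "integrable (P \<theta>) (\<lambda>y. (norm (sc \<theta> y))\<^sup>2)"
  proof (rule integrable_P_poly[OF _ _ norm_\<theta>_le, of _ "C1\<^sup>2" 2])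
    show "norm ((norm (sc \<theta> y))\<^sup>2) \<le> C1\<^sup>2 * (1 + norm y)\<^sup>2" for y
      using power_mono[OF sc_bound[OF norm_\<theta>_le, of y], of 2] by (simp add: power_mult_distrib)
  qed measurable
qed

lemma integrable_hess: "integrable (P \<theta>) (hess \<theta>)" "integrable (P \<theta>) (\<lambda>y. (norm (hess \<theta> y))\<^sup>2)"
proof -
  let ?C = "real CARD('m) * real CARD('m) * (C2 + 2 * C1\<^sup>2)"
  show "integrable (P \<theta>) (hess \<theta>)"
    by (rule integrable_P_poly[OF _ hess_bound[OF norm_\<theta>_le] norm_\<theta>_le]) measurable
  show "integrable (P \<theta>) (\<lambda>y. (norm (hess \<theta> y))\<^sup>2)"
  proof (rule integrable_P_poly[OF _ _ norm_\<theta>_le, of _ "?C\<^sup>2" 4])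
    show "norm ((norm (hess \<theta> y))\<^sup>2) \<le> ?C\<^sup>2 * (1 + norm y)^4" for y
      using power_mono[OF hess_bound[OF norm_\<theta>_le, of y], of 2] by (simp add: power_mult_distrib)
  qed measurable
qed

lemma integral_sc: "(\<integral>y. sc \<theta> y \<partial>P \<theta>) = 0"
proof (rule euclidean_eqI)
  fix b :: "real^'m" assume "b \<in> Basis"
  show "(\<integral>y. sc \<theta> y \<partial>P \<theta>) \<bullet> b = 0 \<bullet> b"
    using integral_dscore[of b] integrable_sc(1)
    by (simp add: integral_inner_left[symmetric] inner_sc[symmetric] inner_commute)
qed

text \<open>The information identity: \<open>dhess\<close> has mean 0 because the total mass is
  constant, and minus the squared score remains.\<close>

lemma integral_hess: "w \<bullet> ((\<integral>y. hess \<theta> y \<partial>P \<theta>) *v w) = - (w \<bullet> (fisher_obs M A \<sigma> \<beta> \<theta> *v w))"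
proof -
  have bl: "bounded_linear (\<lambda>H::real^'m^'m. w \<bullet> (H *v w))"
    by (intro linear_conv_bounded_linear[THEN iffD1] linearI)
       (simp_all add: matrix_vector_mult_add_rdistrib inner_add_right scaleR_matrix_vector_assoc[symmetric])
  have "w \<bullet> ((\<integral>y. hess \<theta> y \<partial>P \<theta>) *v w) = (\<integral>y. w \<bullet> (hess \<theta> y *v w) \<partial>P \<theta>)"
    using integral_bounded_linear[OF bl integrable_hess(1)] by simp
  also have "\<dots> = (\<integral>y. dhess \<theta> w w y - dscore \<theta> w y * dscore \<theta> w y \<partial>P \<theta>)"
    by (simp add: inner_hess[OF norm_\<theta>_le])
  also have "\<dots> = (\<integral>y. dhess \<theta> w w y \<partial>P \<theta>) - (\<integral>y. dscore \<theta> w y * dscore \<theta> w y \<partial>P \<theta>)"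
  proof (rule Bochner_Integration.integral_diff)
    show "integrable (P \<theta>) (dhess \<theta> w w)"
      by (rule integrable_P_poly[OF _ _ norm_\<theta>_le, of _ "(C2 + C1\<^sup>2) * (norm w * norm w)" 2])
         (use dhess_bound[OF norm_\<theta>_le, of w w] in \<open>auto simp: mult_ac\<close>)
    show "integrable (P \<theta>) (\<lambda>y. dscore \<theta> w y * dscore \<theta> w y)"
    proof (rule integrable_P_poly[OF _ _ norm_\<theta>_le, of _ "(C1 * norm w)\<^sup>2" 2])
      show "norm (dscore \<theta> w y * dscore \<theta> w y) \<le> (C1 * norm w)\<^sup>2 * (1 + norm y)\<^sup>2" for y
        using power_mono[OF dscore_bound[OF norm_\<theta>_le, of w y], of 2]
        by (simp add: power_mult_distrib power2_eq_square abs_mult mult_ac)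
    qed measurable
  qed
  also have "\<dots> = - (w \<bullet> (fisher_obs M A \<sigma> \<beta> \<theta> *v w))"
    by (simp add: integral_dhess inner_fisher[OF \<theta>1] inner_sc)
  finally show ?thesis .
qed

end

end

section \<open>Local sections of the quotient map\<close>

text \<open>Needed for the continuity of the velocity of a curve built with the inverse function
  theorem. The map at \<open>t0\<close> is bounded below by \<open>m\<close>; applied to the
  difference of two solutions it equals, up to sign, the perturbation applied to the new
  solution.\<close>

lemma continuous_on_inv_blinfun:
  fixes B :: "'t::metric_space \<Rightarrow> 'a::euclidean_space \<Rightarrow>\<^sub>L 'a"
  assumes cont: "continuous_on S B" and bij: "\<And>t. t \<in> S \<Longrightarrow> bij (blinfun_apply (B t))"
  shows "continuous_on S (\<lambda>t. inv (blinfun_apply (B t)) v)"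
proof (rule continuous_onI)
  fix t0 :: 't and e :: real assume t0: "t0 \<in> S" and e: "e > 0"
  let ?w = "\<lambda>t. inv (blinfun_apply (B t)) v"
  have w: "blinfun_apply (B t) (?w t) = v" if "t \<in> S" for t
    using bij[OF that] by (simp add: bij_is_surj surj_f_inv_f)
  obtain m where m: "m > 0" "\<And>x. m * norm x \<le> norm (blinfun_apply (B t0) x)"
    using linear_inj_bounded_below_pos[of "blinfun_apply (B t0)"] bij[OF t0]
    by (metis bij_is_inj blinfun.bounded_linear_right bounded_linear.linear)
  \<comment> \<open>The first entry lets half of \<open>m\<close> absorb the perturbation, the
    second turns the remaining inequality into the bound \<open>e\<close>. The 1 guards against a
    zero solution.\<close>
  define \<eta> where "\<eta> = min (m / 2) (m / 2 * e / (2 * (norm (?w t0) + 1)))"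
  have \<eta>: "\<eta> > 0" using m e by (simp add: \<eta>_def add_nonneg_pos)
  obtain d where d: "d > 0" "\<And>t. t \<in> S \<Longrightarrow> dist t t0 < d \<Longrightarrow> dist (B t) (B t0) < \<eta>"
    using cont t0 \<eta> unfolding continuous_on_iff by metis
  have "dist (?w t) (?w t0) \<le> e" if t: "t \<in> S" "dist t t0 < d" for t
  proof -
    let ?x = "?w t - ?w t0"
    have n: "norm (B t - B t0) < \<eta>" using d(2)[OF t] by (simp add: dist_norm)
    have "blinfun_apply (B t0) ?x = blinfun_apply (B t) (?w t) - blinfun_apply (B t0) (?w t0) -
        blinfun_apply (B t - B t0) (?w t)"
      by (simp add: blinfun.diff_left blinfun.diff_right)
    also have "\<dots> = - blinfun_apply (B t - B t0) (?w t)" using w[OF t(1)] w[OF t0] by simp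
    finally have "norm (blinfun_apply (B t0) ?x) = norm (blinfun_apply (B t - B t0) (?w t))" by simp
    also have "\<dots> \<le> norm (B t - B t0) * norm (?w t)" by (rule norm_blinfun)
    also have "\<dots> \<le> \<eta> * (norm ?x + norm (?w t0))"
      using n \<eta> norm_triangle_ineq[of ?x "?w t0"] by (intro mult_mono) auto
    finally have "m * norm ?x \<le> \<eta> * norm ?x + \<eta> * norm (?w t0)"
      using m(2)[of ?x] by (simp add: distrib_left)
    moreover have "\<eta> * norm ?x \<le> m / 2 * norm ?x" by (intro mult_right_mono) (simp_all only: \<eta>_def min.cobounded1 norm_ge_zero)
    ultimately have 1: "m / 2 * norm ?x \<le> \<eta> * norm (?w t0)" by linarith
    have "\<eta> * norm (?w t0) \<le> (m / 2 * e / (2 * (norm (?w t0) + 1))) * (2 * (norm (?w t0) + 1))"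
    proof (intro mult_mono)
      show "\<eta> \<le> m / 2 * e / (2 * (norm (?w t0) + 1))" unfolding \<eta>_def by (rule min.cobounded2)
    qed (use m e in auto)
    also have "\<dots> = m / 2 * e"
    proof -
      have div_mult: "a / b * b = a" if "b > 0" for a b :: real using that by simp
      have "2 * (norm (?w t0) + 1) > 0" by (simp add: add_nonneg_pos)
      then show ?thesis by (rule div_mult)
    qed
    finally have "m / 2 * norm ?x \<le> m / 2 * e" using 1 by linarith
    then show ?thesis using m by (simp add: dist_norm)
  qed
  then show "\<exists>d>0. \<forall>x\<in>S. dist x t0 < d \<longrightarrow> dist (?w x) (?w t0) \<le> e" using d(1) by blast
qed

text \<open>A submersion has a section through \<open>\<theta>s\<close>, and it can be taken in the
  orthogonal complement of the kernel of its differential. The chart expression \<open>h\<close>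
  makes sense at every point of \<open>\<Theta>\<close> whose class lies in the chart domain, not
  only on \<open>U\<close>; the section therefore reaches points far from \<open>\<theta>s\<close>
  that are equivalent to points near it.\<close>

lemma local_section:
  fixes cls :: "'a::euclidean_space \<Rightarrow> 'q" and \<Theta> :: "'a set" and \<theta>s :: 'a
  defines "Q \<equiv> quotient_topology (top_of_set \<Theta>) cls"
  defines "T \<equiv> {v. \<exists>\<epsilon>>0. \<exists>\<gamma>. \<gamma> C1_differentiable_on {-\<epsilon><..<\<epsilon>} \<and>
      \<gamma> ` {-\<epsilon><..<\<epsilon>} \<subseteq> {x \<in> \<Theta>. cls x = cls \<theta>s} \<and> \<gamma> 0 = \<theta>s \<and> v = vector_derivative \<gamma> (at 0)}"
  assumes U: "open U" "\<theta>s \<in> U" "U \<subseteq> \<Theta>" "openin Q (cls ` U)"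
    and man: "C2_manifold (subtopology Q (cls ` U)) E \<A>"
    and subm: "C2_submersion U (subtopology Q (cls ` U)) E \<A> cls"
  obtains G r where "openin (top_of_set \<Theta>) G" "{x \<in> \<Theta>. cls x = cls \<theta>s} \<subseteq> G" "continuous_on G r"
    "\<And>x. x \<in> G \<Longrightarrow> r x \<in> \<Theta>" "\<And>x. x \<in> G \<Longrightarrow> cls (r x) = cls x" "\<And>x. x \<in> G \<Longrightarrow> r x - \<theta>s \<in> T\<^sup>\<bottom>"
    "\<And>x. x \<in> \<Theta> \<Longrightarrow> cls x = cls \<theta>s \<Longrightarrow> r x = \<theta>s"
proof -
  let ?X = "subtopology Q (cls ` U)"
  have qm: "quotient_map (top_of_set \<Theta>) Q cls" unfolding Q_def by (rule quotient_map_quotient_topology)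
  have topQ: "topspace Q = cls ` \<Theta>"
    using qm by (simp add: quotient_map_def)
  have topX: "topspace ?X = cls ` U" using U(3) by (auto simp: topQ)
  have clsQ: "continuous_map (top_of_set \<Theta>) Q cls"
    using qm by (rule quotient_imp_continuous_map)
  have "cls \<theta>s \<in> (\<Union>(D, \<phi>)\<in>\<A>. D)" using man U(2) topX unfolding C2_manifold_def by auto
  then obtain D \<phi> where D: "(D, \<phi>) \<in> \<A>" "cls \<theta>s \<in> D" by auto
  have DX: "openin ?X D" and DE: "openin (top_of_set E) (\<phi> ` D)"
    and hom: "homeomorphic_map (subtopology ?X D) (top_of_set (\<phi> ` D)) \<phi>" and E: "subspace E"
    using man D(1) unfolding C2_manifold_def by auto
  \<comment> \<open>Openness of the image of \<open>U\<close> in the full quotient enters here; it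
    makes \<open>G0\<close> relatively open in \<open>\<Theta>\<close>.\<close>
  have DQ: "openin Q D" using DX U(4) by (rule openin_trans_full)
  have DU: "D \<subseteq> cls ` U" using openin_subset[OF DX] topX by simp
  have inj\<phi>: "inj_on \<phi> D" using homeomorphic_imp_injective_map[OF hom] DU topX by (simp add: Int_absorb1)
  have XD: "subtopology ?X D = subtopology Q D" using DU by (simp add: subtopology_subtopology Int_absorb1)
  have \<phi>c: "continuous_map (subtopology Q D) (top_of_set (\<phi> ` D)) \<phi>"
    using homeomorphic_imp_continuous_map[OF hom] XD by simp
  have \<phi>E: "\<phi> ` D \<subseteq> E" using openin_subset[OF DE] by simp
  define h where "h = \<phi> \<circ> cls"
  define G0 where "G0 = {x \<in> \<Theta>. cls x \<in> D}"
  have G0: "openin (top_of_set \<Theta>) G0"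
    using DQ unfolding Q_def openin_quotient_topology by (simp add: G0_def)
  have "continuous_map (subtopology (top_of_set \<Theta>) G0) (subtopology Q D) cls"
    using continuous_map_from_subtopology[OF clsQ, of G0]
    by (rule continuous_map_into_subtopology) (auto simp: G0_def)
  then have "continuous_map (subtopology (top_of_set \<Theta>) G0) (top_of_set (\<phi> ` D)) h"
    unfolding h_def using \<phi>c by (rule continuous_map_compose)
  moreover have "subtopology (top_of_set \<Theta>) G0 = top_of_set G0"
    by (simp add: subtopology_subtopology G0_def Int_absorb1 Collect_subset)
  ultimately have hc: "continuous_on G0 h" by simp
  have hE: "h x \<in> E" if "x \<in> G0" for x using that \<phi>E by (auto simp: h_def G0_def)
  define S0 where "S0 = {u \<in> U. cls u \<in> D}"
  have S0G: "S0 \<subseteq> G0" using U(3) by (auto simp: S0_def G0_def)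
  have C2: "C2_on h S0" and rng: "range (frechet_derivative h (at \<theta>s)) = E"
  proof -
    have "C2_on (\<phi> \<circ> cls) {u \<in> U. cls u \<in> D} \<and>
        (\<forall>u\<in>U. cls u \<in> D \<longrightarrow> range (frechet_derivative (\<phi> \<circ> cls) (at u)) = E)"
      using subm D(1) unfolding C2_submersion_def by blast
    then show "C2_on h S0" "range (frechet_derivative h (at \<theta>s)) = E"
      using U(2) D(2) unfolding h_def S0_def by blast+
  qed
  have \<theta>S: "\<theta>s \<in> S0" using U(2) D(2) by (simp add: S0_def)
  obtain h' h'' where oS: "open S0"
    and h': "\<And>x. x \<in> S0 \<Longrightarrow> (h has_derivative blinfun_apply (h' x)) (at x)"
    and h'': "\<And>x. x \<in> S0 \<Longrightarrow> (h' has_derivative blinfun_apply (h'' x)) (at x)"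
    using C2 unfolding C2_on_def by blast
  have h'c: "continuous_on S0 h'"
    by (intro continuous_at_imp_continuous_on ballI has_derivative_continuous[OF h''])
  define Dg where "Dg = blinfun_apply (h' \<theta>s)"
  have lin: "linear Dg" unfolding Dg_def by (rule bounded_linear.linear) (rule blinfun.bounded_linear_right)
  have rD: "range Dg = E"
    using rng frechet_derivative_at[OF h'[OF \<theta>S]] by (simp add: Dg_def)
  define K where "K = {x. Dg x = 0}"
  have K: "subspace K" unfolding K_def using lin by (rule linear_subspace_kernel)
  define W where "W = K\<^sup>\<bottom>"
  have W: "subspace W" unfolding W_def by (rule subspace_orthogonal_comp)
  have KW: "x = 0" if "x \<in> K" "x \<in> W" for x
    using that by (auto simp: W_def orthogonal_comp_def orthogonal_def)
  have injW: "inj_on Dg W"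
  proof (rule inj_onI)
    fix x y assume xy: "x \<in> W" "y \<in> W" "Dg x = Dg y"
    then have "x - y \<in> K" by (simp add: K_def linear_diff[OF lin])
    then show "x = y" using KW[of "x - y"] subspace_diff[OF W xy(1,2)] by simp
  qed
  obtain L where L: "range L \<subseteq> W" "linear L" "\<And>w. w \<in> W \<Longrightarrow> L (Dg w) = w"
    using linear_exists_left_inverse_on[OF lin W injW] by blast
  \<comment> \<open>\<open>L\<close> was obtained as a left inverse on \<open>W\<close>. The
    splitting along \<open>K\<close> and \<open>W\<close>, with \<open>Dg\<close> onto
    \<open>E\<close>, makes it a right inverse on \<open>E\<close>, hence injective there.\<close>
  have DgL: "Dg (L e) = e" if "e \<in> E" for e
  proof -
    obtain x where x: "e = Dg x" using \<open>e \<in> E\<close> rD by auto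
    obtain k w where kw: "k \<in> span K" "\<And>v. v \<in> span K \<Longrightarrow> orthogonal w v" "x = k + w"
      using orthogonal_subspace_decomp_exists by metis
    have sK: "span K = K" using K by (simp add: span_eq_iff)
    have "w \<in> W" using kw(2) sK by (auto simp: W_def orthogonal_comp_def orthogonal_commute)
    moreover have "Dg k = 0" using kw(1) unfolding sK by (simp add: K_def)
    then have "e = Dg w" using kw(3) x by (simp add: linear_add[OF lin])
    ultimately show ?thesis using L(3) by simp
  qed
  \<comment> \<open>The projection onto \<open>W\<close> along \<open>K\<close>, written through the
    differential so that it cancels the derivative of \<open>L \<circ> h\<close> at
    \<open>\<theta>s\<close>.\<close>
  define P where "P x = L (Dg x)" for x
  have linP: "linear P" unfolding P_def using linear_compose[OF lin L(2)] by (simp add: o_def)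
  have PW: "P w = w" if "w \<in> W" for w using L(3) that by (simp add: P_def)
  have Pin: "P x \<in> W" for x using L(1) by (auto simp: P_def)
  have LW: "L x \<in> W" for x using L(1) by auto
  have bL: "bounded_linear L" and bP: "bounded_linear P"
    using L(2) linP linear_conv_bounded_linear by auto
  \<comment> \<open>\<open>F\<close> straightens the classes: its \<open>W\<close>-component \<open>L (h x)\<close> determines the class of \<open>x\<close>, and its
    \<open>K\<close>-component is that of \<open>x - \<theta>s\<close>. Hence the inverse of \<open>F\<close> at \<open>L (h x)\<close> is a representative in
    \<open>\<theta>s + W\<close>, and it maps the lines in direction \<open>v \<in> K\<close> to curves in the class of \<open>\<theta>s\<close>.\<close>
  define F where "F x = L (h x) + (x - \<theta>s) - P (x - \<theta>s)" for x
  define F' where "F' x = (Blinfun L o\<^sub>L h' x) + id_blinfun - Blinfun P" for x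
  have F'a: "blinfun_apply (F' x) v = L (blinfun_apply (h' x) v) + v - P v" for x v
    by (simp add: F'_def blinfun.diff_left blinfun.add_left bounded_linear_Blinfun_apply bL bP)
  have dF: "(F has_derivative blinfun_apply (F' x)) (at x)" if "x \<in> S0" for x
  proof -
    have id: "((\<lambda>x. x - \<theta>s) has_derivative (\<lambda>v. v)) (at x)"
      by (auto intro!: derivative_eq_intros)
    have "(F has_derivative (\<lambda>v. L (blinfun_apply (h' x) v) + v - P v)) (at x)"
      unfolding F_def[abs_def]
      by (intro has_derivative_diff has_derivative_add id bounded_linear.has_derivative[OF bL h'[OF that]]
          bounded_linear.has_derivative[OF bP id])
    then show ?thesis by (simp add: F'a[abs_def])
  qed
  have F'c: "continuous_on S0 F'"
    unfolding F'_def by (intro continuous_intros h'c)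
  \<comment> \<open>At \<open>\<theta>s\<close> the first and the last term of \<open>F'\<close>
    coincide; the derivative is the identity and is its own inverse.\<close>
  have F'id: "id_blinfun o\<^sub>L F' \<theta>s = id_blinfun"
    by (rule blinfun_eqI) (simp add: F'a P_def Dg_def)
  obtain U' V g g' where ift: "open U'" "U' \<subseteq> S0" "\<theta>s \<in> U'" "open V" "F \<theta>s \<in> V" "homeomorphism U' V F g"
    "\<And>y. y \<in> V \<Longrightarrow> (g has_derivative (g' y)) (at y)"
    "\<And>y. y \<in> V \<Longrightarrow> g' y = inv (blinfun_apply (F' (g y)))"
    "\<And>y. y \<in> V \<Longrightarrow> bij (blinfun_apply (F' (g y)))"
    using inverse_function_theorem[OF oS dF F'c \<theta>S F'id] by blast
  have gU: "g y \<in> U'" "F (g y) = y" if "y \<in> V" for y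
    using ift(6) that unfolding homeomorphism_def by auto
  have gF: "g (F x) = x" if "x \<in> U'" for x using ift(6) that unfolding homeomorphism_def by auto
  have gc: "continuous_on V g" using ift(6) unfolding homeomorphism_def by auto
  have F\<theta>: "F \<theta>s = L (h \<theta>s)" using linear_0[OF linP] by (simp add: F_def)
  have PF: "P (F x) = L (h x)" for x
    using PW[OF LW] PW[OF Pin] by (simp add: F_def linear_add[OF linP] linear_diff[OF linP])
  have eqcls: "cls x = cls y" if "x \<in> G0" "y \<in> G0" "L (h x) = L (h y)" for x y
  proof -
    have "h x = h y" using DgL[OF hE[OF that(1)]] DgL[OF hE[OF that(2)]] that(3) by metis
    then show ?thesis using inj\<phi> that(1,2) by (auto simp: h_def G0_def inj_on_def)
  qed
  have \<theta>G: "\<theta>s \<in> G0" using \<theta>S S0G by blast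
  have TK: "T = K"
  proof (intro set_eqI iffI)
    fix v assume "v \<in> T"
    then obtain e \<gamma> where e: "e > 0" and \<gamma>: "\<gamma> C1_differentiable_on {-e<..<e}"
      "\<gamma> ` {-e<..<e} \<subseteq> {x \<in> \<Theta>. cls x = cls \<theta>s}" "\<gamma> 0 = \<theta>s" "v = vector_derivative \<gamma> (at 0)"
      unfolding T_def by blast
    have "\<gamma> differentiable (at 0)" using \<gamma>(1) e
      by (auto simp: C1_differentiable_on_def intro: differentiableI_vector)
    then have "(\<gamma> has_vector_derivative v) (at 0)" using \<gamma>(4) vector_derivative_works by blast
    then have "(\<gamma> has_derivative (\<lambda>t. t *\<^sub>R v)) (at 0)" by (simp add: has_vector_derivative_def)
    moreover have "(h has_derivative Dg) (at (\<gamma> 0))" using h'[OF \<theta>S] \<gamma>(3) by (simp add: Dg_def)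
    ultimately have 1: "((\<lambda>t. h (\<gamma> t)) has_derivative (\<lambda>t. Dg (t *\<^sub>R v))) (at 0)"
      using has_derivative_compose[of \<gamma> "\<lambda>t. t *\<^sub>R v" 0 UNIV h Dg] by simp
    \<comment> \<open>\<open>h\<close> is constant along a curve in the class, so the velocity lies
      in the kernel of the differential.\<close>
    have "((\<lambda>t. h \<theta>s) has_derivative (\<lambda>t. Dg (t *\<^sub>R v))) (at 0)"
    proof (rule has_derivative_transform_within_open[OF 1, of "{-e<..<e}"])
      show "h (\<gamma> t) = h \<theta>s" if "t \<in> {-e<..<e}" for t
      proof -
        have "\<gamma> t \<in> {x \<in> \<Theta>. cls x = cls \<theta>s}" using \<gamma>(2) that by blast
        then show ?thesis by (simp add: h_def)
      qed
    qed (use e in auto)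
    then have "(\<lambda>t::real. Dg (t *\<^sub>R v)) = (\<lambda>t. 0)"
      by (rule has_derivative_unique) (rule has_derivative_const)
    from fun_cong[OF this, of 1] show "v \<in> K" by (simp add: K_def)
  next
    fix v assume v: "v \<in> K"
    let ?c = "\<lambda>t::real. F \<theta>s + t *\<^sub>R v"
    have "open (?c -` V)" by (intro open_vimage continuous_intros ift(4))
    moreover have "0 \<in> ?c -` V" using ift(5) by simp
    ultimately obtain e where e: "e > 0" "ball 0 e \<subseteq> ?c -` V"
      by (rule openE)
    have cV: "?c t \<in> V" if "t \<in> {-e<..<e}" for t
      using e(2) that by (auto simp: subset_iff ball_def dist_real_def)
    let ?\<gamma> = "\<lambda>t. g (?c t)" and ?d = "\<lambda>t. inv (blinfun_apply (F' (g (?c t)))) v"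
    have vd: "(?\<gamma> has_vector_derivative ?d t) (at t)" if t: "t \<in> {-e<..<e}" for t
    proof -
      have "(?c has_derivative (\<lambda>s. s *\<^sub>R v)) (at t)" by (auto intro!: derivative_eq_intros)
      then have "(?\<gamma> has_derivative (\<lambda>s. g' (?c t) (s *\<^sub>R v))) (at t)"
        using has_derivative_compose[of ?c "\<lambda>s. s *\<^sub>R v" t UNIV g "g' (?c t)"] ift(7)[OF cV[OF t]] by simp
      moreover have "g' (?c t) (s *\<^sub>R v) = s *\<^sub>R ?d t" for s
        using linear_cmul[OF has_derivative_linear[OF ift(7)[OF cV[OF t]]]] ift(8)[OF cV[OF t]] by simp
      ultimately show ?thesis by (simp add: has_vector_derivative_def)
    qed
    have cg: "continuous_on {-e<..<e} ?\<gamma>"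
      by (intro continuous_on_compose2[OF gc, of _ ?c] continuous_intros) (use cV in blast)
    have cF: "continuous_on {-e<..<e} (\<lambda>t. F' (g (?c t)))"
      by (rule continuous_on_compose2[OF F'c cg]) (use gU(1)[OF cV] ift(2) in blast)
    have "continuous_on {-e<..<e} ?d"
      by (rule continuous_on_inv_blinfun[OF cF]) (rule ift(9)[OF cV])
    then have C1: "?\<gamma> C1_differentiable_on {-e<..<e}"
      unfolding C1_differentiable_on_def by (intro exI[of _ ?d] conjI ballI vd)
    have im: "?\<gamma> ` {-e<..<e} \<subseteq> {x \<in> \<Theta>. cls x = cls \<theta>s}"
    proof safe
      fix t assume t: "t \<in> {-e<..<e}"
      have GG: "?\<gamma> t \<in> G0" using gU(1)[OF cV[OF t]] ift(2) S0G by blast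
      then show "?\<gamma> t \<in> \<Theta>" by (simp add: G0_def)
      have "L (h (?\<gamma> t)) = P (?c t)" using PF[of "?\<gamma> t"] gU(2)[OF cV[OF t]] by simp
      also have "\<dots> = P (F \<theta>s) + t *\<^sub>R P v" by (simp add: linear_add[OF linP] linear_cmul[OF linP])
      also have "P v = 0" using v linear_0[OF L(2)] by (simp add: P_def K_def)
      also have "P (F \<theta>s) + t *\<^sub>R 0 = L (h \<theta>s)" by (simp add: PF)
      finally show "cls (?\<gamma> t) = cls \<theta>s" by (rule eqcls[OF GG \<theta>G])
    qed
    have "?\<gamma> 0 = \<theta>s" using gF[OF ift(3)] by simp
    have z: "(0::real) \<in> {-e<..<e}" using e(1) by simp
    have "blinfun_apply (F' \<theta>s) = (\<lambda>x. x)" by (simp add: fun_eq_iff F'a P_def Dg_def)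
    then have "?d 0 = v" using gF[OF ift(3)] by (simp add: inv_f_f)
    then have v': "v = vector_derivative ?\<gamma> (at 0)" using vector_derivative_at[OF vd[OF z]] by simp
    show "v \<in> T" unfolding T_def mem_Collect_eq
      by (intro exI[of _ e] exI[of _ ?\<gamma>] conjI e(1) C1 im \<open>?\<gamma> 0 = \<theta>s\<close> v')
  qed
  define G where "G = {x \<in> G0. L (h x) \<in> V}"
  define r where "r x = g (L (h x))" for x
  have Lc: "continuous_on S L" for S using bL by (rule linear_continuous_on)
  have Lh: "continuous_on G0 (\<lambda>x. L (h x))"
    by (rule continuous_on_compose2[OF Lc[of UNIV] hc]) simp
  have "openin (top_of_set G0) G"
    using continuous_openin_preimage_gen[OF Lh ift(4)] by (simp add: G_def vimage_def Int_def)
  then have 1: "openin (top_of_set \<Theta>) G" using G0 by (rule openin_trans)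
  have h\<theta>: "x \<in> G0 \<and> h x = h \<theta>s" if "x \<in> \<Theta>" "cls x = cls \<theta>s" for x
    using that D(2) by (simp add: G0_def h_def)
  have 2: "{x \<in> \<Theta>. cls x = cls \<theta>s} \<subseteq> G"
    using h\<theta> ift(5) F\<theta> by (auto simp: G_def)
  have 3: "continuous_on G r"
    unfolding r_def by (rule continuous_on_compose2[OF gc continuous_on_subset[OF Lh]]) (auto simp: G_def)
  have rG: "r x \<in> U'" "F (r x) = L (h x)" if "x \<in> G" for x
    using gU that by (auto simp: r_def G_def)
  have rG0: "r x \<in> G0" if "x \<in> G" for x using rG(1)[OF that] ift(2) S0G by blast
  have Lr: "L (h (r x)) = L (h x)" if "x \<in> G" for x
    using PF[of "r x"] rG(2)[OF that] PW[OF LW, of "h x"] by simp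
  have 6: "r x - \<theta>s \<in> T\<^sup>\<bottom>" if "x \<in> G" for x
  proof -
    \<comment> \<open>\<open>F (r x)\<close> equals both \<open>L (h x)\<close> and
      \<open>L (h (r x))\<close>, so the term of \<open>F\<close> that records the component along
      \<open>K\<close> has to vanish.\<close>
    have "r x - \<theta>s = P (r x - \<theta>s)" using rG(2)[OF that] Lr[OF that] by (simp add: F_def)
    then show ?thesis using Pin unfolding TK W_def by metis
  qed
  show thesis
  proof (rule that[of G r, OF 1 2 3 _ _ 6])
    show "r x \<in> \<Theta>" if "x \<in> G" for x using rG0[OF that] by (simp add: G0_def)
    show "cls (r x) = cls x" if "x \<in> G" for x
      using eqcls[OF rG0[OF that] _ Lr[OF that]] that by (simp add: G_def)
    show "r x = \<theta>s" if "x \<in> \<Theta>" "cls x = cls \<theta>s" for x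
      using h\<theta>[OF that] gF[OF ift(3)] F\<theta> by (simp add: r_def)
  qed
qed

section \<open>Quadratic forms on a subspace\<close>

text \<open>Gram--Schmidt for the bilinear form \<open>S\<close> on \<open>W\<close>; the vectors are indexed by \<open>I\<close> and padded with 0.\<close>

lemma orthonormal_expansion:
  fixes W :: "(real^'m) set" and S :: "real^'m^'m"
  assumes sym: "\<And>u v. u \<bullet> (S *v v) = v \<bullet> (S *v u)"
    and fin: "finite I" and W: "subspace W" "dim W \<le> card I"
    and pos: "\<And>w. w \<in> W \<Longrightarrow> w \<noteq> 0 \<Longrightarrow> w \<bullet> (S *v w) > 0"
  shows "\<exists>f. (\<forall>b\<in>I. f b \<in> W) \<and> (\<forall>w\<in>W. w = (\<Sum>b\<in>I. (f b \<bullet> (S *v w)) *\<^sub>R f b))"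
  using fin W pos
proof (induction I arbitrary: W rule: finite_induct)
  case empty
  then have "W \<subseteq> {0}" by (simp add: dim_eq_0)
  then show ?case by auto
next
  case (insert b0 I)
  show ?case
  proof (cases "W \<subseteq> {0}")
    case True
    then show ?thesis using subspace_0[OF insert.prems(1)] by (intro exI[of _ "\<lambda>_. 0"]) auto
  next
    case False
    then obtain v0 where v0: "v0 \<in> W" "v0 \<noteq> 0" by auto
    define q where "q = v0 \<bullet> (S *v v0)"
    have q: "q > 0" using insert.prems(3) v0 by (simp add: q_def)
    define v where "v = (1 / sqrt q) *\<^sub>R v0"
    have v: "v \<in> W" "v \<bullet> (S *v v) = 1"
      using v0 q subspace_scale[OF insert.prems(1)]
      by (simp_all add: v_def matrix_vector_mult_scaleR q_def[symmetric] power2_eq_square[symmetric] flip: real_sqrt_mult)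
    \<comment> \<open>The complement is taken with respect to \<open>S\<close>, not to the inner
      product. It omits \<open>v\<close>, so its dimension drops and the index \<open>b0\<close>
      pays for it.\<close>
    define W' where "W' = {w \<in> W. v \<bullet> (S *v w) = 0}"
    have W': "subspace W'"
      using insert.prems(1) unfolding W'_def subspace_def
      by (auto simp: matrix_vector_right_distrib matrix_vector_mult_scaleR inner_add_right)
    have "W' \<subseteq> W" "v \<notin> W'" using v(2) by (auto simp: W'_def)
    then have "W' \<subset> W" using v(1) by blast
    then have "dim W' < dim W"
      using W' insert.prems(1) by (intro dim_psubset) (simp add: span_eq_iff[THEN iffD2])
    then have "dim W' \<le> card I" using insert.prems(2) insert.hyps by simp
    then obtain f where f: "\<And>b. b \<in> I \<Longrightarrow> f b \<in> W'"
        "\<And>w. w \<in> W' \<Longrightarrow> w = (\<Sum>b\<in>I. (f b \<bullet> (S *v w)) *\<^sub>R f b)"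
      using insert.IH[OF W'] insert.prems(3) unfolding W'_def by blast
    let ?f = "f(b0 := v)"
    have "w = (\<Sum>b\<in>insert b0 I. (?f b \<bullet> (S *v w)) *\<^sub>R ?f b)" if w: "w \<in> W" for w
    proof -
      define a where "a = v \<bullet> (S *v w)"
      let ?w = "w - a *\<^sub>R v"
      have "?w \<in> W'"
        using w v insert.prems(1)
        by (simp add: W'_def subspace_diff subspace_scale matrix_vector_mult_diff_distrib
            matrix_vector_mult_scaleR inner_diff_right a_def)
      then have "?w = (\<Sum>b\<in>I. (f b \<bullet> (S *v ?w)) *\<^sub>R f b)" by (rule f(2))
      \<comment> \<open>By symmetry the vectors \<open>f b\<close> are \<open>S\<close>-orthogonal
        to \<open>v\<close>, so subtracting a multiple of \<open>v\<close> changes no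
        coefficient.\<close>
      also have "\<dots> = (\<Sum>b\<in>I. (f b \<bullet> (S *v w)) *\<^sub>R f b)"
      proof (rule sum.cong[OF refl])
        fix b assume "b \<in> I"
        then have "v \<bullet> (S *v f b) = 0" using f(1) by (auto simp: W'_def)
        then have "f b \<bullet> (S *v v) = 0" by (simp add: sym[of v])
        then show "(f b \<bullet> (S *v ?w)) *\<^sub>R f b = (f b \<bullet> (S *v w)) *\<^sub>R f b"
          by (simp add: matrix_vector_mult_diff_distrib matrix_vector_mult_scaleR inner_diff_right)
      qed
      also have "\<dots> = (\<Sum>b\<in>I. (?f b \<bullet> (S *v w)) *\<^sub>R ?f b)"
        using insert.hyps(2) by (intro sum.cong refl) auto
      finally have "w = a *\<^sub>R v + (\<Sum>b\<in>I. (?f b \<bullet> (S *v w)) *\<^sub>R ?f b)"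
        by (metis add.commute diff_add_cancel)
      then show ?thesis using insert.hyps by (simp add: a_def)
    qed
    moreover have "\<forall>b\<in>insert b0 I. ?f b \<in> W" using f(1) v(1) by (auto simp: W'_def)
    ultimately show ?thesis by blast
  qed
qed

text \<open>For an \<open>S\<close>-orthonormal family \<open>f\<close> spanning \<open>W\<close>,
  padded with 0, the inverse of the compression sends \<open>u\<close> to the sum of the vectors
  \<open>(f b \<bullet> u) *\<^sub>R f b\<close>. The formula is linear on the whole space,
  symmetric, and displays the factor \<open>L\<close> that \<open>centred_normal\<close> asks for:
  the linear map sending each basis vector \<open>b\<close> to \<open>f b\<close>.\<close>

lemma compression_inverse:
  fixes W :: "(real^'m) set" and S :: "real^'m^'m"
  defines "C \<equiv> \<lambda>u. inv_into W (compression S W) (orth_proj W u)"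
  assumes sym: "\<And>u v. u \<bullet> (S *v v) = v \<bullet> (S *v u)"
    and W: "subspace W"
    and pos: "\<And>w. w \<in> W \<Longrightarrow> w \<noteq> 0 \<Longrightarrow> w \<bullet> (S *v w) > 0"
  shows "\<exists>L::real^'m \<Rightarrow> real^'m. linear L \<and> L \<circ> adjoint L = C" and "linear C" and "C u \<in> W"
    and "h \<in> W \<Longrightarrow> h \<bullet> (S *v C u) = h \<bullet> u" and "t \<bullet> C u = C t \<bullet> u"
proof -
  have "dim W \<le> card (Basis :: (real^'m) set)" by (rule dim_subset_UNIV)
  then obtain f :: "real^'m \<Rightarrow> real^'m" where f: "\<And>b. b \<in> Basis \<Longrightarrow> f b \<in> W"
    "\<And>w. w \<in> W \<Longrightarrow> w = (\<Sum>b\<in>Basis. (f b \<bullet> (S *v w)) *\<^sub>R f b)"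
    using orthonormal_expansion[OF sym finite_Basis W _ pos] by blast
  define D where "D u = (\<Sum>b\<in>Basis. (f b \<bullet> u) *\<^sub>R f b)" for u
  have DW: "D u \<in> W" for u
    unfolding D_def by (intro subspace_sum W subspace_scale f(1))
  have DS: "h \<bullet> (S *v D u) = h \<bullet> u" if "h \<in> W" for h u
  proof -
    have "h \<bullet> (S *v D u) = D u \<bullet> (S *v h)" by (rule sym)
    also have "\<dots> = (\<Sum>b\<in>Basis. (f b \<bullet> u) * (f b \<bullet> (S *v h)))" by (simp add: D_def inner_sum_left)
    also have "\<dots> = (\<Sum>b\<in>Basis. (f b \<bullet> (S *v h)) *\<^sub>R f b) \<bullet> u" by (simp add: inner_sum_left mult.commute)
    also have "\<dots> = h \<bullet> u" using f(2)[OF that] by simp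
    finally show ?thesis .
  qed
  have eqW: "x = y" if "x \<in> W" "y \<in> W" "\<And>h. h \<in> W \<Longrightarrow> h \<bullet> x = h \<bullet> y" for x y
  proof -
    have "(x - y) \<bullet> (x - y) = 0" using that(3)[OF subspace_diff[OF W that(1,2)]] by (simp add: inner_diff_right)
    then show ?thesis by simp
  qed
  have inj: "inj_on (compression S W) W"
  proof (rule inj_onI, rule ccontr)
    fix x y assume xy: "x \<in> W" "y \<in> W" "compression S W x = compression S W y" "x \<noteq> y"
    have d: "x - y \<in> W" using subspace_diff[OF W xy(1,2)] .
    have "(x - y) \<bullet> (S *v (x - y)) = (x - y) \<bullet> compression S W x - (x - y) \<bullet> compression S W y"
      by (simp only: inner_compression[OF W d] matrix_vector_mult_diff_distrib inner_diff_right)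
    then show False using pos[OF d] xy by simp
  qed
  have "compression S W (D u) = orth_proj W u" for u
  proof (rule eqW)
    show "compression S W (D u) \<in> W" using W by (rule compression_in)
    show "orth_proj W u \<in> W" using W by (rule orth_proj_props)
    fix h assume h: "h \<in> W"
    have "h \<bullet> (u - orth_proj W u) = 0"
      using orth_proj_props(2)[OF W, of u] h by (auto simp: orthogonal_comp_def orthogonal_def)
    then show "h \<bullet> compression S W (D u) = h \<bullet> orth_proj W u"
      using DS[OF h, of u] by (simp add: inner_compression[OF W h] inner_diff_right)
  qed
  then have CD: "C = D" unfolding C_def using inv_into_f_f[OF inj DW] by (metis ext)
  define L where "L x = (\<Sum>b\<in>Basis. (x \<bullet> b) *\<^sub>R f b)" for x :: "real^'m"
  have L: "linear L"
    by (rule linearI) (simp_all add: L_def inner_add_left scaleR_add_left sum.distrib scaleR_sum_right)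
  have "adjoint L = (\<lambda>u. \<Sum>b\<in>Basis. (f b \<bullet> u) *\<^sub>R b)"
    by (rule adjoint_unique) (simp add: L_def inner_sum_left inner_sum_right mult.commute)
  then have LD: "L \<circ> adjoint L = D"
    by (auto simp: fun_eq_iff L_def D_def inner_sum_left inner_Basis if_distrib sum.delta cong: if_cong)
  show "\<exists>L::real^'m \<Rightarrow> real^'m. linear L \<and> L \<circ> adjoint L = C"
    unfolding CD by (rule exI[of _ L]) (rule conjI[OF L LD])
  show "linear C" unfolding CD
    by (rule linearI) (simp_all add: D_def inner_add_right scaleR_add_left sum.distrib scaleR_sum_right)
  show "C u \<in> W" unfolding CD by (rule DW)
  show "h \<in> W \<Longrightarrow> h \<bullet> (S *v C u) = h \<bullet> u" unfolding CD by (rule DS)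
  show "t \<bullet> C u = C t \<bullet> u"
    unfolding CD D_def inner_sum_left inner_sum_right by (simp add: inner_commute mult.commute)
qed

text \<open>The quadratic form attains a positive minimum on the compact unit sphere of
  \<open>W\<close>; if this sphere is empty, \<open>W\<close> contains only 0.\<close>

lemma pos_def_on_subspace_coercive:
  fixes W :: "(real^'m) set" and S :: "real^'m^'m"
  assumes W: "subspace W" and pos: "\<And>w. w \<in> W \<Longrightarrow> w \<noteq> 0 \<Longrightarrow> w \<bullet> (S *v w) > 0"
  shows "\<exists>c>0. \<forall>w\<in>W. c * (norm w)\<^sup>2 \<le> w \<bullet> (S *v w)"
proof (cases "W \<inter> sphere 0 1 = {}")
  case True
  have "w = 0" if "w \<in> W" for w
  proof (rule ccontr)
    assume "w \<noteq> 0"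
    then have "(1 / norm w) *\<^sub>R w \<in> W \<inter> sphere 0 1" using subspace_scale[OF W that] by simp
    then show False using True by blast
  qed
  then have "\<forall>w\<in>W. 1 * (norm w)\<^sup>2 \<le> w \<bullet> (S *v w)" by fastforce
  then show ?thesis using zero_less_one by blast
next
  case False
  have comp: "compact (W \<inter> sphere 0 1)" using closed_subspace[OF W] by (intro closed_Int_compact) auto
  have cont: "continuous_on (W \<inter> sphere 0 1) (\<lambda>w. w \<bullet> (S *v w))"
    by (intro continuous_intros linear_continuous_on matrix_vector_mul_bounded_linear)
  obtain w0 where w0: "w0 \<in> W \<inter> sphere 0 1"
    "\<And>w. w \<in> W \<inter> sphere 0 1 \<Longrightarrow> w0 \<bullet> (S *v w0) \<le> w \<bullet> (S *v w)"
    using continuous_attains_inf[OF comp False cont] by blast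
  let ?c = "w0 \<bullet> (S *v w0)"
  have "w0 \<in> W" "w0 \<noteq> 0" using w0(1) by auto
  then have "?c > 0" by (rule pos)
  moreover have "?c * (norm w)\<^sup>2 \<le> w \<bullet> (S *v w)" if w: "w \<in> W" for w
  proof (cases "w = 0")
    case False
    let ?u = "(1 / norm w) *\<^sub>R w"
    have "?u \<in> W \<inter> sphere 0 1" using subspace_scale[OF W w] False by simp
    from w0(2)[OF this] have "?c \<le> (w \<bullet> (S *v w)) / (norm w)\<^sup>2"
      by (simp add: matrix_vector_mult_scaleR power2_eq_square)
    then show ?thesis using False by (simp add: pos_le_divide_eq)
  qed simp
  ultimately show ?thesis by blast
qed

text \<open>The point \<open>z\<close> maximizes the quadratic function \<open>w \<bullet> s - w \<bullet> S w / 2\<close> on \<open>W\<close>, while \<open>x\<close> maximizes a function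
  \<open>l\<close> that is close to it.\<close>

lemma quadratic_argmax_close:
  fixes W :: "(real^'m) set" and S :: "real^'m^'m" and l :: "real^'m \<Rightarrow> real"
  assumes sym: "\<And>u v. u \<bullet> (S *v v) = v \<bullet> (S *v u)"
    and W: "subspace W" and c: "c > 0" "\<And>w. w \<in> W \<Longrightarrow> c * (norm w)\<^sup>2 \<le> w \<bullet> (S *v w)"
    and l: "\<And>w. w \<in> W \<Longrightarrow> norm w \<le> \<rho> \<Longrightarrow> \<bar>l w - (w \<bullet> s - w \<bullet> (S *v w) / 2)\<bar> \<le> \<tau> * (norm w)\<^sup>2"
    and x: "x \<in> W" "norm x \<le> \<rho>" "\<And>w. w \<in> W \<Longrightarrow> norm w \<le> \<rho> \<Longrightarrow> l w \<le> l x"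
    and z: "z \<in> W" "\<And>h. h \<in> W \<Longrightarrow> h \<bullet> (S *v z) = h \<bullet> s"
    and s: "norm s \<le> c * \<rho>" and \<tau>: "0 \<le> \<tau>" "\<tau> \<le> c / 4"
  shows "(norm (x - z))\<^sup>2 \<le> 34 * \<tau> / c ^ 3 * (norm s)\<^sup>2"
proof -
  have nz: "c * norm z \<le> norm s"
  proof -
    have "c * norm z * norm z \<le> z \<bullet> s" using c(2)[OF z(1)] z(2)[OF z(1)] by (simp add: power2_eq_square)
    also have "\<dots> \<le> norm s * norm z" using norm_cauchy_schwarz[of z s] by (simp add: mult.commute)
    finally show ?thesis by (cases "norm z = 0") auto
  qed
  then have z\<rho>: "norm z \<le> \<rho>" using s c(1) by (meson mult_le_cancel_left_pos order.trans)
  have l0: "l 0 = 0" using l[OF subspace_0[OF W]] x(2) norm_ge_zero[of x] by (simp add: order.trans[of 0])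
  \<comment> \<open>Comparison of \<open>l x\<close> with \<open>l 0 = 0\<close>. The approximation
    error takes at most half of the available \<open>c / 2\<close>, which leaves
    \<open>c / 4\<close> to bound \<open>x\<close> at the scale of \<open>s\<close>.\<close>
  have nx: "c * norm x \<le> 4 * norm s"
  proof -
    have "0 \<le> l x" using x(3)[OF subspace_0[OF W]] l0 x(2) norm_ge_zero[of x] by simp
    then have "x \<bullet> (S *v x) / 2 \<le> x \<bullet> s + \<tau> * (norm x)\<^sup>2" using l[OF x(1,2)] by linarith
    moreover have "\<tau> * (norm x)\<^sup>2 \<le> c / 4 * (norm x)\<^sup>2" using \<tau> by (intro mult_right_mono) auto
    ultimately have "c / 4 * (norm x)\<^sup>2 \<le> x \<bullet> s" using c(2)[OF x(1)] by linarith
    also have "\<dots> \<le> norm s * norm x" using norm_cauchy_schwarz[of x s] by (simp add: mult.commute)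
    finally have "(c / 4 * norm x) * norm x \<le> norm s * norm x" by (simp add: power2_eq_square)
    then have "c / 4 * norm x \<le> norm s" by (cases "norm x = 0") auto
    then show ?thesis by simp
  qed
  let ?d = "x - z"
  \<comment> \<open>Completing the square: half of the squared \<open>S\<close>-distance from
    \<open>z\<close> is the deficit of the quadratic function at \<open>x\<close>, and optimality of
    \<open>x\<close> for \<open>l\<close> bounds this deficit by the two approximation
    errors.\<close>
  have "?d \<bullet> (S *v ?d) = x \<bullet> (S *v x) - 2 * (x \<bullet> s) + z \<bullet> s"
    using z(2)[OF x(1)] z(2)[OF z(1)] sym[of z x]
    by (simp add: matrix_vector_mult_diff_distrib inner_diff_left inner_diff_right)
  moreover have "z \<bullet> s - z \<bullet> (S *v z) / 2 = (z \<bullet> s) / 2" using z(2)[OF z(1)] by simp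
  ultimately have "?d \<bullet> (S *v ?d) / 2 = (z \<bullet> s - z \<bullet> (S *v z) / 2) - (x \<bullet> s - x \<bullet> (S *v x) / 2)" by simp
  also have "\<dots> \<le> \<tau> * (norm z)\<^sup>2 + \<tau> * (norm x)\<^sup>2"
    using l[OF z(1) z\<rho>] l[OF x(1,2)] x(3)[OF z(1) z\<rho>] by linarith
  finally have 1: "c * (norm ?d)\<^sup>2 \<le> 2 * \<tau> * ((norm z)\<^sup>2 + (norm x)\<^sup>2)"
    using c(2)[OF subspace_diff[OF W x(1) z(1)]] by (simp add: distrib_left)
  have "(c * norm z)\<^sup>2 \<le> (norm s)\<^sup>2" using nz c(1) by (intro power_mono) auto
  moreover have "(c * norm x)\<^sup>2 \<le> (4 * norm s)\<^sup>2" using nx c(1) by (intro power_mono) auto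
  \<comment> \<open>\<open>17 = 1 + 16\<close> from the two norm bounds; doubled, it is the constant
    34 of the conclusion.\<close>
  ultimately have "c\<^sup>2 * ((norm z)\<^sup>2 + (norm x)\<^sup>2) \<le> 17 * (norm s)\<^sup>2"
    by (simp add: power_mult_distrib distrib_left)
  then have "2 * \<tau> * (c\<^sup>2 * ((norm z)\<^sup>2 + (norm x)\<^sup>2)) \<le> 2 * \<tau> * (17 * (norm s)\<^sup>2)"
    using \<tau>(1) by (intro mult_left_mono) auto
  moreover have "c\<^sup>2 * (c * (norm ?d)\<^sup>2) \<le> c\<^sup>2 * (2 * \<tau> * ((norm z)\<^sup>2 + (norm x)\<^sup>2))"
    using 1 by (intro mult_left_mono) auto
  ultimately have "c ^ 3 * (norm ?d)\<^sup>2 \<le> 34 * \<tau> * (norm s)\<^sup>2"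
    by (simp add: power3_eq_cube power2_eq_square[of c] mult_ac)
  then show ?thesis using c(1) by (simp add: field_simps)
qed

section \<open>Consistency\<close>

lemma norm_matrix_vector_mult_le: "norm ((H :: real^'n^'m) *v x) \<le> norm H * norm x"
proof -
  have "norm (H *v x) = L2_set (\<lambda>i. norm (H $ i \<bullet> x)) UNIV"
    by (simp add: norm_vec_def matrix_mult_dot)
  also have "\<dots> \<le> L2_set (\<lambda>i. norm (H $ i) * norm x) UNIV"
    by (intro L2_set_mono) (auto simp: Cauchy_Schwarz_ineq2)
  also have "\<dots> = norm H * norm x"
    by (simp add: norm_vec_def[of H] L2_set_left_distrib)
  finally show ?thesis .
qed

lemma abs_quadratic_form_le: "\<bar>w \<bullet> ((H :: real^'m^'m) *v w)\<bar> \<le> norm H * (norm w)\<^sup>2"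
proof -
  have "\<bar>w \<bullet> (H *v w)\<bar> \<le> norm w * (norm H * norm w)"
    using Cauchy_Schwarz_ineq2[of w "H *v w"] norm_matrix_vector_mult_le[of H w]
    by (meson mult_left_mono norm_ge_zero order.trans)
  then show ?thesis by (simp add: power2_eq_square mult_ac)
qed

lemma linear_quadratic_form: "linear (\<lambda>H::real^'m^'m. w \<bullet> (H *v w))"
  by (rule linearI)
     (simp_all add: matrix_vector_mult_add_rdistrib inner_add_right scaleR_matrix_vector_assoc[symmetric])

text \<open>Leaves room for a term that is small but need not vanish, such as the probability left
  over by tightness.\<close>

lemma tendsto_zero_if_bounded_by:
  fixes f :: "nat \<Rightarrow> real"
  assumes "\<And>n. 0 \<le> f n" "\<And>e. e > 0 \<Longrightarrow> \<exists>g. g \<longlonglongrightarrow> 0 \<and> (\<forall>\<^sub>F n in sequentially. f n \<le> g n + e)"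
  shows "f \<longlonglongrightarrow> 0"
proof (rule tendstoI)
  fix e :: real assume e: "e > 0"
  obtain g where g: "g \<longlonglongrightarrow> 0" "\<forall>\<^sub>F n in sequentially. f n \<le> g n + e / 2"
    using assms(2)[of "e / 2"] e by auto
  have "\<forall>\<^sub>F n in sequentially. g n < e / 2" using g(1) e by (intro order_tendstoD) auto
  with g(2) show "\<forall>\<^sub>F n in sequentially. dist (f n) 0 < e"
    by eventually_elim (use assms(1) in \<open>auto simp: abs_of_nonneg\<close>)
qed

lemma tendsto_zero_if_le:
  fixes f g :: "nat \<Rightarrow> real"
  assumes "\<And>n. 0 \<le> f n" "\<And>n. f n \<le> g n" "g \<longlonglongrightarrow> 0"
  shows "f \<longlonglongrightarrow> 0"
  by (rule tendsto_sandwich[OF _ _ tendsto_const assms(3)]) (simp_all add: assms(1,2))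

locale mixture_sample = mixture_model M A \<sigma> \<beta> \<kappa> R + N: prob_space N
  for M :: "'z measure" and A :: "'z \<Rightarrow> real^'m^'d" and \<sigma> \<beta> \<kappa> R :: real and N :: "'w measure" +
  fixes y :: "nat \<Rightarrow> 'w \<Rightarrow> real^'d" and \<theta>s :: "real^'m"
  assumes indep: "N.indep_vars (\<lambda>_. borel) y UNIV"
    and law: "\<And>i. distr N borel (y i) = P \<theta>s"
    and norm_\<theta>s: "norm \<theta>s + 1 \<le> R"
begin

definition avg :: "(real^'d \<Rightarrow> 'b::real_vector) \<Rightarrow> nat \<Rightarrow> 'w \<Rightarrow> 'b" where
  "avg g n \<omega> = (1 / real n) *\<^sub>R (\<Sum>i<n. g (y i \<omega>))"

lemma measurable_y[measurable]: "y i \<in> borel_measurable N"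
  using indep unfolding N.indep_vars_def2 by simp

lemma measurable_avg[measurable]:
  fixes g :: "real^'d \<Rightarrow> 'b::euclidean_space"
  assumes [measurable]: "g \<in> borel_measurable borel"
  shows "avg g n \<in> borel_measurable N"
  unfolding avg_def by measurable

lemma deviation_event:
  fixes g :: "real^'d \<Rightarrow> 'b::euclidean_space"
  assumes "g \<in> borel_measurable borel"
  shows "{\<omega>\<in>space N. norm (avg g n \<omega> - c) \<ge> e} \<in> sets N"
proof -
  have [measurable]: "avg g n \<in> borel_measurable N" using assms by (rule measurable_avg)
  show ?thesis by measurable
qed

lemma norm_\<theta>s_le: "norm \<theta>s \<le> R" using norm_\<theta>s by simp

context
  fixes g :: "real^'d \<Rightarrow> 'b::euclidean_space" and C :: real and k :: nat
  assumes g[measurable]: "g \<in> borel_measurable borel" and C: "\<And>v. norm (g v) \<le> C * (1 + norm v) ^ k"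
begin

lemma sample_image:
  shows "N.indep_vars (\<lambda>_. borel) (\<lambda>i \<omega>. g (y i \<omega>)) UNIV"
    and "distr N borel (\<lambda>\<omega>. g (y i \<omega>)) = distr (P \<theta>s) borel g"
    and "integrable (distr (P \<theta>s) borel g) (\<lambda>x. (norm x)\<^sup>2)"
    and "(\<integral>x. x \<partial>distr (P \<theta>s) borel g) = (\<integral>v. g v \<partial>P \<theta>s)"
    and "(\<integral>x. (norm (x - m))\<^sup>2 \<partial>distr (P \<theta>s) borel g) = (\<integral>v. (norm (g v - m))\<^sup>2 \<partial>P \<theta>s)"
proof -
  show "N.indep_vars (\<lambda>_. borel) (\<lambda>i \<omega>. g (y i \<omega>)) UNIV"
    by (rule N.indep_vars_compose2[OF indep]) measurable
  show "distr N borel (\<lambda>\<omega>. g (y i \<omega>)) = distr (P \<theta>s) borel g"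
    unfolding law[of i, symmetric] by (subst distr_distr) (auto simp: o_def)
  have "integrable (P \<theta>s) (\<lambda>v. (norm (g v))\<^sup>2)"
  proof (rule integrable_P_poly[OF _ _ norm_\<theta>s_le, of _ "C\<^sup>2" "k * 2"])
    show "norm ((norm (g v))\<^sup>2) \<le> C\<^sup>2 * (1 + norm v) ^ (k * 2)" for v
      using power_mono[OF C[of v], of 2] by (simp add: power_mult_distrib power_mult)
  qed measurable
  then show "integrable (distr (P \<theta>s) borel g) (\<lambda>x. (norm x)\<^sup>2)"
    by (subst integrable_distr_eq) auto
  show "(\<integral>x. x \<partial>distr (P \<theta>s) borel g) = (\<integral>v. g v \<partial>P \<theta>s)"
    by (subst integral_distr) auto
  show "(\<integral>x. (norm (x - m))\<^sup>2 \<partial>distr (P \<theta>s) borel g) = (\<integral>v. (norm (g v - m))\<^sup>2 \<partial>P \<theta>s)"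
    by (subst integral_distr) auto
qed

lemma sample_weak_law:
  assumes e: "e > 0"
  shows "(\<lambda>n. measure N {\<omega>\<in>space N. norm (avg g n \<omega> - (\<integral>v. g v \<partial>P \<theta>s)) \<ge> e}) \<longlonglongrightarrow> 0"
  using N.iid_weak_law[OF sample_image(1,2,3) e] unfolding sample_image(4) avg_def .

lemma sample_deviation:
  assumes n: "n > 0" and e: "e > 0"
  shows "measure N {\<omega>\<in>space N. norm (avg g n \<omega> - (\<integral>v. g v \<partial>P \<theta>s)) \<ge> e} \<le>
    (\<integral>v. (norm (g v - (\<integral>v. g v \<partial>P \<theta>s)))\<^sup>2 \<partial>P \<theta>s) / (real n * e\<^sup>2)"
  using N.iid_mean_deviation_prob[OF sample_image(1,2,3) n e] unfolding sample_image(4,5) avg_def .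

end

lemma sample_central_limit:
  fixes g :: "real^'d \<Rightarrow> real"
  assumes g[measurable]: "g \<in> borel_measurable borel" and C: "\<And>v. norm (g v) \<le> C * (1 + norm v) ^ k"
    and "(\<integral>v. g v \<partial>P \<theta>s) = 0" and v: "(\<integral>v. (g v)\<^sup>2 \<partial>P \<theta>s) > 0"
  shows "(\<lambda>n. \<integral>\<omega>. cis (sqrt (real n) * avg g n \<omega>) \<partial>N) \<longlonglongrightarrow>
    complex_of_real (exp (- (\<integral>v. (g v)\<^sup>2 \<partial>P \<theta>s) / 2))"
proof -
  note im = sample_image[OF g C]
  have sq: "integrable (distr (P \<theta>s) borel g) (\<lambda>x. x\<^sup>2)" using im(3) by simp
  have m: "(\<integral>x. x \<partial>distr (P \<theta>s) borel g) = 0" using im(4) assms(3) by simp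
  have v2: "(\<integral>v. (g v)\<^sup>2 \<partial>P \<theta>s) = (\<integral>x. x\<^sup>2 \<partial>distr (P \<theta>s) borel g)" using im(5)[of 0] by simp
  show ?thesis
    using N.iid_central_limit_cis[OF im(1,2) sq m v2 v] unfolding avg_def by simp
qed

section \<open>Growth and Lipschitz bounds for the empirical and the population
  log-likelihood\<close>

lemma ln_p_bound:
  assumes \<theta>: "norm \<theta> \<le> R"
  shows "\<bar>ln (p \<theta> v)\<bar> \<le> (\<bar>ln c0\<bar> + (1 + \<kappa> * R)\<^sup>2 / (2 * \<sigma>\<^sup>2)) * (1 + norm v)\<^sup>2"
proof -
  let ?B = "((1 + \<kappa> * R) * (1 + norm v))\<^sup>2 / (2 * \<sigma>\<^sup>2)"
  have int: "integrable M (\<lambda>z. exp (ea \<theta> v z))" using integrable_exp_ea_mult[of "\<lambda>_. 1" 1] by simp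
  have ae: "AE z in M. exp (- ?B) \<le> exp (ea \<theta> v z)"
    using ea_bound[of v]
  proof eventually_elim
    case (elim z)
    have "norm v + \<kappa> * norm \<theta> \<le> norm v + \<kappa> * R" using \<theta> kappa by (simp add: mult_left_mono)
    also have "\<dots> \<le> (1 + \<kappa> * R) * (1 + norm v)" using kappa R by (simp add: algebra_simps)
    finally have "(norm v + \<kappa> * norm \<theta>)\<^sup>2 \<le> ((1 + \<kappa> * R) * (1 + norm v))\<^sup>2"
      using kappa by (intro power_mono) auto
    then have "(norm v + \<kappa> * norm \<theta>)\<^sup>2 / (2 * \<sigma>\<^sup>2) \<le> ?B" by (intro divide_right_mono) auto
    then show ?case using elim[rule_format, of \<theta>] by simp
  qed
  have "(\<integral>z. exp (- ?B) \<partial>M) \<le> wt \<theta> v"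
    unfolding wt_def by (rule integral_mono_AE[OF _ int ae]) simp
  then have 1: "- ?B \<le> ln (wt \<theta> v)" using wt_pos[of \<theta> v] by (simp add: prob_space ln_ge_iff)
  have "wt \<theta> v \<le> (\<integral>z. 1 \<partial>M)"
    unfolding wt_def by (rule integral_mono[OF int]) (auto simp: ea_nonpos)
  then have 2: "ln (wt \<theta> v) \<le> 0" using wt_pos[of \<theta> v] by (simp add: prob_space)
  have "ln (p \<theta> v) = ln c0 + ln (wt \<theta> v)"
    using c0_pos wt_pos[of \<theta> v] by (simp add: p_wt ln_mult)
  then have 3: "\<bar>ln (p \<theta> v)\<bar> \<le> \<bar>ln c0\<bar> + ?B" using 1 2 by linarith
  have "\<bar>ln c0\<bar> * 1 \<le> \<bar>ln c0\<bar> * (1 + norm v)\<^sup>2" by (intro mult_left_mono) simp_all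
  moreover have "?B = (1 + \<kappa> * R)\<^sup>2 / (2 * \<sigma>\<^sup>2) * (1 + norm v)\<^sup>2"
    by (simp only: power_mult_distrib times_divide_eq_left)
  ultimately show ?thesis using 3 by (simp only: distrib_right mult_1_right)
qed

lemma integrable_ln_p:
  assumes \<theta>: "norm \<theta> \<le> R" shows "integrable (P \<theta>s) (\<lambda>v. ln (p \<theta> v))"
  by (rule integrable_P_poly[OF _ _ norm_\<theta>s_le, of _ "\<bar>ln c0\<bar> + (1 + \<kappa> * R)\<^sup>2 / (2 * \<sigma>\<^sup>2)" 2])
     (use ln_p_bound[OF \<theta>] in auto)

text \<open>The increment between two points of the ball of radius \<open>R / 3\<close> has length
  at most \<open>2 * R / 3\<close>, which is exactly the room required by the Taylor
  estimates.\<close>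

lemma ln_p_Lipschitz:
  assumes "norm \<theta> \<le> R / 3" "norm \<theta>' \<le> R / 3"
  shows "\<bar>ln (p \<theta> v) - ln (p \<theta>' v)\<bar> \<le> C1 * (1 + norm v) * norm (\<theta> - \<theta>')"
proof -
  have "norm \<theta>' + norm (\<theta> - \<theta>') \<le> R" using assms norm_triangle_ineq4[of \<theta> \<theta>'] by linarith
  from ln_p_Taylor1[OF this] show ?thesis by simp
qed

lemma pop_loglik_Lipschitz:
  assumes \<theta>: "norm \<theta> \<le> R / 3" "norm \<theta>' \<le> R / 3"
  shows "\<bar>pop_loglik M A \<sigma> \<beta> \<theta>s \<theta> - pop_loglik M A \<sigma> \<beta> \<theta>s \<theta>'\<bar> \<le> C1 * (\<integral>v. 1 + norm v \<partial>P \<theta>s) * norm (\<theta> - \<theta>')"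
proof -
  have le: "norm \<theta> \<le> R" "norm \<theta>' \<le> R" using \<theta> R by auto
  note int = integrable_ln_p[OF le(1)] integrable_ln_p[OF le(2)]
  have int1: "integrable (P \<theta>s) (\<lambda>v. 1 + norm v)"
    by (rule integrable_P_poly[OF _ _ norm_\<theta>s_le, of _ 1 1]) auto
  have "\<bar>pop_loglik M A \<sigma> \<beta> \<theta>s \<theta> - pop_loglik M A \<sigma> \<beta> \<theta>s \<theta>'\<bar> = \<bar>\<integral>v. ln (p \<theta> v) - ln (p \<theta>' v) \<partial>P \<theta>s\<bar>"
    using int by (simp add: pop_loglik_def)
  also have "\<dots> \<le> (\<integral>v. \<bar>ln (p \<theta> v) - ln (p \<theta>' v)\<bar> \<partial>P \<theta>s)" by (rule integral_abs_bound)
  also have "\<dots> \<le> (\<integral>v. C1 * norm (\<theta> - \<theta>') * (1 + norm v) \<partial>P \<theta>s)"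
    using int int1 ln_p_Lipschitz[OF \<theta>] by (intro integral_mono integrable_mult_right) (auto simp: mult_ac)
  also have "\<dots> = C1 * (\<integral>v. 1 + norm v \<partial>P \<theta>s) * norm (\<theta> - \<theta>')"
    using int1 by (simp add: mult_ac)
  finally show ?thesis .
qed

lemma emp_loglik_diff:
  "emp_loglik M A \<sigma> \<beta> n (\<lambda>i. y i \<omega>) \<theta> - emp_loglik M A \<sigma> \<beta> n (\<lambda>i. y i \<omega>) \<theta>' =
    avg (\<lambda>v. ln (p \<theta> v) - ln (p \<theta>' v)) n \<omega>"
  by (simp add: emp_loglik_def avg_def sum_subtractf diff_divide_distrib)

lemma avg_mono:
  fixes f g :: "real^'d \<Rightarrow> real"
  shows "(\<And>v. f v \<le> g v) \<Longrightarrow> avg f n \<omega> \<le> avg g n \<omega>"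
  unfolding avg_def by (auto intro!: divide_right_mono sum_mono)

lemma avg_linear:
  fixes f g :: "real^'d \<Rightarrow> real"
  shows "avg (\<lambda>v. f v + g v) n \<omega> = avg f n \<omega> + avg g n \<omega>" "avg (\<lambda>v. r * f v) n \<omega> = r * avg f n \<omega>"
  by (simp_all add: avg_def sum.distrib add_divide_distrib sum_distrib_left[symmetric])

text \<open>Wald's argument: the Lipschitz bound reduces the supremum over \<open>K\<close> to a finite net.\<close>

lemma maximizer_avoids_compact:
  assumes K: "compact K" and KR: "\<And>\<theta>. \<theta> \<in> K \<Longrightarrow> norm \<theta> \<le> R / 3" and \<theta>sR: "norm \<theta>s \<le> R / 3"
    and less: "\<And>\<theta>. \<theta> \<in> K \<Longrightarrow> pop_loglik M A \<sigma> \<beta> \<theta>s \<theta> < pop_loglik M A \<sigma> \<beta> \<theta>s \<theta>s"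
    and max: "\<And>n \<omega>. \<omega> \<in> space N \<Longrightarrow>
      emp_loglik M A \<sigma> \<beta> n (\<lambda>i. y i \<omega>) \<theta>s \<le> emp_loglik M A \<sigma> \<beta> n (\<lambda>i. y i \<omega>) (mle n \<omega>)"
  shows "(\<lambda>n. measure N {\<omega>\<in>space N. mle n \<omega> \<in> K}) \<longlonglongrightarrow> 0"
proof (cases "K = {}")
  case False
  let ?L = "pop_loglik M A \<sigma> \<beta> \<theta>s"
  define m where "m = (\<integral>v. 1 + norm v \<partial>P \<theta>s)"
  have m0: "m \<ge> 0" unfolding m_def by (intro integral_nonneg_AE) auto
  have "continuous_on K ?L"
  proof (rule lipschitz_on_continuous_on)
    show "(C1 * m)-lipschitz_on K ?L"
      using pop_loglik_Lipschitz KR C_nonneg m0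
      by (intro lipschitz_onI) (auto simp: m_def dist_real_def dist_norm)
  qed
  then obtain \<theta>0 where \<theta>0: "\<theta>0 \<in> K" "\<And>\<theta>. \<theta> \<in> K \<Longrightarrow> ?L \<theta> \<le> ?L \<theta>0"
    using continuous_attains_sup[OF K False] by blast
  \<comment> \<open>A quarter of the gap: one \<open>\<eta>\<close> is lost to the law of large
    numbers at a net point and one to the mesh of the net, which leaves the mean log-likelihood
    ratio below \<open>- 2 * \<eta>\<close>.\<close>
  define \<eta> where "\<eta> = (?L \<theta>s - ?L \<theta>0) / 4"
  have \<eta>: "\<eta> > 0" using less[OF \<theta>0(1)] by (simp add: \<eta>_def)
  \<comment> \<open>\<open>m + 1\<close> bounds the empirical mean of \<open>1 + norm v\<close>
    outside \<open>?M\<close>; the 1 added to \<open>C1\<close> keeps the denominator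
    positive.\<close>
  define \<delta> where "\<delta> = \<eta> / ((C1 + 1) * (m + 1))"
  have \<delta>: "\<delta> > 0" using \<eta> C_nonneg m0 by (simp add: \<delta>_def)
  have "K \<subseteq> (\<Union>\<theta>\<in>K. ball \<theta> \<delta>)" using \<delta> by auto
  then obtain F where F: "F \<subseteq> K" "finite F" "K \<subseteq> (\<Union>\<theta>\<in>F. ball \<theta> \<delta>)"
    by (rule compactE_image[OF K open_ball])
  let ?d = "\<lambda>\<theta> v. ln (p \<theta> v) - ln (p \<theta>s v)"
  let ?B = "\<lambda>\<theta> n. {\<omega>\<in>space N. norm (avg (?d \<theta>) n \<omega> - (\<integral>v. ?d \<theta> v \<partial>P \<theta>s)) \<ge> \<eta>}"
  let ?M = "\<lambda>n. {\<omega>\<in>space N. norm (avg (\<lambda>v. 1 + norm v) n \<omega> - m) \<ge> 1}"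
  have B: "(\<lambda>n. measure N (?B \<theta> n)) \<longlonglongrightarrow> 0" if "\<theta> \<in> F" for \<theta>
  proof (rule sample_weak_law[OF _ _ \<eta>])
    show "norm (?d \<theta> v) \<le> (C1 * norm (\<theta> - \<theta>s)) * (1 + norm v) ^ 1" for v
      using ln_p_Lipschitz[OF KR \<theta>sR, of \<theta> v] that F(1) by (auto simp: mult_ac)
  qed measurable
  have B0: "(\<lambda>n. measure N (?M n)) \<longlonglongrightarrow> 0"
    unfolding m_def by (rule sample_weak_law[of _ 1 1]) auto
  have sub: "{\<omega>\<in>space N. mle n \<omega> \<in> K} \<subseteq> (\<Union>\<theta>\<in>F. ?B \<theta> n) \<union> ?M n" for n
  proof (rule subsetI, rule ccontr)
    fix \<omega> assume \<omega>: "\<omega> \<in> {\<omega>\<in>space N. mle n \<omega> \<in> K}" "\<omega> \<notin> (\<Union>\<theta>\<in>F. ?B \<theta> n) \<union> ?M n"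
    then obtain \<theta> where \<theta>: "\<theta> \<in> F" "dist \<theta> (mle n \<omega>) < \<delta>" using F(3) by auto
    have \<theta>K: "\<theta> \<in> K" using \<theta>(1) F(1) by blast
    have mK: "mle n \<omega> \<in> K" and sp: "\<omega> \<in> space N" using \<omega>(1) by auto
    have int: "(\<integral>v. ?d \<theta> v \<partial>P \<theta>s) = ?L \<theta> - ?L \<theta>s"
      using integrable_ln_p[of \<theta>] integrable_ln_p[OF norm_\<theta>s_le] KR[OF \<theta>K] R by (simp add: pop_loglik_def)
    have 1: "avg (?d \<theta>) n \<omega> < ?L \<theta> - ?L \<theta>s + \<eta>"
      using \<omega>(2) \<theta>(1) sp int by (auto simp: not_le abs_less_iff)
    have 2: "avg (\<lambda>v. 1 + norm v) n \<omega> < m + 1"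
      using \<omega>(2) sp by (auto simp: not_le abs_less_iff)
    have "avg (?d (mle n \<omega>)) n \<omega> \<le> avg (\<lambda>v. ?d \<theta> v + C1 * \<delta> * (1 + norm v)) n \<omega>"
    proof (rule avg_mono)
      fix v
      have "ln (p (mle n \<omega>) v) - ln (p \<theta> v) \<le> C1 * (1 + norm v) * norm (mle n \<omega> - \<theta>)"
        using ln_p_Lipschitz[OF KR[OF mK] KR[OF \<theta>K], of v] by linarith
      also have "\<dots> \<le> C1 * (1 + norm v) * \<delta>"
        using \<theta>(2) C_nonneg by (intro mult_left_mono) (auto simp: dist_norm norm_minus_commute)
      finally show "?d (mle n \<omega>) v \<le> ?d \<theta> v + C1 * \<delta> * (1 + norm v)" by (simp add: mult_ac)
    qed
    also have "\<dots> = avg (?d \<theta>) n \<omega> + C1 * \<delta> * avg (\<lambda>v. 1 + norm v) n \<omega>" by (simp only: avg_linear)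
    also have "\<dots> \<le> avg (?d \<theta>) n \<omega> + C1 * \<delta> * (m + 1)"
      using 2 C_nonneg \<delta> by (intro add_left_mono mult_left_mono) auto
    also have "C1 * \<delta> * (m + 1) \<le> (C1 + 1) * \<delta> * (m + 1)"
      using \<delta> m0 by (intro mult_right_mono) auto
    also have "(C1 + 1) * \<delta> * (m + 1) = \<eta>" using C_nonneg m0 by (simp add: \<delta>_def)
    finally have "avg (?d (mle n \<omega>)) n \<omega> < ?L \<theta> - ?L \<theta>s + 2 * \<eta>" using 1 by linarith
    also have "\<dots> \<le> - 2 * \<eta>" using \<theta>0(2)[OF \<theta>K] unfolding \<eta>_def by (simp add: field_simps)
    finally have "avg (?d (mle n \<omega>)) n \<omega> < 0" using \<eta> by linarith
    then show False using max[OF sp, of n] emp_loglik_diff[of n \<omega> "mle n \<omega>" \<theta>s] by linarith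
  qed
  have ev: "?B \<theta> n \<in> sets N" "?M n \<in> sets N" for \<theta> n
    by (rule deviation_event, measurable)+
  have "measure N {\<omega>\<in>space N. mle n \<omega> \<in> K} \<le> (\<Sum>\<theta>\<in>F. measure N (?B \<theta> n)) + measure N (?M n)" for n
  proof -
    \<comment> \<open>Monotonicity of \<open>measure\<close> asks for measurability of the covering
      event only, which is built from deviation events.\<close>
    have "measure N {\<omega>\<in>space N. mle n \<omega> \<in> K} \<le> measure N ((\<Union>\<theta>\<in>F. ?B \<theta> n) \<union> ?M n)"
      using F(2) by (intro N.finite_measure_mono[OF sub] sets.Un sets.finite_UN ev)
    also have "\<dots> \<le> measure N (\<Union>\<theta>\<in>F. ?B \<theta> n) + measure N (?M n)"
      using F(2) by (intro measure_Un_le sets.finite_UN ev)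
    also have "measure N (\<Union>\<theta>\<in>F. ?B \<theta> n) \<le> (\<Sum>\<theta>\<in>F. measure N (?B \<theta> n))"
      using F(2) by (intro measure_UNION_le ev)
    finally show ?thesis by simp
  qed
  moreover have "(\<lambda>n. (\<Sum>\<theta>\<in>F. measure N (?B \<theta> n)) + measure N (?M n)) \<longlonglongrightarrow> (\<Sum>\<theta>\<in>F. 0) + 0"
    by (intro tendsto_add tendsto_sum B B0)
  ultimately show ?thesis
    by (intro tendsto_zero_if_le[OF measure_nonneg]) simp_all
qed simp

end

section \<open>Asymptotic normality\<close>

lemma linear_orth_proj: "subspace W \<Longrightarrow> linear (orth_proj W)"
proof (rule linearI)
  assume W: "subspace W"
  note o = orth_proj_props[OF W] and oc = subspace_orthogonal_comp[of W]
  fix x y :: 'a and r :: real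
  have "x + y - (orth_proj W x + orth_proj W y) = (x - orth_proj W x) + (y - orth_proj W y)" by simp
  then show "orth_proj W (x + y) = orth_proj W x + orth_proj W y"
    using subspace_add[OF W o(1) o(1)] subspace_add[OF oc o(2) o(2)]
    by (intro orth_proj_eqI[OF W]) metis+
  have "r *\<^sub>R x - r *\<^sub>R orth_proj W x = r *\<^sub>R (x - orth_proj W x)" by (simp add: scaleR_diff_right)
  then show "orth_proj W (r *\<^sub>R x) = r *\<^sub>R orth_proj W x"
    using subspace_scale[OF W o(1)] subspace_scale[OF oc o(2)]
    by (intro orth_proj_eqI[OF W]) metis+
qed

lemma orth_proj_ident: "subspace W \<Longrightarrow> x \<in> W \<Longrightarrow> orth_proj W x = x"
  by (rule orth_proj_eqI) (auto simp: subspace_0[OF subspace_orthogonal_comp])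

lemma borel_measurable_linear:
  fixes f :: "'a::euclidean_space \<Rightarrow> 'b::euclidean_space"
  assumes "linear f" shows "f \<in> borel_measurable borel"
  using linear_conv_bounded_linear[THEN iffD1, OF assms]
  by (intro borel_measurable_continuous_onI linear_continuous_on)

text \<open>The Lipschitz bound that allows two sequences to be exchanged in a characteristic
  function when their difference tends to 0 in probability.\<close>

lemma norm_cis_diff_le: "norm (cis a - cis b) \<le> \<bar>a - b\<bar>"
proof -
  have "cis a - cis b = cis b * (cis (a - b) - 1)" by (simp add: algebra_simps cis_mult)
  then have "norm (cis a - cis b) = norm (cis (a - b) - 1)" by (simp add: norm_mult)
  also have "\<dots> \<le> \<bar>a - b\<bar>"
    using iexp_approx1[of "a - b" 0] by (simp add: cis_conv_exp)
  finally show ?thesis .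
qed

context mixture_sample
begin

text \<open>Averaging the pointwise expansion leaves three sample means that do not depend on
  \<open>w\<close>: score, Hessian and cubic majorant. Uniformity over small \<open>w\<close> is
  thus automatic.\<close>

lemma loglik_expansion:
  assumes w: "norm w \<le> 1"
  shows "\<bar>avg (\<lambda>v. ln (p (\<theta>s + w) v) - ln (p \<theta>s v)) n \<omega> -
      (w \<bullet> avg (sc \<theta>s) n \<omega> + (w \<bullet> (avg (hess \<theta>s) n \<omega> *v w)) / 2)\<bar>
    \<le> (C2 * C1 + C1 ^ 3) * avg (\<lambda>v. (1 + norm v) ^ 3) n \<omega> * norm w ^ 3"
proof -
  have tw: "norm \<theta>s + norm w \<le> R" using w norm_\<theta>s by simp
  let ?K = "(C2 * C1 + C1 ^ 3) * norm w ^ 3"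
  let ?e = "\<lambda>v. ln (p (\<theta>s + w) v) - ln (p \<theta>s v) - dscore \<theta>s w v - (dhess \<theta>s w w v - (dscore \<theta>s w v)\<^sup>2) / 2"
  have s: "w \<bullet> avg (sc \<theta>s) n \<omega> = avg (\<lambda>v. dscore \<theta>s w v) n \<omega>"
    by (simp add: avg_def inner_sum_right inner_sc)
  have h: "w \<bullet> (avg (hess \<theta>s) n \<omega> *v w) = avg (\<lambda>v. dhess \<theta>s w w v - (dscore \<theta>s w v)\<^sup>2) n \<omega>"
    unfolding avg_def
    by (simp only: linear_cmul[OF linear_quadratic_form] linear_sum[OF linear_quadratic_form]
        inner_hess[OF norm_\<theta>s_le] power2_eq_square)
  have "avg (\<lambda>v. ln (p (\<theta>s + w) v) - ln (p \<theta>s v)) n \<omega> -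
      (w \<bullet> avg (sc \<theta>s) n \<omega> + (w \<bullet> (avg (hess \<theta>s) n \<omega> *v w)) / 2) = avg ?e n \<omega>"
    unfolding s h by (simp add: avg_def sum_subtractf sum_divide_distrib[symmetric] diff_divide_distrib)
  moreover have "avg ?e n \<omega> \<le> avg (\<lambda>v. ?K * (1 + norm v) ^ 3) n \<omega>"
    "avg (\<lambda>v. - 1 * ?e v) n \<omega> \<le> avg (\<lambda>v. ?K * (1 + norm v) ^ 3) n \<omega>"
    using ln_p_Taylor3[OF tw] by (auto intro!: avg_mono simp: abs_le_iff mult_ac)
  ultimately show ?thesis unfolding avg_linear(2) by (simp add: abs_le_iff mult_ac)
qed

text \<open>Tightness of the normalized score sum, from Chebyshev's inequality and the zero mean of
  the score; the \<open>- 0\<close> is that mean.\<close>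

lemma score_deviation:
  "\<exists>B>0. \<forall>n>0. measure N {\<omega>\<in>space N. norm (avg (sc \<theta>s) n \<omega> - 0) \<ge> B / sqrt (real n)} \<le> e" if e: "e > 0"
proof -
  define V where "V = (\<integral>v. (norm (sc \<theta>s v - 0))\<^sup>2 \<partial>P \<theta>s)"
  have V: "V \<ge> 0" unfolding V_def by (intro integral_nonneg_AE) auto
  \<comment> \<open>\<open>B\<^sup>2 \<ge> V / e\<close> brings the Chebyshev bound below
    \<open>e\<close>; the 1 keeps \<open>B\<close> positive when \<open>V = 0\<close>.\<close>
  define B where "B = sqrt (V / e) + 1"
  have B: "B > 0" using V e by (simp add: B_def add_nonneg_pos)
  have "(sqrt (V / e))\<^sup>2 \<le> B\<^sup>2" using V e by (intro power_mono) (auto simp: B_def)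
  then have VB: "V / B\<^sup>2 \<le> e" using V e B by (simp add: field_simps)
  have "measure N {\<omega>\<in>space N. norm (avg (sc \<theta>s) n \<omega> - 0) \<ge> B / sqrt (real n)} \<le> e" if n: "n > 0" for n
  proof -
    have "norm (sc \<theta>s v) \<le> C1 * (1 + norm v) ^ 1" for v using sc_bound[OF norm_\<theta>s_le, of v] by simp
    from sample_deviation[OF measurable_sc this n, of "B / sqrt (real n)"]
    have "measure N {\<omega>\<in>space N. norm (avg (sc \<theta>s) n \<omega> - 0) \<ge> B / sqrt (real n)} \<le> V / (real n * (B / sqrt (real n))\<^sup>2)"
      using B n unfolding integral_sc[OF norm_\<theta>s] V_def by simp
    also have "\<dots> = V / B\<^sup>2" using n by (simp add: power_divide)
    finally show ?thesis using VB by simp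
  qed
  then show ?thesis using B by blast
qed

lemma measurable_avg_sc[measurable]: "avg (sc \<theta>s) n \<in> borel_measurable N"
  by (rule measurable_avg) measurable

lemma fisher_commute: "u \<bullet> (fisher_obs M A \<sigma> \<beta> \<theta>s *v v) = v \<bullet> (fisher_obs M A \<sigma> \<beta> \<theta>s *v u)"
  unfolding inner_fisher[OF norm_\<theta>s] by (simp add: mult.commute)

lemma measurable_cis_inner: "(\<lambda>x::real^'m. cis (t \<bullet> x)) \<in> borel_measurable borel"
  by (intro borel_measurable_continuous_onI continuous_intros)

lemma integrable_cis:
  assumes [measurable]: "f \<in> borel_measurable N"
  shows "integrable N (\<lambda>\<omega>. cis (t \<bullet> (f \<omega> :: real^'m)))"
proof (rule N.integrable_const_bound[of _ 1])
  show "(\<lambda>\<omega>. cis (t \<bullet> f \<omega>)) \<in> borel_measurable N"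
    by (rule measurable_compose[OF assms measurable_cis_inner])
qed simp

section \<open>Limit law of a consistent representative that is optimal over the slice\<close>

context
  fixes W :: "(real^'m) set" and C :: "real^'m \<Rightarrow> real^'m" and rep :: "nat \<Rightarrow> 'w \<Rightarrow> real^'m" and \<rho>0 :: real
  assumes W: "subspace W"
    and pos: "\<And>w. w \<in> W \<Longrightarrow> w \<noteq> 0 \<Longrightarrow> w \<bullet> (fisher_obs M A \<sigma> \<beta> \<theta>s *v w) > 0"
    and C: "linear C" "\<And>u. C u \<in> W" "\<And>h u. h \<in> W \<Longrightarrow> h \<bullet> (fisher_obs M A \<sigma> \<beta> \<theta>s *v C u) = h \<bullet> u"
      "\<And>t u. t \<bullet> C u = C t \<bullet> u"
    and rep[measurable]: "\<And>n. rep n \<in> borel_measurable N"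
    and cons: "\<And>e. e > 0 \<Longrightarrow> (\<lambda>n. measure N {\<omega>\<in>space N. dist (rep n \<omega>) \<theta>s \<ge> e}) \<longlonglongrightarrow> 0"
    and inW: "(\<lambda>n. measure N {\<omega>\<in>space N. rep n \<omega> - \<theta>s \<notin> W}) \<longlonglongrightarrow> 0"
    and \<rho>0: "\<rho>0 > 0"
    and opt: "\<And>n \<omega> w. \<omega> \<in> space N \<Longrightarrow> w \<in> W \<Longrightarrow> norm w \<le> \<rho>0 \<Longrightarrow>
      emp_loglik M A \<sigma> \<beta> n (\<lambda>i. y i \<omega>) (\<theta>s + w) \<le> emp_loglik M A \<sigma> \<beta> n (\<lambda>i. y i \<omega>) (rep n \<omega>)"
begin

lemma measurable_C[measurable]: "C \<in> borel_measurable borel"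
  using C(1) by (rule borel_measurable_linear)

lemma event_W: "{\<omega>\<in>space N. rep n \<omega> - \<theta>s \<notin> W} \<in> sets N"
proof -
  have "W \<in> sets borel" using closed_subspace[OF W] by simp
  then have [measurable]: "Measurable.pred borel (\<lambda>x. x \<in> W)" by simp
  show ?thesis by measurable
qed

text \<open>Outside a few bad events the deterministic comparison of maximizers applies with the
  mean score as \<open>s\<close>. Since \<open>s\<close> is of order \<open>B / sqrt n\<close>, the
  squared error is at most a small multiple of \<open>1 / n\<close>, and the multiple is controlled
  by \<open>\<tau>\<close>.\<close>

lemma local_approximation:
  assumes e: "e > 0"
  shows "(\<lambda>n. measure N {\<omega>\<in>space N. norm (sqrt (real n) *\<^sub>R (rep n \<omega> - \<theta>s) -
    sqrt (real n) *\<^sub>R C (avg (sc \<theta>s) n \<omega>)) \<ge> e}) \<longlonglongrightarrow> 0"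
    (is "(\<lambda>n. measure N (?E n)) \<longlonglongrightarrow> 0")
proof (rule tendsto_zero_if_bounded_by[OF measure_nonneg])
  fix \<eta> :: real assume \<eta>: "\<eta> > 0"
  let ?I = "fisher_obs M A \<sigma> \<beta> \<theta>s"
  obtain c where c: "c > 0" "\<And>w. w \<in> W \<Longrightarrow> c * (norm w)\<^sup>2 \<le> w \<bullet> (?I *v w)"
    using pos_def_on_subspace_coercive[OF W pos] by blast
  obtain B where B: "B > 0" "\<And>n. n > 0 \<Longrightarrow>
      measure N {\<omega>\<in>space N. norm (avg (sc \<theta>s) n \<omega> - 0) \<ge> B / sqrt (real n)} \<le> \<eta>"
    using score_deviation[OF \<eta>] by blast
  \<comment> \<open>The first entry is the absorption condition of the comparison; the second, with
    \<open>68 = 2 * 34\<close>, brings its bound down to \<open>e\<^sup>2 / 2\<close> after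
    multiplication by \<open>n\<close>.\<close>
  define \<tau> where "\<tau> = min (c / 4) (e\<^sup>2 * c ^ 3 / (68 * B\<^sup>2))"
  have \<tau>: "\<tau> > 0" "\<tau> \<le> c / 4" using c(1) e B(1) by (auto simp: \<tau>_def)
  have "\<tau> \<le> e\<^sup>2 * c ^ 3 / (68 * B\<^sup>2)" by (simp add: \<tau>_def)
  then have "34 * \<tau> / c ^ 3 * B\<^sup>2 \<le> 34 * (e\<^sup>2 * c ^ 3 / (68 * B\<^sup>2)) / c ^ 3 * B\<^sup>2"
    using c(1) by (intro mult_right_mono divide_right_mono mult_left_mono) auto
  also have "\<dots> = e\<^sup>2 / 2" using c(1) B(1) by simp
  finally have \<tau>e: "34 * \<tau> / c ^ 3 * B\<^sup>2 < e\<^sup>2" using e by (smt (verit) half_gt_zero_iff field_sum_of_halves zero_less_power)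
  define K where "K = C2 * C1 + C1 ^ 3"
  have K: "K \<ge> 0" using C_nonneg by (simp add: K_def)
  define m where "m = (\<integral>v. (1 + norm v) ^ 3 \<partial>P \<theta>s)"
  have m: "m \<ge> 0" unfolding m_def by (intro integral_nonneg_AE) auto
  \<comment> \<open>On this radius the cubic remainder is at most
    \<open>\<tau> / 2 * (norm w)\<^sup>2\<close> once the cubic mean is at most
    \<open>m + 1\<close>. The other half of \<open>\<tau>\<close> is left for the fluctuation of the
    Hessian.\<close>
  define \<rho> where "\<rho> = min (min 1 \<rho>0) (\<tau> / (2 * ((K + 1) * (m + 1))))"
  have Km: "(K + 1) * (m + 1) > 0" using K m by simp
  have \<rho>: "\<rho> > 0" "\<rho> \<le> 1" "\<rho> \<le> \<rho>0" using \<tau> \<rho>0 Km by (auto simp: \<rho>_def)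
  have \<rho>\<tau>: "K * (m + 1) * \<rho> \<le> \<tau> / 2"
  proof -
    have "K * (m + 1) * \<rho> \<le> ((K + 1) * (m + 1)) * \<rho>" using \<rho>(1) m by (intro mult_right_mono) auto
    also have "\<dots> \<le> ((K + 1) * (m + 1)) * (\<tau> / (2 * ((K + 1) * (m + 1))))"
      using Km by (intro mult_left_mono) (auto simp: \<rho>_def)
    also have "\<dots> = \<tau> / 2" using K m by simp
    finally show ?thesis .
  qed
  let ?EH = "\<integral>v. hess \<theta>s v \<partial>P \<theta>s"
  let ?E1 = "\<lambda>n. {\<omega>\<in>space N. norm (avg (hess \<theta>s) n \<omega> - ?EH) \<ge> \<tau>}"
  let ?E2 = "\<lambda>n. {\<omega>\<in>space N. norm (avg (\<lambda>v. (1 + norm v) ^ 3) n \<omega> - m) \<ge> 1}"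
  \<comment> \<open>For this event only the bound \<open>\<eta>\<close> is known, valid for every
    \<open>n > 0\<close>; it is therefore kept out of \<open>?g\<close>, whose terms all tend to
    0.\<close>
  let ?E3 = "\<lambda>n. {\<omega>\<in>space N. norm (avg (sc \<theta>s) n \<omega> - 0) \<ge> B / sqrt (real n)}"
  let ?E4 = "\<lambda>n. {\<omega>\<in>space N. dist (rep n \<omega>) \<theta>s \<ge> \<rho>}"
  let ?E5 = "\<lambda>n. {\<omega>\<in>space N. rep n \<omega> - \<theta>s \<notin> W}"
  have E1: "(\<lambda>n. measure N (?E1 n)) \<longlonglongrightarrow> 0"
    by (rule sample_weak_law[OF _ hess_bound[OF norm_\<theta>s_le] \<tau>(1)]) measurable
  have E2: "(\<lambda>n. measure N (?E2 n)) \<longlonglongrightarrow> 0"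
    unfolding m_def by (rule sample_weak_law[of _ 1 3]) auto
  have "?E1 n \<in> sets N" "?E3 n \<in> sets N" for n
    by (rule deviation_event[OF measurable_hess]) (rule deviation_event[OF measurable_sc])
  moreover have "?E2 n \<in> sets N" for n by (rule deviation_event) measurable
  moreover have "?E4 n \<in> sets N" for n by measurable
  ultimately have ev: "?E1 n \<in> sets N" "?E2 n \<in> sets N" "?E3 n \<in> sets N" "?E4 n \<in> sets N" "?E5 n \<in> sets N" for n
    by (simp_all only: event_W)
  let ?g = "\<lambda>n. measure N (?E1 n) + measure N (?E2 n) + measure N (?E4 n) + measure N (?E5 n)"
  have g: "?g \<longlonglongrightarrow> 0"
    using tendsto_add[OF tendsto_add[OF tendsto_add[OF E1 E2] cons[OF \<rho>(1)]] inW] by simp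
  \<comment> \<open>For large \<open>n\<close> the mean score is so short that the maximizer of the
    quadratic function falls into the ball of radius \<open>\<rho>\<close>, where it can be compared
    with \<open>x\<close>.\<close>
  have "((\<lambda>n. B / sqrt (real n)) \<longlonglongrightarrow> 0)"
    by (intro tendsto_divide_0[OF tendsto_const] filterlim_at_top_imp_at_infinity
        filterlim_compose[OF sqrt_at_top filterlim_real_sequentially])
  then have "\<forall>\<^sub>F n in sequentially. B / sqrt (real n) < c * \<rho>"
    using c(1) \<rho>(1) by (intro order_tendstoD) auto
  then have "\<forall>\<^sub>F n in sequentially. measure N (?E n) \<le> ?g n + \<eta>"
    using eventually_gt_at_top[of 0]
  proof eventually_elim
    case (elim n)
    have "?E n \<subseteq> ?E1 n \<union> ?E2 n \<union> ?E4 n \<union> ?E5 n \<union> ?E3 n"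
    proof (rule subsetI, rule ccontr)
      fix \<omega> assume \<omega>: "\<omega> \<in> ?E n" and nE: "\<omega> \<notin> ?E1 n \<union> ?E2 n \<union> ?E4 n \<union> ?E5 n \<union> ?E3 n"
      then have sp: "\<omega> \<in> space N" by simp
      define x where "x = rep n \<omega> - \<theta>s"
      define s where "s = avg (sc \<theta>s) n \<omega>"
      define H where "H = avg (hess \<theta>s) n \<omega>"
      define l where "l w = avg (\<lambda>v. ln (p (\<theta>s + w) v) - ln (p \<theta>s v)) n \<omega>" for w
      have H: "norm (H - ?EH) \<le> \<tau>" and a3: "avg (\<lambda>v. (1 + norm v) ^ 3) n \<omega> \<le> m + 1"
        and x: "x \<in> W" "norm x \<le> \<rho>" and s: "norm s \<le> B / sqrt (real n)"
        using nE sp by (auto simp: not_le x_def s_def H_def dist_norm abs_less_iff)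
      have lexp: "\<bar>l w - (w \<bullet> s - w \<bullet> (?I *v w) / 2)\<bar> \<le> \<tau> * (norm w)\<^sup>2" if w: "norm w \<le> \<rho>" for w
      proof -
        have "\<bar>l w - (w \<bullet> s + (w \<bullet> (H *v w)) / 2)\<bar> \<le> K * avg (\<lambda>v. (1 + norm v) ^ 3) n \<omega> * norm w ^ 3"
          using loglik_expansion[of w n \<omega>] w \<rho>(2) by (simp add: l_def s_def H_def K_def)
        also have "\<dots> \<le> K * (m + 1) * norm w ^ 3"
          using a3 K by (intro mult_right_mono mult_left_mono) auto
        also have "\<dots> = K * (m + 1) * norm w * (norm w)\<^sup>2" by (simp add: power3_eq_cube power2_eq_square)
        also have "\<dots> \<le> K * (m + 1) * \<rho> * (norm w)\<^sup>2"
          using w K m by (intro mult_right_mono mult_left_mono) auto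
        also have "\<dots> \<le> \<tau> / 2 * (norm w)\<^sup>2" using \<rho>\<tau> by (intro mult_right_mono) auto
        finally have 1: "\<bar>l w - (w \<bullet> s + (w \<bullet> (H *v w)) / 2)\<bar> \<le> \<tau> / 2 * (norm w)\<^sup>2" .
        \<comment> \<open>By the information identity the form of the mean Hessian is minus that of
          \<open>?I\<close>.\<close>
        have "w \<bullet> ((H - ?EH) *v w) = w \<bullet> (H *v w) + w \<bullet> (?I *v w)"
          using linear_diff[OF linear_quadratic_form, of w H ?EH] integral_hess[OF norm_\<theta>s, of w] by simp
        moreover have "\<bar>w \<bullet> ((H - ?EH) *v w)\<bar> \<le> \<tau> * (norm w)\<^sup>2"
          using abs_quadratic_form_le[of w "H - ?EH"] H
          by (meson mult_right_mono order.trans zero_le_power2)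
        ultimately have "\<bar>(w \<bullet> (H *v w)) / 2 + (w \<bullet> (?I *v w)) / 2\<bar> \<le> \<tau> / 2 * (norm w)\<^sup>2" by linarith
        with 1 show ?thesis by linarith
      qed
      have "(norm (x - C s))\<^sup>2 \<le> 34 * \<tau> / c ^ 3 * (norm s)\<^sup>2"
      proof (rule quadratic_argmax_close[of ?I, OF fisher_commute W c lexp x])
        show "l w \<le> l x" if "w \<in> W" "norm w \<le> \<rho>" for w
          using opt[OF sp that(1), of n] that(2) \<rho>(3) emp_loglik_diff[of n \<omega> "\<theta>s + w" \<theta>s]
            emp_loglik_diff[of n \<omega> "rep n \<omega>" \<theta>s] by (simp add: l_def x_def)
        show "norm s \<le> c * \<rho>" using s elim(1) by linarith
      qed (use \<tau> C(2,3) in auto)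
      also have "\<dots> \<le> 34 * \<tau> / c ^ 3 * (B / sqrt (real n))\<^sup>2"
        using s \<tau> c(1) by (intro mult_left_mono power_mono) auto
      finally have "real n * (norm (x - C s))\<^sup>2 \<le> real n * (34 * \<tau> / c ^ 3 * (B / sqrt (real n))\<^sup>2)"
        by (intro mult_left_mono) auto
      also have "\<dots> = 34 * \<tau> / c ^ 3 * B\<^sup>2" using elim(2) by (simp add: power_divide)
      finally have "real n * (norm (x - C s))\<^sup>2 < e\<^sup>2" using \<tau>e by simp
      moreover have "e\<^sup>2 \<le> (norm (sqrt (real n) *\<^sub>R x - sqrt (real n) *\<^sub>R C s))\<^sup>2"
        using \<omega> e by (intro power_mono) (auto simp: x_def s_def)
      moreover have "(norm (sqrt (real n) *\<^sub>R x - sqrt (real n) *\<^sub>R C s))\<^sup>2 = real n * (norm (x - C s))\<^sup>2"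
        by (simp add: scaleR_diff_right[symmetric] power_mult_distrib)
      ultimately show False by simp
    qed
    then have "measure N (?E n) \<le> measure N (?E1 n \<union> ?E2 n \<union> ?E4 n \<union> ?E5 n \<union> ?E3 n)"
      by (intro N.finite_measure_mono sets.Un ev)
    also have "\<dots> \<le> measure N (?E1 n \<union> ?E2 n \<union> ?E4 n \<union> ?E5 n) + measure N (?E3 n)"
      by (intro measure_Un_le sets.Un ev)
    also have "measure N (?E1 n \<union> ?E2 n \<union> ?E4 n \<union> ?E5 n) \<le> measure N (?E1 n \<union> ?E2 n \<union> ?E4 n) + measure N (?E5 n)"
      by (intro measure_Un_le sets.Un ev)
    also have "measure N (?E1 n \<union> ?E2 n \<union> ?E4 n) \<le> measure N (?E1 n \<union> ?E2 n) + measure N (?E4 n)"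
      by (intro measure_Un_le sets.Un ev)
    also have "measure N (?E1 n \<union> ?E2 n) \<le> measure N (?E1 n) + measure N (?E2 n)"
      by (intro measure_Un_le sets.Un ev)
    finally show ?case using B(2)[OF elim(2)] by linarith
  qed
  then show "\<exists>g. g \<longlonglongrightarrow> 0 \<and> (\<forall>\<^sub>F n in sequentially. measure N (?E n) \<le> g n + \<eta>)"
    using g by blast
qed

abbreviation "X n \<omega> \<equiv> sqrt (real n) *\<^sub>R orth_proj W (rep n \<omega> - \<theta>s)"
abbreviation "Z n \<omega> \<equiv> sqrt (real n) *\<^sub>R C (avg (sc \<theta>s) n \<omega>)"

lemma measurable_orth_proj[measurable]: "orth_proj W \<in> borel_measurable borel"
  using linear_orth_proj[OF W] by (rule borel_measurable_linear)

text \<open>Where \<open>rep n \<omega> - \<theta>s\<close> lies in \<open>W\<close> the projection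
  does nothing, and the complementary event has vanishing probability.\<close>

lemma projected_approximation:
  assumes e: "e > 0"
  shows "(\<lambda>n. measure N {\<omega>\<in>space N. norm (X n \<omega> - Z n \<omega>) \<ge> e}) \<longlonglongrightarrow> 0"
proof (rule tendsto_zero_if_le[OF measure_nonneg])
  let ?E = "\<lambda>n. {\<omega>\<in>space N. norm (sqrt (real n) *\<^sub>R (rep n \<omega> - \<theta>s) - Z n \<omega>) \<ge> e}"
  let ?D = "\<lambda>n. {\<omega>\<in>space N. rep n \<omega> - \<theta>s \<notin> W}"
  show "(\<lambda>n. measure N (?E n) + measure N (?D n)) \<longlonglongrightarrow> 0"
    using tendsto_add[OF local_approximation[OF e] inW] by simp
  fix n
  have ev: "?E n \<in> sets N" by measurable
  have "measure N {\<omega>\<in>space N. norm (X n \<omega> - Z n \<omega>) \<ge> e} \<le> measure N (?E n \<union> ?D n)"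
    by (intro N.finite_measure_mono sets.Un ev event_W) (auto simp: orth_proj_ident[OF W])
  also have "\<dots> \<le> measure N (?E n) + measure N (?D n)"
    by (intro measure_Un_le ev event_W)
  finally show "measure N {\<omega>\<in>space N. norm (X n \<omega> - Z n \<omega>) \<ge> e} \<le> measure N (?E n) + measure N (?D n)" .
qed

text \<open>Cramer-Wold: a linear functional of \<open>Z\<close> is a normalized sum of real scores
  in direction \<open>C t\<close>, of variance \<open>t \<bullet> C t\<close> because
  \<open>C\<close> inverts the information on \<open>W\<close>. For \<open>C t = 0\<close> the
  functional is identically 0 and both sides equal 1.\<close>

lemma char_Z: "(\<lambda>n. \<integral>\<omega>. cis (t \<bullet> Z n \<omega>) \<partial>N) \<longlonglongrightarrow> complex_of_real (exp (- (t \<bullet> C t) / 2))"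
proof -
  have eq: "t \<bullet> Z n \<omega> = sqrt (real n) * avg (dscore \<theta>s (C t)) n \<omega>" for n \<omega>
    by (simp add: C(4) avg_def inner_sum_right inner_sc)
  have v: "(\<integral>v. (dscore \<theta>s (C t) v)\<^sup>2 \<partial>P \<theta>s) = t \<bullet> C t"
    using inner_fisher[OF norm_\<theta>s, of "C t" "C t"] C(3)[OF C(2), of t t]
    by (simp add: inner_sc power2_eq_square inner_commute)
  show ?thesis
  proof (cases "C t = 0")
    case True
    have "dscore \<theta>s 0 v = 0" for v using linear_0[OF linear_dscore] by simp
    then show ?thesis unfolding eq True by (simp add: avg_def N.prob_space)
  next
    case False
    have p: "t \<bullet> C t > 0" using pos[OF C(2) False] C(3)[OF C(2), of t t] by (simp add: inner_commute)
    show ?thesis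
      unfolding eq v[symmetric]
      by (rule sample_central_limit[where C = "C1 * norm (C t)" and k = 1])
         (use p v integral_dscore[OF norm_\<theta>s] dscore_bound[OF norm_\<theta>s_le, of "C t"] in \<open>auto simp: mult_ac\<close>)
  qed
qed

text \<open>Slutsky's argument for characteristic functions: the integrands differ by at most
  \<open>e\<close> where \<open>X\<close> and \<open>Z\<close> are close, and by at most 2
  elsewhere.\<close>

lemma char_X: "(\<lambda>n. \<integral>\<omega>. cis (t \<bullet> X n \<omega>) \<partial>N) \<longlonglongrightarrow> complex_of_real (exp (- (t \<bullet> C t) / 2))"
proof -
  have "(\<lambda>n. norm ((\<integral>\<omega>. cis (t \<bullet> X n \<omega>) \<partial>N) - (\<integral>\<omega>. cis (t \<bullet> Z n \<omega>) \<partial>N))) \<longlonglongrightarrow> 0"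
  proof (rule tendsto_zero_if_bounded_by[OF norm_ge_zero])
    fix e :: real assume e: "e > 0"
    define d where "d = e / (norm t + 1)"
    have d: "d > 0" using e by (simp add: d_def add_nonneg_pos)
    have "norm t * d \<le> (norm t + 1) * d" using d by (intro mult_right_mono) auto
    also have "\<dots> = e" using norm_ge_zero[of t] by (simp add: d_def add_nonneg_eq_0_iff)
    finally have td: "norm t * d \<le> e" .
    let ?E = "\<lambda>n. {\<omega>\<in>space N. norm (X n \<omega> - Z n \<omega>) \<ge> d}"
    have "norm ((\<integral>\<omega>. cis (t \<bullet> X n \<omega>) \<partial>N) - (\<integral>\<omega>. cis (t \<bullet> Z n \<omega>) \<partial>N)) \<le> 2 * measure N (?E n) + e" for n
    proof -
      have mX: "X n \<in> borel_measurable N" and mZ: "Z n \<in> borel_measurable N" by measurable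
      have ev: "?E n \<in> sets N" by measurable
      have "norm ((\<integral>\<omega>. cis (t \<bullet> X n \<omega>) \<partial>N) - (\<integral>\<omega>. cis (t \<bullet> Z n \<omega>) \<partial>N)) =
          norm (\<integral>\<omega>. cis (t \<bullet> X n \<omega>) - cis (t \<bullet> Z n \<omega>) \<partial>N)"
        using integrable_cis[OF mX] integrable_cis[OF mZ] by (subst Bochner_Integration.integral_diff) auto
      also have "\<dots> \<le> (\<integral>\<omega>. norm (cis (t \<bullet> X n \<omega>) - cis (t \<bullet> Z n \<omega>)) \<partial>N)"
        by (rule integral_norm_bound)
      also have "\<dots> \<le> (\<integral>\<omega>. 2 * indicator (?E n) \<omega> + e \<partial>N)"
      proof (rule integral_mono)
        show "integrable N (\<lambda>\<omega>. norm (cis (t \<bullet> X n \<omega>) - cis (t \<bullet> Z n \<omega>)))"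
          by (intro integrable_norm Bochner_Integration.integrable_diff integrable_cis mX mZ)
        show "integrable N (\<lambda>\<omega>. 2 * indicator (?E n) \<omega> + e)"
          by (intro Bochner_Integration.integrable_add integrable_mult_right integrable_real_indicator ev)
             (auto simp: N.emeasure_eq_measure)
        fix \<omega> assume \<omega>: "\<omega> \<in> space N"
        show "norm (cis (t \<bullet> X n \<omega>) - cis (t \<bullet> Z n \<omega>)) \<le> 2 * indicator (?E n) \<omega> + e"
        proof (cases "\<omega> \<in> ?E n")
          case True
          then show ?thesis using norm_triangle_ineq4[of "cis (t \<bullet> X n \<omega>)" "cis (t \<bullet> Z n \<omega>)"] e by simp
        next
          case False
          then have "norm (X n \<omega> - Z n \<omega>) \<le> d" using \<omega> by simp
          have "norm (cis (t \<bullet> X n \<omega>) - cis (t \<bullet> Z n \<omega>)) \<le> \<bar>t \<bullet> X n \<omega> - t \<bullet> Z n \<omega>\<bar>" by (rule norm_cis_diff_le)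
          also have "\<dots> = \<bar>t \<bullet> (X n \<omega> - Z n \<omega>)\<bar>" by (simp only: inner_diff_right)
          also have "\<dots> \<le> norm t * norm (X n \<omega> - Z n \<omega>)" by (rule Cauchy_Schwarz_ineq2)
          also have "\<dots> \<le> norm t * d" using \<open>norm (X n \<omega> - Z n \<omega>) \<le> d\<close> by (intro mult_left_mono) auto
          finally show ?thesis using td False by simp
        qed
      qed
      also have "\<dots> = 2 * measure N (?E n) + e"
        using N.prob_space ev by (simp add: N.emeasure_eq_measure)
      finally show ?thesis .
    qed
    moreover have "(\<lambda>n. 2 * measure N (?E n)) \<longlonglongrightarrow> 0"
      using tendsto_mult_left[OF projected_approximation[OF d], of 2] by simp
    ultimately show "\<exists>g. g \<longlonglongrightarrow> 0 \<and> (\<forall>\<^sub>F n in sequentially.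
        norm ((\<integral>\<omega>. cis (t \<bullet> X n \<omega>) \<partial>N) - (\<integral>\<omega>. cis (t \<bullet> Z n \<omega>) \<partial>N)) \<le> g n + e)"
      by (intro exI[of _ "\<lambda>n. 2 * measure N (?E n)"]) simp
  qed
  then have "(\<lambda>n. (\<integral>\<omega>. cis (t \<bullet> X n \<omega>) \<partial>N) - (\<integral>\<omega>. cis (t \<bullet> Z n \<omega>) \<partial>N)) \<longlonglongrightarrow> 0"
    by (rule tendsto_norm_zero_cancel)
  from tendsto_add[OF this char_Z[of t]] show ?thesis by simp
qed

text \<open>\<open>Z\<close> inherits tightness from the normalized score through the bounded map
  \<open>C\<close>, and \<open>X\<close> stays within distance 1 of \<open>Z\<close> up to vanishing
  probability.\<close>

lemma tight_X:
  assumes e: "e > 0"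
  shows "\<exists>K. \<forall>\<^sub>F n in sequentially. measure N {\<omega>\<in>space N. norm (X n \<omega>) > K} \<le> e"
proof -
  obtain B where B: "B > 0" "\<And>n. n > 0 \<Longrightarrow>
      measure N {\<omega>\<in>space N. norm (avg (sc \<theta>s) n \<omega> - 0) \<ge> B / sqrt (real n)} \<le> e / 2"
    using score_deviation[of "e / 2"] e by auto
  obtain b where b: "b > 0" "\<And>u. norm (C u) \<le> b * norm u"
    using linear_bounded_pos[OF C(1)] by blast
  let ?E = "\<lambda>n. {\<omega>\<in>space N. norm (X n \<omega> - Z n \<omega>) \<ge> 1}"
  let ?D = "\<lambda>n. {\<omega>\<in>space N. norm (avg (sc \<theta>s) n \<omega> - 0) \<ge> B / sqrt (real n)}"
  have ev: "?E n \<in> sets N" "?D n \<in> sets N" for n by measurable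
  have "\<forall>\<^sub>F n in sequentially. measure N (?E n) < e / 2"
    using projected_approximation[of 1] e by (intro order_tendstoD) auto
  then have "\<forall>\<^sub>F n in sequentially. measure N {\<omega>\<in>space N. norm (X n \<omega>) > 1 + b * B} \<le> e"
    using eventually_gt_at_top[of 0]
  proof eventually_elim
    case (elim n)
    have "{\<omega>\<in>space N. norm (X n \<omega>) > 1 + b * B} \<subseteq> ?E n \<union> ?D n"
    proof (rule subsetI, rule ccontr)
      fix \<omega> assume \<omega>: "\<omega> \<in> {\<omega>\<in>space N. norm (X n \<omega>) > 1 + b * B}" "\<omega> \<notin> ?E n \<union> ?D n"
      then have 1: "norm (X n \<omega> - Z n \<omega>) < 1" and 2: "norm (avg (sc \<theta>s) n \<omega>) < B / sqrt (real n)" by auto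
      have "norm (Z n \<omega>) \<le> sqrt (real n) * (b * norm (avg (sc \<theta>s) n \<omega>))"
        using b(2) by (simp add: mult_left_mono)
      also have "\<dots> \<le> sqrt (real n) * (b * (B / sqrt (real n)))"
        using 2 b(1) by (intro mult_left_mono) auto
      also have "\<dots> = b * B" using elim(2) by simp
      finally have "norm (X n \<omega>) \<le> 1 + b * B"
        using 1 norm_triangle_ineq[of "X n \<omega> - Z n \<omega>" "Z n \<omega>"] by simp
      then show False using \<omega>(1) by simp
    qed
    then have "measure N {\<omega>\<in>space N. norm (X n \<omega>) > 1 + b * B} \<le> measure N (?E n \<union> ?D n)"
      by (intro N.finite_measure_mono sets.Un ev)
    also have "\<dots> \<le> measure N (?E n) + measure N (?D n)" by (intro measure_Un_le ev)
    finally show ?case using elim(1) B(2)[OF elim(2)] by linarith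
  qed
  then show ?thesis by blast
qed

lemma asymptotic_normality:
  fixes L :: "real^'m \<Rightarrow> real^'m"
  assumes L: "linear L" "L \<circ> adjoint L = C"
  shows "conv_in_dist N X (distr (density lborel (\<lambda>x. ennreal (gauss_density 1 x))) borel L)"
proof (rule conv_in_dist_of_char[OF N.prob_space_axioms prob_space_gauss_image[OF L(1)]])
  show "X n \<in> borel_measurable N" for n by measurable
  have "L (adjoint L t) = C t" for t using L(2) by (auto simp: fun_eq_iff)
  then show "(\<lambda>n. \<integral>\<omega>. cis (t \<bullet> X n \<omega>) \<partial>N) \<longlonglongrightarrow>
      (\<integral>x. cis (t \<bullet> x) \<partial>distr (density lborel (\<lambda>x. ennreal (gauss_density 1 x))) borel L)" for t
    using char_X[of t] by (simp only: integral_cis_gauss_image[OF L(1)])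
qed (simp, rule tight_X)

end

end

section \<open>The quotient distance and the theorem\<close>

context mixture_model
begin

lemma continuous_p_parameter: "continuous_on S (\<lambda>\<theta>. p \<theta> v)"
proof (rule continuous_on_subset[OF _ subset_UNIV])
  show "continuous_on UNIV (\<lambda>\<theta>. p \<theta> v)"
    unfolding continuous_on_sequentially
  proof safe
    fix X and \<theta> :: "real^'m" assume X: "X \<longlonglongrightarrow> \<theta>"
    have "(\<lambda>i. \<integral>z. exp (ea (X i) v z) \<partial>M) \<longlonglongrightarrow> (\<integral>z. exp (ea \<theta> v z) \<partial>M)"
    proof (rule integral_dominated_convergence[where w = "\<lambda>_. 1"])
      have "(\<lambda>i. act z (X i)) \<longlonglongrightarrow> act z \<theta>" for z
        unfolding act_def
        by (intro tendsto_scaleR tendsto_const bounded_linear.tendsto[OF matrix_vector_mul_bounded_linear X])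
      then show "AE z in M. (\<lambda>i. exp (ea (X i) v z)) \<longlonglongrightarrow> exp (ea \<theta> v z)"
        unfolding ea_def using sigma by (intro AE_I2 tendsto_intros) auto
    qed (auto simp: ea_nonpos)
    then show "((\<lambda>\<theta>. p \<theta> v) \<circ> X) \<longlonglongrightarrow> p \<theta> v"
      unfolding p_eq o_def by (intro tendsto_intros)
  qed
qed

lemma obs_class_eq: "obs_class M A \<sigma> \<beta> \<Theta> \<theta> = {\<theta>' \<in> \<Theta>. p \<theta>' = p \<theta>}"
  by (simp add: obs_class_def obs_equiv_iff)

lemma obs_class_eq_iff:
  assumes "\<theta> \<in> \<Theta>"
  shows "obs_class M A \<sigma> \<beta> \<Theta> \<theta> = obs_class M A \<sigma> \<beta> \<Theta> \<theta>' \<longleftrightarrow> p \<theta> = p \<theta>'"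
  using assms unfolding obs_class_eq by auto

text \<open>An intersection of closed conditions, one for each observation. Two maps are allowed so
  that the lemma serves both for a single class and for pairs of varying parameters.\<close>

lemma closed_p_eq:
  fixes f g :: "'x::topological_space \<Rightarrow> real^'m"
  assumes "continuous_on UNIV f" "continuous_on UNIV g"
  shows "closed {x. p (f x) = p (g x)}"
proof -
  have "closed {x. p (f x) v = p (g x) v}" for v
    by (rule closed_Collect_eq)
       (intro continuous_on_compose2[OF continuous_p_parameter[of UNIV]] assms subset_UNIV)+
  then have "closed {x. \<forall>v. p (f x) v = p (g x) v}" by (rule closed_Collect_all)
  then show ?thesis by (simp add: fun_eq_iff)
qed

text \<open>Classes are closed in the compact \<open>\<Theta>\<close>, so the infimum over pairs of
  representatives is a minimum.\<close>

lemma d_eq_attained: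
  assumes \<Theta>: "compact \<Theta>" and \<theta>: "\<theta> \<in> \<Theta>" "\<theta>' \<in> \<Theta>"
  shows "\<exists>a\<in>obs_class M A \<sigma> \<beta> \<Theta> \<theta>. \<exists>b\<in>obs_class M A \<sigma> \<beta> \<Theta> \<theta>'. d_eq M A \<sigma> \<beta> \<Theta> \<theta> \<theta>' = norm (a - b)"
    and "a \<in> obs_class M A \<sigma> \<beta> \<Theta> \<theta> \<Longrightarrow> b \<in> obs_class M A \<sigma> \<beta> \<Theta> \<theta>' \<Longrightarrow> d_eq M A \<sigma> \<beta> \<Theta> \<theta> \<theta>' \<le> norm (a - b)"
proof -
  let ?c = "obs_class M A \<sigma> \<beta> \<Theta>"
  let ?V = "{norm (a - b) | a b. a \<in> ?c \<theta> \<and> b \<in> ?c \<theta>'}"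
  have comp: "compact (?c \<theta>)" for \<theta>
  proof -
    have "?c \<theta> = \<Theta> \<inter> {x. p x = p \<theta>}" by (auto simp: obs_class_eq)
    then show ?thesis using \<Theta> closed_p_eq[of "\<lambda>x. x" "\<lambda>_. \<theta>"] by (auto intro!: compact_Int_closed)
  qed
  have ne: "?c \<theta> \<times> ?c \<theta>' \<noteq> {}" using \<theta> by (auto simp: obs_class_eq)
  have "continuous_on (?c \<theta> \<times> ?c \<theta>') (\<lambda>x. norm (fst x - snd x))" by (intro continuous_intros)
  from continuous_attains_inf[OF compact_Times[OF comp comp] ne this]
  obtain a b where ab: "a \<in> ?c \<theta>" "b \<in> ?c \<theta>'"
    "\<And>a' b'. a' \<in> ?c \<theta> \<Longrightarrow> b' \<in> ?c \<theta>' \<Longrightarrow> norm (a - b) \<le> norm (a' - b')"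
    by fastforce
  have eq: "d_eq M A \<sigma> \<beta> \<Theta> \<theta> \<theta>' = norm (a - b)"
    unfolding d_eq_def by (rule cInf_eq_minimum) (use ab in auto)
  show "\<exists>a\<in>?c \<theta>. \<exists>b\<in>?c \<theta>'. d_eq M A \<sigma> \<beta> \<Theta> \<theta> \<theta>' = norm (a - b)" using ab(1,2) eq by blast
  show "a' \<in> ?c \<theta> \<Longrightarrow> b' \<in> ?c \<theta>' \<Longrightarrow> d_eq M A \<sigma> \<beta> \<Theta> \<theta> \<theta>' \<le> norm (a' - b')" for a' b'
    unfolding eq by (rule ab(3))
qed

text \<open>Serves the measurability of the quotient distance of the estimator. Since the distance
  is attained, the sublevel set is the projection of a compact set of triples: a parameter and
  representatives of the two classes at distance at most \<open>r\<close>.\<close>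

lemma closed_d_eq_le:
  assumes \<Theta>: "compact \<Theta>" and \<theta>': "\<theta>' \<in> \<Theta>"
  shows "closed {\<theta> \<in> \<Theta>. d_eq M A \<sigma> \<beta> \<Theta> \<theta> \<theta>' \<le> r}"
proof -
  let ?S = "{x. p (fst (snd x)) = p (fst x)} \<inter> {x. p (snd (snd x)) = p \<theta>'} \<inter>
    {x. norm (fst (snd x) - snd (snd x)) \<le> r} :: ((real^'m) \<times> (real^'m) \<times> (real^'m)) set"
  have "closed ?S"
    by (intro closed_Int closed_p_eq closed_Collect_le continuous_intros)
  then have "compact ((\<Theta> \<times> \<Theta> \<times> \<Theta>) \<inter> ?S)"
    using \<Theta> by (intro compact_Int_closed compact_Times)
  then have "compact (fst ` ((\<Theta> \<times> \<Theta> \<times> \<Theta>) \<inter> ?S))"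
    by (intro compact_continuous_image continuous_intros)
  also have "fst ` ((\<Theta> \<times> \<Theta> \<times> \<Theta>) \<inter> ?S) = {\<theta> \<in> \<Theta>. d_eq M A \<sigma> \<beta> \<Theta> \<theta> \<theta>' \<le> r}"
  proof (intro set_eqI iffI)
    fix \<theta> assume "\<theta> \<in> fst ` ((\<Theta> \<times> \<Theta> \<times> \<Theta>) \<inter> ?S)"
    then obtain a b where "\<theta> \<in> \<Theta>" "a \<in> obs_class M A \<sigma> \<beta> \<Theta> \<theta>" "b \<in> obs_class M A \<sigma> \<beta> \<Theta> \<theta>'" "norm (a - b) \<le> r"
      by (auto simp: obs_class_eq)
    then show "\<theta> \<in> {\<theta> \<in> \<Theta>. d_eq M A \<sigma> \<beta> \<Theta> \<theta> \<theta>' \<le> r}"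
      using d_eq_attained(2)[OF \<Theta> _ \<theta>', of \<theta> a b] by simp
  next
    fix \<theta> assume \<theta>: "\<theta> \<in> {\<theta> \<in> \<Theta>. d_eq M A \<sigma> \<beta> \<Theta> \<theta> \<theta>' \<le> r}"
    then obtain a b where ab: "a \<in> obs_class M A \<sigma> \<beta> \<Theta> \<theta>" "b \<in> obs_class M A \<sigma> \<beta> \<Theta> \<theta>'"
      "d_eq M A \<sigma> \<beta> \<Theta> \<theta> \<theta>' = norm (a - b)"
      using d_eq_attained(1)[OF \<Theta> _ \<theta>', of \<theta>] by auto
    then have "(\<theta>, a, b) \<in> (\<Theta> \<times> \<Theta> \<times> \<Theta>) \<inter> ?S" using \<theta> by (auto simp: obs_class_eq)
    then show "\<theta> \<in> fst ` ((\<Theta> \<times> \<Theta> \<times> \<Theta>) \<inter> ?S)" by (rule rev_image_eqI) simp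
  qed
  finally show ?thesis by (rule compact_imp_closed)
qed

end

theorem proposition3p3:
  fixes M :: "'z measure" and A :: "'z \<Rightarrow> real^'m^'d" and \<sigma> \<beta> :: real
    and \<Theta> :: "(real^'m) set" and \<theta>s :: "real^'m"
    and N :: "'w measure" and y :: "nat \<Rightarrow> 'w \<Rightarrow> real^'d" and mle :: "nat \<Rightarrow> 'w \<Rightarrow> real^'m"
  assumes model: "obs_model M A \<sigma> \<Theta> \<theta>s"
    and beta: "\<beta> > 0"
    and R: "assumption_R M A \<Theta>"
    and Q: "assumption_Q M A \<sigma> \<beta> \<Theta> \<theta>s"
    and I: "assumption_I M A \<sigma> \<beta> \<Theta> \<theta>s"
    and N: "prob_space N"
    and indep: "prob_space.indep_vars N (\<lambda>_. borel) y UNIV"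
    and dens: "\<And>i. distributed N lborel (y i) (\<lambda>x. ennreal (obs_dens M A \<sigma> \<beta> \<theta>s x))"
    and mle_meas: "\<And>n. mle n \<in> borel_measurable N"
    and mle_in: "\<And>n \<omega>. \<omega> \<in> space N \<Longrightarrow> mle n \<omega> \<in> \<Theta>"
    and mle_max: "\<And>n \<omega> \<theta>. \<omega> \<in> space N \<Longrightarrow> \<theta> \<in> \<Theta> \<Longrightarrow>
      emp_loglik M A \<sigma> \<beta> n (\<lambda>i. y i \<omega>) \<theta> \<le> emp_loglik M A \<sigma> \<beta> n (\<lambda>i. y i \<omega>) (mle n \<omega>)"
  shows "conv_in_prob N (\<lambda>n \<omega>. d_eq M A \<sigma> \<beta> \<Theta> (mle n \<omega>) \<theta>s) 0 \<and>
    (\<exists>rep \<nu>. (\<forall>n. \<forall>\<omega>\<in>space N. rep n \<omega> \<in> obs_class M A \<sigma> \<beta> \<Theta> (mle n \<omega>)) \<and>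
       conv_in_prob N rep \<theta>s \<and>
       centred_normal (fisher_W_inverse M A \<sigma> \<beta> \<Theta> \<theta>s) \<nu> \<and>
       conv_in_dist N
         (\<lambda>n \<omega>. sqrt (real n) *\<^sub>R orth_proj (class_normal M A \<sigma> \<beta> \<Theta> \<theta>s) (rep n \<omega> - \<theta>s)) \<nu>)"
proof -
  interpret N: prob_space N by fact
  note [measurable] = mle_meas
  obtain amax where M: "prob_space M" "\<sigma> > 0" "A \<in> borel_measurable M" and \<theta>s_in: "\<theta>s \<in> \<Theta>" and \<Theta>: "compact \<Theta>"
    and amax: "AE z in M. onorm (\<lambda>x. A z *v x) \<le> amax"
    using model R unfolding obs_model_def assumption_R_def by blast
  \<comment> \<open>The absolute value makes \<open>\<kappa>\<close> nonnegative whatever the sign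
    of the essential bound.\<close>
  define \<kappa> where "\<kappa> = \<beta> * \<bar>amax\<bar>"
  have A_bound: "AE z in M. \<forall>x. norm (\<beta> *\<^sub>R (A z *v x)) \<le> \<kappa> * norm x"
    using amax
  proof eventually_elim
    case (elim z)
    have "norm (A z *v x) \<le> \<bar>amax\<bar> * norm x" for x
      using onorm[OF matrix_vector_mul_bounded_linear, of "A z" x] elim
      by (meson abs_ge_self mult_right_mono norm_ge_zero order.trans)
    then show ?case using beta by (simp add: \<kappa>_def mult.assoc)
  qed
  obtain b where b: "\<And>\<theta>. \<theta> \<in> \<Theta> \<Longrightarrow> norm \<theta> \<le> b"
    using compact_imp_bounded[OF \<Theta>] by (auto simp: bounded_iff)
  have b0: "b \<ge> 0" using b[OF \<theta>s_in] norm_ge_zero[of \<theta>s] by linarith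
  \<comment> \<open>The 1 keeps the radius positive even for \<open>b = 0\<close> and leaves unit
    room around \<open>\<theta>s\<close>.\<close>
  define R0 where "R0 = 3 * (b + 1)"
  have R0: "\<And>\<theta>. \<theta> \<in> \<Theta> \<Longrightarrow> norm \<theta> \<le> R0 / 3" "norm \<theta>s + 1 \<le> R0" "R0 > 0"
  proof -
    show "norm \<theta> \<le> R0 / 3" if "\<theta> \<in> \<Theta>" for \<theta> using b[OF that] by (simp add: R0_def)
  qed (use b[OF \<theta>s_in] b0 in \<open>simp_all add: R0_def\<close>)
  have "mixture_model M A \<sigma> \<beta> \<kappa> R0"
    using M A_bound R0(3) beta by (auto simp: mixture_model_def mixture_model_axioms_def \<kappa>_def)
  moreover have law: "distr N borel (y i) = obs_law M A \<sigma> \<beta> \<theta>s" for i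
    using distributed_distr_eq_density[OF dens[of i]] by (simp add: obs_law_def cong: distr_cong)
  ultimately interpret mixture_sample M A \<sigma> \<beta> \<kappa> R0 N y \<theta>s
    using N indep R0(2) by (simp add: mixture_sample_def mixture_sample_axioms_def)
  let ?cls = "obs_class M A \<sigma> \<beta> \<Theta>" and ?W = "class_normal M A \<sigma> \<beta> \<Theta> \<theta>s"
  have cls_s: "{x \<in> \<Theta>. ?cls x = ?cls \<theta>s} = ?cls \<theta>s"
    using obs_class_eq_iff[of _ \<Theta> \<theta>s] by (auto simp: obs_class_eq)
  obtain U E \<A> where U: "open U" "\<theta>s \<in> U" "U \<subseteq> \<Theta>"
      "openin (quotient_topology (top_of_set \<Theta>) ?cls) (?cls ` U)"
      "C2_manifold (subtopology (quotient_topology (top_of_set \<Theta>) ?cls) (?cls ` U)) (E :: (real^'m) set) \<A>"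
      "C2_submersion U (subtopology (quotient_topology (top_of_set \<Theta>) ?cls) (?cls ` U)) E \<A> ?cls"
    using Q unfolding assumption_Q_def Let_def by blast
  obtain G r where G: "openin (top_of_set \<Theta>) G" and cG: "?cls \<theta>s \<subseteq> G" and r: "continuous_on G r"
    "\<And>x. x \<in> G \<Longrightarrow> r x \<in> \<Theta>" "\<And>x. x \<in> G \<Longrightarrow> ?cls (r x) = ?cls x" "\<And>x. x \<in> G \<Longrightarrow> r x - \<theta>s \<in> ?W"
    and rs: "\<And>x. x \<in> \<Theta> \<Longrightarrow> ?cls x = ?cls \<theta>s \<Longrightarrow> r x = \<theta>s"
    using local_section[OF U] unfolding cls_s class_tangent_def[symmetric] class_normal_def[symmetric] by blast
  \<comment> \<open>Outside \<open>G\<close> the estimator represents itself; there only membership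
    in the class and measurability matter, since this event has vanishing probability.\<close>
  define f where "f x = (if x \<in> G then r x else x)" for x
  define rep where "rep n \<omega> = f (mle n \<omega>)" for n \<omega>
  have G_sets: "G \<in> sets borel"
    using G \<Theta> compact_imp_closed[OF \<Theta>] by (auto simp: openin_open)
  have "f \<in> borel_measurable borel"
    unfolding f_def[abs_def]
    by (subst measurable_If_restrict_space_iff)
       (use G_sets borel_measurable_continuous_on_restrict[OF r(1)] in
         \<open>auto intro!: measurable_restrict_space1\<close>)
  then have rep[measurable]: "rep n \<in> borel_measurable N" for n
    unfolding rep_def[abs_def] by measurable
  have rep_cls: "rep n \<omega> \<in> ?cls (mle n \<omega>)" if "\<omega> \<in> space N" for n \<omega>
  proof (cases "mle n \<omega> \<in> G")
    case True
    have "p (r (mle n \<omega>)) = p (mle n \<omega>)"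
      using r(3)[OF True] obs_class_eq_iff[OF r(2)[OF True]] by blast
    then show ?thesis using True r(2)[OF True] by (simp add: rep_def f_def obs_class_eq)
  qed (use mle_in[OF that] in \<open>simp add: rep_def f_def obs_class_eq\<close>)
  \<comment> \<open>The parameters outside the domain of the section or sent by it at least
    \<open>e\<close> away from \<open>\<theta>s\<close>. This set is compact and misses the class of
    \<open>\<theta>s\<close>, where \<open>r\<close> is constantly \<open>\<theta>s\<close>; by
    identifiability its points have smaller population likelihood.\<close>
  define K where "K e = \<Theta> - {x \<in> G. dist (r x) \<theta>s < e}" for e
  have K0: "(\<lambda>n. measure N {\<omega>\<in>space N. mle n \<omega> \<in> K e}) \<longlonglongrightarrow> 0"
    and K_sets: "K e \<in> sets borel" if e: "e > 0" for e
  proof -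
    have "G \<inter> r -` ball \<theta>s e = {x \<in> G. dist (r x) \<theta>s < e}" by (auto simp: dist_commute)
    with continuous_openin_preimage_gen[OF r(1) open_ball, of \<theta>s e]
    have "openin (top_of_set G) {x \<in> G. dist (r x) \<theta>s < e}" by (simp only:)
    then have "openin (top_of_set \<Theta>) {x \<in> G. dist (r x) \<theta>s < e}" using G by (rule openin_trans)
    from closedin_diff[OF closedin_topspace this]
    have "closedin (top_of_set \<Theta>) (K e)" by (simp add: K_def)
    then have comp: "compact (K e)" using \<Theta> by (rule closedin_compact[rotated])
    then show "K e \<in> sets borel" by (rule borel_compact)
    show "(\<lambda>n. measure N {\<omega>\<in>space N. mle n \<omega> \<in> K e}) \<longlonglongrightarrow> 0"
    proof (rule maximizer_avoids_compact[OF comp])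
      fix \<theta> assume \<theta>: "\<theta> \<in> K e"
      then have \<theta>T: "\<theta> \<in> \<Theta>" by (simp add: K_def)
      then show "norm \<theta> \<le> R0 / 3" by (rule R0)
      have "\<not> obs_equiv M A \<sigma> \<beta> \<theta> \<theta>s"
      proof
        assume "obs_equiv M A \<sigma> \<beta> \<theta> \<theta>s"
        then have "?cls \<theta> = ?cls \<theta>s" "\<theta> \<in> ?cls \<theta>s"
          using \<theta>T by (auto simp: obs_equiv_iff obs_class_eq)
        then show False using \<theta> rs[OF \<theta>T] cG e by (auto simp: K_def)
      qed
      then show "pop_loglik M A \<sigma> \<beta> \<theta>s \<theta> < pop_loglik M A \<sigma> \<beta> \<theta>s \<theta>s"
        using I \<theta>T unfolding assumption_I_def by (meson order.not_eq_order_implies_strict)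
    qed (use R0(1)[OF \<theta>s_in] mle_max[OF _ \<theta>s_in] in auto)
  qed
  \<comment> \<open>A representative far from \<open>\<theta>s\<close> forces the estimator into
    \<open>K e\<close>; in the same way one off the slice forces it into \<open>K 1\<close>.\<close>
  have cons: "(\<lambda>n. measure N {\<omega>\<in>space N. dist (rep n \<omega>) \<theta>s \<ge> e}) \<longlonglongrightarrow> 0" if e: "e > 0" for e
  proof (rule tendsto_zero_if_le[OF measure_nonneg _ K0[OF e]])
    fix n
    have [measurable]: "K e \<in> sets borel" by (rule K_sets[OF e])
    have ev: "{\<omega>\<in>space N. mle n \<omega> \<in> K e} \<in> sets N" by measurable
    show "measure N {\<omega>\<in>space N. dist (rep n \<omega>) \<theta>s \<ge> e} \<le> measure N {\<omega>\<in>space N. mle n \<omega> \<in> K e}"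
      using mle_in by (intro N.finite_measure_mono[OF _ ev]) (auto simp: K_def rep_def f_def)
  qed
  have inW: "(\<lambda>n. measure N {\<omega>\<in>space N. rep n \<omega> - \<theta>s \<notin> ?W}) \<longlonglongrightarrow> 0"
  proof (rule tendsto_zero_if_le[OF measure_nonneg _ K0[OF zero_less_one]])
    fix n
    have [measurable]: "K 1 \<in> sets borel" by (rule K_sets) simp
    have ev: "{\<omega>\<in>space N. mle n \<omega> \<in> K 1} \<in> sets N" by measurable
    show "measure N {\<omega>\<in>space N. rep n \<omega> - \<theta>s \<notin> ?W} \<le> measure N {\<omega>\<in>space N. mle n \<omega> \<in> K 1}"
      using mle_in r(4) by (intro N.finite_measure_mono[OF _ ev]) (auto simp: K_def rep_def f_def)
  qed
  \<comment> \<open>\<open>U\<close> is open in the ambient space, so every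
    \<open>\<theta>s + w\<close> with small \<open>w\<close> competes with the estimator; the
    representative has the density of the estimator and hence its likelihood.\<close>
  obtain e0 where e0: "e0 > 0" "ball \<theta>s e0 \<subseteq> U" using U(1,2) by (rule openE)
  have opt: "emp_loglik M A \<sigma> \<beta> n (\<lambda>i. y i \<omega>) (\<theta>s + w) \<le> emp_loglik M A \<sigma> \<beta> n (\<lambda>i. y i \<omega>) (rep n \<omega>)"
    if "\<omega> \<in> space N" "norm w \<le> e0 / 2" for n \<omega> w
  proof -
    have "\<theta>s + w \<in> ball \<theta>s e0" using that(2) e0(1) by (simp add: dist_norm)
    then have "\<theta>s + w \<in> \<Theta>" using e0(2) U(3) by blast
    moreover have "p (rep n \<omega>) = p (mle n \<omega>)" using rep_cls[OF that(1)] by (simp add: obs_class_eq)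
    ultimately show ?thesis using mle_max[OF that(1), of "\<theta>s + w" n] by (simp add: emp_loglik_def)
  qed
  let ?C = "fisher_W_inverse M A \<sigma> \<beta> \<Theta> \<theta>s" and ?I = "fisher_obs M A \<sigma> \<beta> \<theta>s"
  have W: "subspace ?W" unfolding class_normal_def by (rule subspace_orthogonal_comp)
  have pos: "w \<bullet> (?I *v w) > 0" if "w \<in> ?W" "w \<noteq> 0" for w
    using I that unfolding assumption_I_def by blast
  have C: "?C = (\<lambda>u. inv_into ?W (compression ?I ?W) (orth_proj ?W u))"
    by (simp add: fun_eq_iff fisher_W_inverse_def fisher_W_def Let_def)
  have Cp: "\<exists>L::real^'m \<Rightarrow> real^'m. linear L \<and> L \<circ> adjoint L = ?C" "linear ?C" "?C u \<in> ?W"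
    "h \<in> ?W \<Longrightarrow> h \<bullet> (?I *v ?C u) = h \<bullet> u" "t \<bullet> ?C u = ?C t \<bullet> u" for u h t
    unfolding C by (rule compression_inverse[OF fisher_commute W pos]; assumption)+
  obtain L :: "real^'m \<Rightarrow> real^'m" where L: "linear L" "L \<circ> adjoint L = ?C" using Cp(1) by blast
  let ?\<nu> = "distr (density lborel (\<lambda>x. ennreal (gauss_density 1 x))) borel L"
  have opt': "emp_loglik M A \<sigma> \<beta> n (\<lambda>i. y i \<omega>) (\<theta>s + w) \<le> emp_loglik M A \<sigma> \<beta> n (\<lambda>i. y i \<omega>) (rep n \<omega>)"
    if "\<omega> \<in> space N" "w \<in> ?W" "norm w \<le> e0 / 2" for n \<omega> w
    using that(1,3) by (rule opt)
  have e0': "e0 / 2 > 0" using e0(1) by simp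
  have dist: "conv_in_dist N (\<lambda>n \<omega>. sqrt (real n) *\<^sub>R orth_proj ?W (rep n \<omega> - \<theta>s)) ?\<nu>"
    using W pos Cp(2-5) rep cons inW e0' opt' L by (rule asymptotic_normality)
  have normal: "centred_normal ?C ?\<nu>"
    unfolding centred_normal_def using L by blast
  have repc: "conv_in_prob N rep \<theta>s"
    unfolding conv_in_prob_def
  proof (intro conjI allI impI rep)
    fix e :: real assume e: "e > 0"
    show "(\<lambda>n. measure N {\<omega>\<in>space N. dist (rep n \<omega>) \<theta>s > e}) \<longlonglongrightarrow> 0"
      by (rule tendsto_zero_if_le[OF measure_nonneg _ cons[OF e]])
         (auto intro!: N.finite_measure_mono)
  qed
  have deqc: "conv_in_prob N (\<lambda>n \<omega>. d_eq M A \<sigma> \<beta> \<Theta> (mle n \<omega>) \<theta>s) 0"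
    unfolding conv_in_prob_def
  proof (intro conjI allI impI)
    fix n
    show "(\<lambda>\<omega>. d_eq M A \<sigma> \<beta> \<Theta> (mle n \<omega>) \<theta>s) \<in> borel_measurable N"
      unfolding borel_measurable_iff_le
    proof
      fix c
      let ?S = "{\<theta> \<in> \<Theta>. d_eq M A \<sigma> \<beta> \<Theta> \<theta> \<theta>s \<le> c}"
      have [measurable]: "?S \<in> sets borel" using closed_d_eq_le[OF \<Theta> \<theta>s_in] by simp
      have "{\<omega> \<in> space N. d_eq M A \<sigma> \<beta> \<Theta> (mle n \<omega>) \<theta>s \<le> c} = {\<omega> \<in> space N. mle n \<omega> \<in> ?S}"
        using mle_in by auto
      also have "\<dots> \<in> sets N" by measurable
      finally show "{\<omega> \<in> space N. d_eq M A \<sigma> \<beta> \<Theta> (mle n \<omega>) \<theta>s \<le> c} \<in> sets N" .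
    qed
  next
    fix e :: real assume e: "e > 0"
    \<comment> \<open>The representative and \<open>\<theta>s\<close> form an admissible pair in the
      infimum, so consistency on the quotient follows from that of the representative.\<close>
    have le: "dist (d_eq M A \<sigma> \<beta> \<Theta> (mle n \<omega>) \<theta>s) 0 \<le> dist (rep n \<omega>) \<theta>s" if "\<omega> \<in> space N" for n \<omega>
    proof -
      have "\<theta>s \<in> ?cls \<theta>s" using \<theta>s_in by (simp add: obs_class_eq)
      then have "d_eq M A \<sigma> \<beta> \<Theta> (mle n \<omega>) \<theta>s \<le> norm (rep n \<omega> - \<theta>s)"
        using d_eq_attained(2)[OF \<Theta> mle_in[OF that] \<theta>s_in rep_cls[OF that]] by blast
      moreover have "0 \<le> d_eq M A \<sigma> \<beta> \<Theta> (mle n \<omega>) \<theta>s"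
        using d_eq_attained(1)[OF \<Theta> mle_in[OF that] \<theta>s_in, of n] by auto
      ultimately show ?thesis by (simp add: dist_norm)
    qed
    show "(\<lambda>n. measure N {\<omega>\<in>space N. dist (d_eq M A \<sigma> \<beta> \<Theta> (mle n \<omega>) \<theta>s) 0 > e}) \<longlonglongrightarrow> 0"
    proof (rule tendsto_zero_if_le[OF measure_nonneg _ cons[OF e]])
      fix n
      have "{\<omega>\<in>space N. dist (d_eq M A \<sigma> \<beta> \<Theta> (mle n \<omega>) \<theta>s) 0 > e} \<subseteq> {\<omega>\<in>space N. dist (rep n \<omega>) \<theta>s \<ge> e}"
      proof (intro subsetI CollectI conjI)
        fix \<omega> assume "\<omega> \<in> {\<omega>\<in>space N. dist (d_eq M A \<sigma> \<beta> \<Theta> (mle n \<omega>) \<theta>s) 0 > e}"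
        then show "\<omega> \<in> space N" "dist (rep n \<omega>) \<theta>s \<ge> e" using le[of \<omega> n] by auto
      qed
      then show "measure N {\<omega>\<in>space N. dist (d_eq M A \<sigma> \<beta> \<Theta> (mle n \<omega>) \<theta>s) 0 > e} \<le>
          measure N {\<omega>\<in>space N. dist (rep n \<omega>) \<theta>s \<ge> e}"
        by (rule N.finite_measure_mono) measurable
    qed
  qed
  show ?thesis using dist normal repc deqc rep_cls by blast
qed

end
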